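(* Let $G_\theta=\mathbb{R}^s\times(\mathbb{R}^k\ltimes_\theta\mathbb{H}^q)$ be a hyper-Kähler Lie group as described in the context, with $s+k=4p$ and $\theta$ a real $q\times k$ matrix of rank $k$. Let $L\subset\mathbb{R}^k$ be the connected closed abelian subgroup with Lie algebra $\mathfrak{l}=\operatorname{span}_{\mathbb{R}}\{e_1,\dots,e_l\}$, isotropic with respect to $\omega_\alpha$ for each $\alpha=1,2,3$, acting on $G_\theta$ by left translations $(V,(X,W))\mapsto(V+X,\theta(V)W)$, with hyper-Kähler moment map $\mu^\theta$. Then the local expression of the hyper-Kähler metric on the quotient $L\backslash(\mu^\theta)^{-1}(0)$ is $h=h_0+h_1$, where $h_0$ is the Euclidean metric on $\mathbb{R}^{4p-4l}$ and, in suitable local coordinates $(\tau_\beta,\mathbf{r}_\beta)$, $\beta=1,\dots,q$, $$h_1=\tfrac14 H_{\beta\gamma}\,d\mathbf{r}_\beta\cdot d\mathbf{r}_\gamma+\tfrac14 H^{\beta\gamma}\,(d\tau_\beta+\boldsymbol{\Omega}_{\beta\delta}\cdot d\mathbf{r}_\delta)(d\tau_\gamma+\boldsymbol{\Omega}_{\gamma\epsilon}\cdot d\mathbf{r}_\epsilon)$$ (summation over repeated indices from $1$ to $q$), with $$H_{\beta\gamma}=(\tilde\theta\,\tilde\theta^t)_{\beta\gamma}+\frac{1}{r_\beta}\,\delta_{\beta\gamma},$$ where $\tilde\theta$ is the $q\times l$ matrix obtained from $\theta$ by deleting the last $k-l$ columns, $\tilde\theta^t$ is its transpose, $r_\beta=|\mathbf{r}_\beta|$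 and $(H^{\beta\gamma})$ is the inverse of the matrix $(H_{\beta\gamma})$.
   Context: $\theta=(\theta_\beta^\alpha)$ has rows $\theta_1,\dots,\theta_q\in\mathbb{R}^k$; $\langle\cdot,\cdot\rangle$ is the Euclidean inner product on $\mathbb{R}^k$, and $e_1,\dots,e_k$ is the standard orthonormal basis of $\mathbb{R}^k$. For $T\in\mathbb{R}^k$ and $W=(W_1,\dots,W_q)\in\mathbb{H}^q$ put $$\rho_\theta(T)W=(\langle T,\theta_1\rangle\, iW_1,\dots,\langle T,\theta_q\rangle\, iW_q),\qquad \theta(T)W=(e^{i\langle T,\theta_1\rangle}W_1,\dots,e^{i\langle T,\theta_q\rangle}W_q),$$ extended to $\mathbb{R}^s\times\mathbb{R}^k=\mathbb{R}^{4p}$ by letting $\mathbb{R}^s$ act trivially. $G_\theta$ is the simply connected Lie group with underlying manifold $\mathbb{R}^{4p}\times\mathbb{H}^q$ and product $(X,W)\cdot(X',W')=(X+X',\,W+\theta(X)W')$. Its left invariant hyper-Kähler structure: $g$ is the Euclidean metric on $\mathbb{R}^{4p}\times\mathbb{H}^q$; $J_1,J_2,J_3=J_1J_2$ are given on $\mathbb{H}^q$ by right multiplication by $-i,-j,-k$, and on $\mathbb{R}^{4p}$ by a triple of orthogonal constant endomorphisms satisfying the quaternion relations; $\omega_\alpha(\cdot,\cdot)=g(J_\alpha\cdot,\cdot)$. The hyper-Kähler moment map is $\mu^\theta=\mu_1^\theta i+\mu_2^\theta j+\mu_3^\theta k:G_\theta\to\mathfrak{l}^*\otimes\operatorname{Im}\mathbb{H}$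 with $\mu^\theta_\alpha(X,W)(V)=\omega_\alpha(V,X)+\frac12\omega_\alpha(\rho_\theta(V)W,W)$ for $V\in\mathfrak{l}$. The hyper-Kähler metric on $L\backslash(\mu^\theta)^{-1}(0)$ is the one making $(\mu^\theta)^{-1}(0)\to L\backslash(\mu^\theta)^{-1}(0)$ a Riemannian submersion. Coordinates: $\mathbf{r}_\beta=\overline{W_\beta}\,iW_\beta\in\operatorname{Im}\mathbb{H}\cong\mathbb{R}^3$, which descends to the quotient, and the expression holds locally where all $r_\beta\ne0$. The $\tau_\beta$ are local real coordinates such that the $\partial/\partial\tau_\beta$ are Killing vector fields generating the action of the torus $T^q$ on the quotient induced by $(X,W)\mapsto(X,(e^{i\phi_1}W_1,\dots,e^{i\phi_q}W_q))$. $\boldsymbol{\Omega}_{\beta\delta}=\delta_{\beta\delta}\boldsymbol{\Omega}_\beta$, where $\boldsymbol{\Omega}_\beta=\boldsymbol{\Omega}_\beta(\mathbf{r}_\beta)$ is a local $\mathbb{R}^3$-valued function with $\operatorname{curl}(\boldsymbol{\Omega}_\beta)=\operatorname{grad}(1/r_\beta)$ (curl and grad with respect to the Euclidean metric on $\mathbb{R}^3$ with cartesian coordinates $\mathbf{r}_\beta$). *)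

theory Defs
  imports "HOL-Analysis.Analysis"
begin

section \<open>Smooth maps, charts and Riemannian submersions\<close>

text \<open>On an open subset of a Euclidean space: \<open>C\<^sup>n\<close> in the usual sense, by recursion on
  directional derivatives.\<close>

primrec Ck_on :: "nat \<Rightarrow> 'a::real_normed_vector set \<Rightarrow> ('a \<Rightarrow> 'b::real_normed_vector) \<Rightarrow> bool" where
  "Ck_on 0 U f \<longleftrightarrow> continuous_on U f"
| "Ck_on (Suc n) U f \<longleftrightarrow> (\<forall>x\<in>U. f differentiable (at x)) \<and>
     (\<forall>v. Ck_on n U (\<lambda>x. frechet_derivative f (at x) v))"

definition smooth_on :: "'a::real_normed_vector set \<Rightarrow> ('a \<Rightarrow> 'b::real_normed_vector) \<Rightarrow> bool" where
  "smooth_on U f \<longleftrightarrow> (\<forall>n. Ck_on n U f)"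

text \<open>For an arbitrary subset \<open>S\<close> (used with open subsets of a submanifold): local extendability
  to a smooth map of the ambient space.\<close>

definition smooth_map_on :: "'a::real_normed_vector set \<Rightarrow> ('a \<Rightarrow> 'b::real_normed_vector) \<Rightarrow> bool" where
  "smooth_map_on S f \<longleftrightarrow>
     (\<forall>x\<in>S. \<exists>U F. open U \<and> x \<in> U \<and> smooth_on U F \<and> (\<forall>y\<in>S \<inter> U. F y = f y))"

text \<open>Velocities at \<open>P\<close> of curves in \<open>M\<close>; for an embedded submanifold this is the tangent space.\<close>

definition tangent_space :: "'a::real_normed_vector set \<Rightarrow> 'a \<Rightarrow> 'a set" where
  "tangent_space M P =
     {v. \<exists>c. c 0 = P \<and> (\<forall>\<^sub>F t in nhds 0. c t \<in> M) \<and> (c has_vector_derivative v) (at (0::real))}"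

definition horizontal_space :: "'a::real_inner set \<Rightarrow> ('a \<Rightarrow> 'c) \<Rightarrow> 'a \<Rightarrow> 'a set" where
  "horizontal_space M \<pi> P =
     {u \<in> tangent_space M P. \<forall>v \<in> tangent_space {P' \<in> M. \<pi> P' = \<pi> P} P. u \<bullet> v = 0}"

text \<open>Let \<open>M\<close> be a submanifold of a Euclidean space and \<open>\<pi>\<close> a map on \<open>M\<close>.  The image \<open>\<pi> ` M\<close>
  carries the quotient topology and the unique smooth structure (if any) that makes \<open>\<pi>\<close> a
  submersion.  A map \<open>\<phi>\<close> on an open set \<open>D\<close> of the quotient, with values in the linear space \<open>B\<close>,
  is a chart of that structure iff it is injective with open image and \<open>\<phi> \<circ> \<pi>\<close> is a smooth
  submersion onto its image.

  The derivative within \<open>M\<close> is only determined on vectors tangent to \<open>M\<close>, and it is applied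
  to such vectors only.\<close>

definition quotient_chart ::
  "'a::real_normed_vector set \<Rightarrow> ('a \<Rightarrow> 'c) \<Rightarrow> 'e::real_normed_vector set \<Rightarrow> 'c set \<Rightarrow> ('c \<Rightarrow> 'e) \<Rightarrow> bool" where
  "quotient_chart M \<pi> B D \<phi> \<longleftrightarrow>
     D \<subseteq> \<pi> ` M \<and> openin (top_of_set M) {P \<in> M. \<pi> P \<in> D} \<and>
     inj_on \<phi> D \<and> openin (top_of_set B) (\<phi> ` D) \<and>
     smooth_map_on {P \<in> M. \<pi> P \<in> D} (\<phi> \<circ> \<pi>) \<and>
     (\<forall>P\<in>M. \<pi> P \<in> D \<longrightarrow>
        frechet_derivative (\<phi> \<circ> \<pi>) (at P within M) ` tangent_space M P = B)"

text \<open>\<open>h\<close> is the expression in the chart \<open>\<phi>\<close> of the metric on \<open>\<pi> ` M\<close> for which \<open>\<pi>\<close> is a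
  Riemannian submersion, \<open>M\<close> having the metric induced from the ambient Euclidean space:
  the differential of \<open>\<pi>\<close> is isometric on horizontal vectors.  In a \<open>quotient_chart\<close> the
  horizontal vectors map onto \<open>B\<close>, so this determines \<open>h\<close>.\<close>

definition submersion_metric_in_chart ::
  "'a::real_inner set \<Rightarrow> ('a \<Rightarrow> 'c) \<Rightarrow> 'c set \<Rightarrow> ('c \<Rightarrow> 'e::real_normed_vector) \<Rightarrow>
   ('e \<Rightarrow> 'e \<Rightarrow> 'e \<Rightarrow> real) \<Rightarrow> bool" where
  "submersion_metric_in_chart M \<pi> D \<phi> h \<longleftrightarrow>
     (\<forall>P\<in>M. \<pi> P \<in> D \<longrightarrow>
       (let d = frechet_derivative (\<phi> \<circ> \<pi>) (at P within M) in
        \<forall>u\<in>horizontal_space M \<pi> P. \<forall>v\<in>horizontal_space M \<pi> P.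
          h (\<phi> (\<pi> P)) (d u) (d v) = u \<bullet> v))"

section \<open>Quaternions\<close>

text \<open>A quaternion is a pair of its real part and its imaginary part in \<open>Im \<H> \<cong> \<real>\<^sup>3\<close>;
  the inner product of the product type is the Euclidean one.\<close>

type_synonym quat = "real \<times> (real^3)"

definition qmul :: "quat \<Rightarrow> quat \<Rightarrow> quat" (infixl "\<odot>" 70) where
  "x \<odot> y = (fst x * fst y - snd x \<bullet> snd y,
            fst x *\<^sub>R snd y + fst y *\<^sub>R snd x + cross3 (snd x) (snd y))"

definition qcnj :: "quat \<Rightarrow> quat" where
  "qcnj x = (fst x, - snd x)"

text \<open>\<open>qunit 1\<close>, \<open>qunit 2\<close>, \<open>qunit 3\<close> are \<open>i\<close>, \<open>j\<close>, \<open>k\<close>.\<close>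

definition qunit :: "3 \<Rightarrow> quat" where
  "qunit \<alpha> = (0, axis \<alpha> 1)"

definition qexp_i :: "real \<Rightarrow> quat" where
  "qexp_i t = (cos t, sin t *\<^sub>R axis 1 1)"

section \<open>The hyper-Kaehler Lie group\<close>

text \<open>The coordinates of \<open>\<real>\<^sup>s \<times> \<real>\<^sup>k = \<real>\<^sup>4\<^sup>p\<close> are indexed by a type \<open>'n\<close>; which of them
  belong to \<open>\<real>\<^sup>k\<close> is specified by a set of indices \<open>K\<close>, and \<open>e\<^sub>1, \<dots>, e\<^sub>l\<close> are the basis vectors
  with index in \<open>\<Lambda> \<subseteq> K\<close> (so \<open>s = 0\<close>, \<open>k = 0\<close>, \<open>l = 0\<close>, \<open>l = k\<close> are all possible, and the
  numbering of the coordinates is immaterial).  Row \<open>\<beta>\<close> of \<open>\<theta>\<close> is padded to a vector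
  \<open>\<theta> $ \<beta>\<close> of \<open>\<real>\<^sup>4\<^sup>p\<close> whose components outside \<open>K\<close> are \<open>0\<close>; this is the extension of
  \<open>\<rho>\<^sub>\<theta>\<close> and \<open>\<theta>\<close> to \<open>\<real>\<^sup>s \<times> \<real>\<^sup>k\<close> by the trivial action of \<open>\<real>\<^sup>s\<close>.\<close>

type_synonym ('n, 'q) group_space = "(real^'n) \<times> (quat^'q)"

definition rho :: "real^'n^'q \<Rightarrow> real^'n \<Rightarrow> quat^'q \<Rightarrow> quat^'q" where
  "rho \<theta> T W = (\<chi> \<beta>. (T \<bullet> \<theta> $ \<beta>) *\<^sub>R (qunit 1 \<odot> W $ \<beta>))"

definition theta_act :: "real^'n^'q \<Rightarrow> real^'n \<Rightarrow> quat^'q \<Rightarrow> quat^'q" where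
  "theta_act \<theta> T W = (\<chi> \<beta>. qexp_i (T \<bullet> \<theta> $ \<beta>) \<odot> W $ \<beta>)"

fun gmul :: "real^'n^'q \<Rightarrow> ('n, 'q) group_space \<Rightarrow> ('n, 'q) group_space \<Rightarrow> ('n, 'q) group_space" where
  "gmul \<theta> (X, W) (X', W') = (X + X', W + theta_act \<theta> X W')"

text \<open>Orthogonal endomorphisms of \<open>\<real>\<^sup>4\<^sup>p\<close> satisfying the quaternion relations.\<close>

definition quaternionic_triple :: "(3 \<Rightarrow> real^'n \<Rightarrow> real^'n) \<Rightarrow> bool" where
  "quaternionic_triple J \<longleftrightarrow>
     (\<forall>\<alpha>. orthogonal_transformation (J \<alpha>)) \<and>
     (\<forall>\<alpha> X. J \<alpha> (J \<alpha> X) = - X) \<and>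
     (\<forall>X. J 1 (J 2 X) = J 3 X) \<and> (\<forall>X. J 2 (J 1 X) = - J 3 X)"

fun cplx_struct ::
  "(3 \<Rightarrow> real^'n \<Rightarrow> real^'n) \<Rightarrow> 3 \<Rightarrow> ('n, 'q::finite) group_space \<Rightarrow> ('n, 'q) group_space" where
  "cplx_struct J \<alpha> (X, W) = (J \<alpha> X, \<chi> \<beta>. W $ \<beta> \<odot> (- qunit \<alpha>))"

definition kahler_form ::
  "(3 \<Rightarrow> real^'n \<Rightarrow> real^'n) \<Rightarrow> 3 \<Rightarrow> ('n, 'q::finite) group_space \<Rightarrow> ('n, 'q) group_space \<Rightarrow> real" where
  "kahler_form J \<alpha> u v = cplx_struct J \<alpha> u \<bullet> v"

text \<open>The Lie algebra \<open>span {e\<^sub>1, \<dots>, e\<^sub>l}\<close>, and the connected subgroup \<open>L\<close> it generates; the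
  exponential map of \<open>\<real>\<^sup>k\<close> is the identity.\<close>

definition lie_l :: "'n::finite set \<Rightarrow> (real^'n) set" where
  "lie_l \<Lambda> = span ((\<lambda>a. axis a 1) ` \<Lambda>)"

definition subgroup_L :: "'n::finite set \<Rightarrow> ('n, 'q::finite) group_space set" where
  "subgroup_L \<Lambda> = (\<lambda>V. (V, 0)) ` lie_l \<Lambda>"

text \<open>The value lies in \<open>\<real>\<^sup>3 \<cong> Im \<H>\<close>, with components \<open>\<mu>\<^sub>1\<close>, \<open>\<mu>\<^sub>2\<close>, \<open>\<mu>\<^sub>3\<close>; \<open>V\<close> ranges over the
  Lie algebra of \<open>L\<close>.\<close>

fun moment_map ::
  "(3 \<Rightarrow> real^'n \<Rightarrow> real^'n) \<Rightarrow> real^'n^'q \<Rightarrow> ('n, 'q) group_space \<Rightarrow> real^'n \<Rightarrow> real^3" where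
  "moment_map J \<theta> (X, W) V =
     (\<chi> \<alpha>. kahler_form J \<alpha> ((V, 0) :: ('n, 'q) group_space) (X, 0)
         + 1/2 * kahler_form J \<alpha> ((0, rho \<theta> V W) :: ('n, 'q) group_space) (0, W))"

definition zero_level ::
  "(3 \<Rightarrow> real^'n \<Rightarrow> real^'n) \<Rightarrow> real^'n^'q \<Rightarrow> 'n::finite set \<Rightarrow> ('n, 'q) group_space set" where
  "zero_level J \<theta> \<Lambda> = {P. \<forall>V\<in>lie_l \<Lambda>. moment_map J \<theta> P V = 0}"

text \<open>The projection to the space of \<open>L\<close>-orbits.\<close>

definition orbit ::
  "real^'n^'q \<Rightarrow> 'n::finite set \<Rightarrow> ('n, 'q) group_space \<Rightarrow> ('n, 'q) group_space set" where
  "orbit \<theta> \<Lambda> P = (\<lambda>g. gmul \<theta> g P) ` subgroup_L \<Lambda>"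

section \<open>Coordinates and the metric\<close>

definition rvec :: "('n::finite, 'q::finite) group_space \<Rightarrow> (real^3)^'q" where
  "rvec P = (\<chi> \<beta>. snd (qcnj (snd P $ \<beta>) \<odot> qunit 1 \<odot> snd P $ \<beta>))"

fun torus_act :: "real^'q \<Rightarrow> ('n, 'q) group_space \<Rightarrow> ('n, 'q) group_space" where
  "torus_act t (X, W) = (X, \<chi> \<beta>. qexp_i (t $ \<beta>) \<odot> W $ \<beta>)"

definition grad :: "(real^3 \<Rightarrow> real) \<Rightarrow> real^3 \<Rightarrow> real^3" where
  "grad f x = (\<chi> i. frechet_derivative f (at x) (axis i 1))"

definition curl :: "(real^3 \<Rightarrow> real^3) \<Rightarrow> real^3 \<Rightarrow> real^3" where
  "curl A x = (let pd = (\<lambda>i j. frechet_derivative A (at x) (axis i 1) $ j) in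
     vector [pd 2 3 - pd 3 2, pd 3 1 - pd 1 3, pd 1 2 - pd 2 1])"

definition local_potential :: "(real^3) set \<Rightarrow> (real^3 \<Rightarrow> real^3) \<Rightarrow> bool" where
  "local_potential U A \<longleftrightarrow> open U \<and> 0 \<notin> U \<and> smooth_on U A \<and>
     (\<forall>x\<in>U. curl A x = grad (\<lambda>y. 1 / norm y) x)"

text \<open>\<open>\<real>\<^sup>4\<^sup>p\<^sup>-\<^sup>4\<^sup>l\<close> (which may be \<open>0\<close>-dimensional) is realised as a coordinate subspace of \<open>\<real>\<^sup>4\<^sup>p\<close>,
  with coordinates indexed by \<open>I\<close>; a point of the coordinate space is a triple \<open>(x, \<tau>, \<^bold>r)\<close>.\<close>

type_synonym ('n, 'q) coords = "(real^'n) \<times> (real^'q) \<times> ((real^3)^'q)"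

definition coord_space :: "'n::finite set \<Rightarrow> ('n, 'q) coords set" where
  "coord_space I = {(x, \<tau>, r). \<forall>i. i \<notin> I \<longrightarrow> x $ i = 0}"

text \<open>Instead of deleting the columns of \<open>\<theta>\<close> with index not in \<open>\<Lambda>\<close> we replace them by \<open>0\<close>, which
  does not affect \<open>\<theta>~ \<theta>~\<^sup>t\<close>.\<close>

definition theta_tilde :: "real^'n^'q \<Rightarrow> 'n::finite set \<Rightarrow> real^'n^'q" where
  "theta_tilde \<theta> \<Lambda> = (\<chi> \<beta> a. if a \<in> \<Lambda> then \<theta> $ \<beta> $ a else 0)"

definition Hmat :: "real^'n^'q \<Rightarrow> 'n::finite set \<Rightarrow> (real^3)^'q \<Rightarrow> real^'q^'q" where
  "Hmat \<theta> \<Lambda> r = (\<chi> \<beta> \<gamma>. (theta_tilde \<theta> \<Lambda> ** transpose (theta_tilde \<theta> \<Lambda>)) $ \<beta> $ \<gamma>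
                      + 1 / norm (r $ \<beta>) * (if \<beta> = \<gamma> then 1 else 0))"

definition Omega_mat :: "('q \<Rightarrow> real^3 \<Rightarrow> real^3) \<Rightarrow> (real^3)^'q::finite \<Rightarrow> 'q \<Rightarrow> 'q \<Rightarrow> real^3" where
  "Omega_mat \<Omega> r \<beta> \<delta> = (if \<beta> = \<delta> then \<Omega> \<beta> (r $ \<beta>) else 0)"

text \<open>The symmetric bilinear forms \<open>h\<^sub>0\<close>, \<open>h\<^sub>1\<close> and \<open>h = h\<^sub>0 + h\<^sub>1\<close> at the point \<open>(x, \<tau>, \<^bold>r)\<close>,
  evaluated on two tangent vectors.  They do not depend on \<open>\<tau>\<close>, which is the
  coordinate form of \<open>\<partial>/\<partial>\<tau>\<^sub>\<beta>\<close> being Killing.\<close>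

fun h0 :: "('n::finite, 'q::finite) coords \<Rightarrow> ('n, 'q) coords \<Rightarrow> real" where
  "h0 (x', _, _) (x'', _, _) = x' \<bullet> x''"

fun h1 :: "real^'n^'q \<Rightarrow> 'n::finite set \<Rightarrow> ('q \<Rightarrow> real^3 \<Rightarrow> real^3) \<Rightarrow>
    ('n, 'q::finite) coords \<Rightarrow> ('n, 'q) coords \<Rightarrow> ('n, 'q) coords \<Rightarrow> real" where
  "h1 \<theta> \<Lambda> \<Omega> (_, _, r) (_, \<tau>', r') (_, \<tau>'', r'') =
     1/4 * (\<Sum>\<beta>\<in>UNIV. \<Sum>\<gamma>\<in>UNIV. Hmat \<theta> \<Lambda> r $ \<beta> $ \<gamma> * (r' $ \<beta> \<bullet> r'' $ \<gamma>)) +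
     1/4 * (\<Sum>\<beta>\<in>UNIV. \<Sum>\<gamma>\<in>UNIV. matrix_inv (Hmat \<theta> \<Lambda> r) $ \<beta> $ \<gamma> *
        ((\<tau>' $ \<beta> + (\<Sum>\<delta>\<in>UNIV. Omega_mat \<Omega> r \<beta> \<delta> \<bullet> r' $ \<delta>)) *
         (\<tau>'' $ \<gamma> + (\<Sum>\<epsilon>\<in>UNIV. Omega_mat \<Omega> r \<gamma> \<epsilon> \<bullet> r'' $ \<epsilon>))))"

definition h_quot :: "real^'n^'q \<Rightarrow> 'n::finite set \<Rightarrow> ('q \<Rightarrow> real^3 \<Rightarrow> real^3) \<Rightarrow>
    ('n, 'q::finite) coords \<Rightarrow> ('n, 'q) coords \<Rightarrow> ('n, 'q) coords \<Rightarrow> real" where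
  "h_quot \<theta> \<Lambda> \<Omega> y u v = h0 u v + h1 \<theta> \<Lambda> \<Omega> y u v"

text \<open>Local coordinates \<open>(x, \<tau>, \<^bold>r)\<close> on an open set \<open>D\<close> of the quotient of the level set.  The
  last component is induced by \<open>rvec\<close>, nowhere has a vanishing entry, and takes values in the
  domains \<open>U \<beta>\<close> of the potentials; and \<open>\<partial>/\<partial>\<tau>\<^sub>\<beta>\<close> generates the action of the \<open>\<beta>\<close>-th factor of
  the torus.  Generators of that action are only determined up to a constant factor, whence
  the constant \<open>c \<noteq> 0\<close>; the form of \<open>h\<^sub>1\<close> forces \<open>\<bar>c\<bar> = 2\<close>, so one cannot demand \<open>c = 1\<close>.\<close>

definition adapted_chart ::
  "(3 \<Rightarrow> real^'n \<Rightarrow> real^'n) \<Rightarrow> real^'n^'q \<Rightarrow> 'n::finite set \<Rightarrow> 'n set \<Rightarrow> ('q \<Rightarrow> (real^3) set) \<Rightarrow>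
   ('n, 'q::finite) group_space set set \<Rightarrow> (('n, 'q) group_space set \<Rightarrow> ('n, 'q) coords) \<Rightarrow> bool" where
  "adapted_chart J \<theta> \<Lambda> I U D \<phi> \<longleftrightarrow>
     quotient_chart (zero_level J \<theta> \<Lambda>) (orbit \<theta> \<Lambda>) (coord_space I) D \<phi> \<and>
     (\<forall>P\<in>zero_level J \<theta> \<Lambda>. orbit \<theta> \<Lambda> P \<in> D \<longrightarrow>
        snd (snd (\<phi> (orbit \<theta> \<Lambda> P))) = rvec P \<and>
        (\<forall>\<beta>. rvec P $ \<beta> \<noteq> 0 \<and> rvec P $ \<beta> \<in> U \<beta>)) \<and>
     (\<forall>\<beta>. \<exists>c. c \<noteq> 0 \<and> (\<forall>P\<in>zero_level J \<theta> \<Lambda>. orbit \<theta> \<Lambda> P \<in> D \<longrightarrow>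
        ((\<lambda>t. \<phi> (orbit \<theta> \<Lambda> (torus_act (axis \<beta> t) P)))
           has_vector_derivative (0, axis \<beta> c, 0)) (at 0)))"

end

theory Submission
  imports Defs
begin

text \<open>The constraints that cut out the zero level are solved by some of the coordinates of \<open>X\<close>, and the
  action of \<open>L\<close> absorbs some others.  Write \<open>W\<^sub>\<beta>\<close> for the quaternionic coordinates and
  \<open>r\<^sub>\<beta> = conj W\<^sub>\<beta> i W\<^sub>\<beta>\<close>.  By isotropy the vectors \<open>e\<^sub>a\<close>, \<open>J\<^sub>\<alpha> e\<^sub>a\<close> (\<open>a\<close> in \<open>\<Lambda>\<close>) are
  orthonormal; let \<open>E\<close> be the orthogonal complement of their span, which is isometric to a coordinate
  subspace (\<open>hyperkaehler_splitting\<close>).  The moment map vanishes iff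
  \<open>\<langle>J\<^sub>\<alpha> e\<^sub>a, X\<rangle> = - 1/2 \<Sum>\<^sub>\<beta> \<theta>\<^sub>\<beta>\<^sub>a (r\<^sub>\<beta>)\<^sub>\<alpha>\<close> for all \<open>a\<close> and \<open>\<alpha>\<close> (\<open>zero_level_iff\<close>).  So the
  level set is a graph over \<open>\<l> \<times> E \<times> \<H>\<^sup>q\<close>; every orbit contains exactly one point whose
  component in \<open>\<l>\<close> is \<open>0\<close>, and the quotient is globally \<open>E \<times> \<H>\<^sup>q\<close>, by means of the component of
  \<open>X\<close> in \<open>E\<close> and of the coordinates \<open>gauged\<close>, which undo the action of the \<open>\<l>\<close>-component of \<open>X\<close>.

  It remains to introduce on each factor \<open>\<H> - {0}\<close> the coordinates \<open>(\<tau>, r)\<close>.  Multiplicativity of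
  the quaternionic norm says (\<open>hopf_pythagoras\<close>) that
  \<open>|dW|\<^sup>2 = |dr|\<^sup>2 / (4|r|) + |r| \<eta>\<^sup>2 / 4\<close> with \<open>\<eta> = - 2 \<langle>iW, dW\<rangle> / |W|\<^sup>2\<close>.  The exterior derivative
  of \<open>\<eta>\<close> is the pullback under \<open>W \<mapsto> r\<close> of the two-form that corresponds to the vector field
  \<open>grad (1/|r|)\<close> (\<open>hopf_triple\<close>), and so is that of \<open>\<Omega> \<cdot> dr\<close>.  Hence \<open>\<eta> - \<Omega> \<cdot> dr\<close> is closed
  (\<open>tau_form_closed\<close>).  A local primitive \<open>\<tau>\<close> satisfies \<open>d\<tau> + \<Omega> \<cdot> dr = \<eta>\<close>, and together with
  \<open>r\<close> it is a chart by the inverse function theorem (\<open>hopf_chart_exists\<close>).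

  For a horizontal vector \<open>(Y, Z)\<close> put \<open>b\<^sub>\<beta> = \<langle>iW\<^sub>\<beta>, Z\<^sub>\<beta>\<rangle>\<close>.  Orthogonality to the orbit reads
  \<open>Y\<^sub>a = - \<Sum>\<^sub>\<beta> \<theta>\<^sub>\<beta>\<^sub>a b\<^sub>\<beta>\<close>.  Passing to the gauged coordinates subtracts
  \<open>\<Sum>\<^sub>a Y\<^sub>a \<theta>\<^sub>\<beta>\<^sub>a iW\<^sub>\<beta>\<close> from \<open>Z\<^sub>\<beta>\<close>, so that \<open>d\<tau> + \<Omega> \<cdot> dr\<close> takes the value
  \<open>- 2 H b\<close> (\<open>tau_coframe_horizontal\<close>).  Therefore its square with respect to \<open>H\<inverse>/4\<close> is
  \<open>\<langle>b, H b\<rangle> = \<Sum>\<^sub>a Y\<^sub>a\<^sup>2 + \<Sum>\<^sub>\<beta> b\<^sub>\<beta>\<^sup>2 / |W\<^sub>\<beta>|\<^sup>2\<close>.  In the same way \<open>H/4\<close> applied to \<open>dr\<close> collects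
  the components of \<open>Y\<close> along the \<open>J\<^sub>\<alpha> e\<^sub>a\<close> and the rest of \<open>|Z|\<^sup>2\<close>
  (\<open>submersion_metric\<close>).\<close>

section \<open>Smooth maps between Euclidean spaces\<close>

lemma Ck_on_cong:
  assumes "open U" "\<And>x. x \<in> U \<Longrightarrow> f x = g x"
  shows "Ck_on n U f \<longleftrightarrow> Ck_on n U g"
  using assms(2)
proof (induction n arbitrary: f g)
  case 0
  then show ?case by (simp cong: continuous_on_cong)
next
  case (Suc n)
  have tr: "(f has_derivative D) (at x) \<longleftrightarrow> (g has_derivative D) (at x)" if "x \<in> U" for x D
    by (metis has_derivative_transform_within_open that assms(1) Suc.prems)
  then have "frechet_derivative f (at x) = frechet_derivative g (at x)" if "x \<in> U" for x
    using that by (simp add: frechet_derivative_def)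
  then have "Ck_on n U (\<lambda>x. frechet_derivative f (at x) v) \<longleftrightarrow> Ck_on n U (\<lambda>x. frechet_derivative g (at x) v)" for v
    by (intro Suc.IH) simp
  then show ?case using tr by (auto simp: differentiable_def)
qed

text \<open>This rule and the next one replace the derivative that is chosen in the definition of \<open>Ck_on\<close> by
  any explicit formula for it; all closure properties below follow by induction from a
  differentiation rule whose right-hand side is built by the same operations.\<close>

lemma Ck_on_SucI:
  assumes "open U" "\<And>x. x \<in> U \<Longrightarrow> (f has_derivative f' x) (at x)"
    and "\<And>v. Ck_on n U (\<lambda>x. f' x v)"
  shows "Ck_on (Suc n) U f"
proof -
  have "frechet_derivative f (at x) = f' x" if "x \<in> U" for x
    using assms(2)[OF that] frechet_derivative_at by metis
  then have "Ck_on n U (\<lambda>x. frechet_derivative f (at x) v)" for v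
    using Ck_on_cong[OF assms(1), of "\<lambda>x. frechet_derivative f (at x) v" "\<lambda>x. f' x v"] assms(3) by simp
  then show ?thesis using assms(2) by (auto simp: differentiable_def)
qed

lemma Ck_on_SucE:
  assumes "Ck_on (Suc n) U f"
  obtains f' where "\<And>x. x \<in> U \<Longrightarrow> (f has_derivative f' x) (at x)"
    and "\<And>v. Ck_on n U (\<lambda>x. f' x v)"
  using assms that[of "\<lambda>x. frechet_derivative f (at x)"] by (auto simp: frechet_derivative_works)

lemma Ck_on_Suc_imp: "Ck_on (Suc n) U f \<Longrightarrow> Ck_on n U f"
proof (induction n arbitrary: f)
  case 0
  then show ?case
    by (auto intro!: continuous_at_imp_continuous_on differentiable_imp_continuous_within)
next
  case (Suc n)
  then show ?case by (metis Ck_on.simps(2))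
qed

lemma Ck_on_subset: "Ck_on n U f \<Longrightarrow> V \<subseteq> U \<Longrightarrow> Ck_on n V f"
  by (induction n arbitrary: f) (auto intro: continuous_on_subset)

lemma Ck_on_const: "open U \<Longrightarrow> Ck_on n U (\<lambda>x. c)"
proof (induction n arbitrary: c)
  case (Suc n)
  show ?case by (rule Ck_on_SucI[where f' = "\<lambda>x v. 0"]) (auto simp: Suc)
qed auto

lemma Ck_on_linear:
  assumes "open U" "bounded_linear L" "Ck_on n U f"
  shows "Ck_on n U (\<lambda>x. L (f x))"
  using assms(3)
proof (induction n arbitrary: f)
  case 0
  then show ?case by (simp add: bounded_linear.continuous_on[OF assms(2)])
next
  case (Suc n)
  from Suc.prems obtain f' where f': "\<And>x. x \<in> U \<Longrightarrow> (f has_derivative f' x) (at x)" "\<And>v. Ck_on n U (\<lambda>x. f' x v)"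
    by (rule Ck_on_SucE) blast
  show ?case
    by (rule Ck_on_SucI[OF assms(1), where f' = "\<lambda>x v. L (f' x v)"])
      (auto intro: Suc.IH f' bounded_linear.has_derivative[OF assms(2)])
qed

lemma Ck_on_add:
  assumes "open U" "Ck_on n U f" "Ck_on n U g"
  shows "Ck_on n U (\<lambda>x. f x + g x)"
  using assms(2,3)
proof (induction n arbitrary: f g)
  case 0
  then show ?case by (simp add: continuous_on_add)
next
  case (Suc n)
  from Suc.prems(1) obtain f' where f': "\<And>x. x \<in> U \<Longrightarrow> (f has_derivative f' x) (at x)" "\<And>v. Ck_on n U (\<lambda>x. f' x v)"
    by (rule Ck_on_SucE) blast
  from Suc.prems(2) obtain g' where g': "\<And>x. x \<in> U \<Longrightarrow> (g has_derivative g' x) (at x)" "\<And>v. Ck_on n U (\<lambda>x. g' x v)"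
    by (rule Ck_on_SucE) blast
  show ?case
    by (rule Ck_on_SucI[OF assms(1), where f' = "\<lambda>x v. f' x v + g' x v"])
      (auto intro: Suc.IH f' g' has_derivative_add)
qed

lemma Ck_on_bilinear:
  assumes "open U" "bounded_bilinear B" "Ck_on n U f" "Ck_on n U g"
  shows "Ck_on n U (\<lambda>x. B (f x) (g x))"
  using assms(3,4)
proof (induction n arbitrary: f g)
  case 0
  then show ?case by (simp add: bounded_bilinear.continuous_on[OF assms(2)])
next
  case (Suc n)
  from Suc.prems(1) obtain f' where f': "\<And>x. x \<in> U \<Longrightarrow> (f has_derivative f' x) (at x)" "\<And>v. Ck_on n U (\<lambda>x. f' x v)"
    by (rule Ck_on_SucE) blast
  from Suc.prems(2) obtain g' where g': "\<And>x. x \<in> U \<Longrightarrow> (g has_derivative g' x) (at x)" "\<And>v. Ck_on n U (\<lambda>x. g' x v)"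
    by (rule Ck_on_SucE) blast
  have "Ck_on n U f" "Ck_on n U g" using Suc.prems Ck_on_Suc_imp by blast+
  then have "Ck_on n U (\<lambda>x. B (f x) (g' x v) + B (f' x v) (g x))" for v
    by (intro Ck_on_add Suc.IH f'(2) g'(2) assms(1))
  moreover have "((\<lambda>x. B (f x) (g x)) has_derivative (\<lambda>v. B (f x) (g' x v) + B (f' x v) (g x))) (at x)"
    if "x \<in> U" for x
    by (rule bounded_bilinear.FDERIV[OF assms(2) f'(1)[OF that] g'(1)[OF that]])
  ultimately show ?case by (intro Ck_on_SucI[OF assms(1)])
qed

lemma Ck_on_sum:
  assumes "open U" "\<And>i. i \<in> I \<Longrightarrow> Ck_on n U (f i)"
  shows "Ck_on n U (\<lambda>x. \<Sum>i\<in>I. f i x)"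
  using assms(2)
  by (induction I rule: infinite_finite_induct) (auto intro: Ck_on_const Ck_on_add assms(1))

text \<open>The derivative of \<open>g \<circ> f\<close> has to be expanded in a basis of the intermediate space: only
  the directional derivatives \<open>x \<mapsto> g' x b\<close> for a fixed direction \<open>b\<close> are known to be
  \<open>C\<^sup>n\<close>, and the direction \<open>f' x v\<close> varies with \<open>x\<close>.\<close>

lemma Ck_on_compose:
  fixes g :: "'b::euclidean_space \<Rightarrow> 'c::real_normed_vector" and f :: "'a::real_normed_vector \<Rightarrow> 'b"
  assumes "open U" "open V" "f ` U \<subseteq> V" "Ck_on n U f" "Ck_on n V g"
  shows "Ck_on n U (\<lambda>x. g (f x))"
  using assms(3-5)
proof (induction n arbitrary: f g)
  case 0
  then show ?case by (auto intro: continuous_on_compose2)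
next
  case (Suc n)
  from Suc.prems(2) obtain f' where f': "\<And>x. x \<in> U \<Longrightarrow> (f has_derivative f' x) (at x)" "\<And>v. Ck_on n U (\<lambda>x. f' x v)"
    by (rule Ck_on_SucE) blast
  from Suc.prems(3) obtain g' where g': "\<And>x. x \<in> V \<Longrightarrow> (g has_derivative g' x) (at x)" "\<And>v. Ck_on n V (\<lambda>x. g' x v)"
    by (rule Ck_on_SucE) blast
  have f: "Ck_on n U f" using Suc.prems Ck_on_Suc_imp by blast
  have comp: "((\<lambda>x. g (f x)) has_derivative (\<lambda>v. \<Sum>b\<in>Basis. (f' x v \<bullet> b) *\<^sub>R g' (f x) b)) (at x)" if "x \<in> U" for x
  proof -
    have fx: "f x \<in> V" using Suc.prems(1) that by auto
    have D: "((\<lambda>x. g (f x)) has_derivative (\<lambda>v. g' (f x) (f' x v))) (at x)"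
      by (rule has_derivative_compose[OF f'(1)[OF that] g'(1)[OF fx]])
    have lin: "linear (g' (f x))" using g'(1)[OF fx] has_derivative_linear by blast
    have "g' (f x) (f' x v) = (\<Sum>b\<in>Basis. (f' x v \<bullet> b) *\<^sub>R g' (f x) b)" for v
      by (subst euclidean_representation[of "f' x v", symmetric])
        (simp add: linear_sum[OF lin] linear_scale[OF lin])
    with D show ?thesis by simp
  qed
  have "Ck_on n U (\<lambda>x. \<Sum>b\<in>Basis. (f' x v \<bullet> b) *\<^sub>R g' (f x) b)" for v
  proof (rule Ck_on_sum[OF assms(1)])
    fix b :: 'b
    show "Ck_on n U (\<lambda>x. (f' x v \<bullet> b) *\<^sub>R g' (f x) b)"
      by (rule Ck_on_bilinear[OF assms(1) bounded_bilinear_scaleR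
            Ck_on_linear[OF assms(1) bounded_linear_inner_left f'(2)] Suc.IH[OF Suc.prems(1) f g'(2)]])
  qed
  with comp show ?case by (intro Ck_on_SucI[OF assms(1)])
qed

lemma smooth_on_CkD: "smooth_on U f \<Longrightarrow> Ck_on n U f"
  by (simp add: smooth_on_def)

lemma smooth_onI:
  assumes "open U" "\<And>x. x \<in> U \<Longrightarrow> (f has_derivative f' x) (at x)"
    and "\<And>v. smooth_on U (\<lambda>x. f' x v)"
  shows "smooth_on U f"
proof -
  have "Ck_on (Suc n) U f" for n
    by (rule Ck_on_SucI[OF assms(1,2) smooth_on_CkD[OF assms(3)]])
  then have "Ck_on n U f" for n by (rule Ck_on_Suc_imp)
  then show ?thesis by (simp add: smooth_on_def)
qed

lemma smooth_on_imp_continuous_on: "smooth_on U f \<Longrightarrow> continuous_on U f"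
  using smooth_on_CkD[of U f 0] by simp

lemma smooth_on_has_derivative:
  "smooth_on U f \<Longrightarrow> x \<in> U \<Longrightarrow> (f has_derivative frechet_derivative f (at x)) (at x)"
  using smooth_on_CkD[of U f "Suc 0"] by (simp add: frechet_derivative_works)

lemma smooth_on_frechet: "smooth_on U f \<Longrightarrow> smooth_on U (\<lambda>x. frechet_derivative f (at x) v)"
  unfolding smooth_on_def
proof
  fix n assume "\<forall>n. Ck_on n U f"
  then have "Ck_on (Suc n) U f" ..
  then show "Ck_on n U (\<lambda>x. frechet_derivative f (at x) v)" by simp
qed

lemma smooth_on_subset: "smooth_on U f \<Longrightarrow> V \<subseteq> U \<Longrightarrow> smooth_on V f"
  by (auto simp: smooth_on_def intro: Ck_on_subset)

lemma smooth_on_linear: "open U \<Longrightarrow> bounded_linear L \<Longrightarrow> smooth_on U f \<Longrightarrow> smooth_on U (\<lambda>x. L (f x))"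
  by (simp add: smooth_on_def Ck_on_linear)

lemma smooth_on_bilinear:
  "open U \<Longrightarrow> bounded_bilinear B \<Longrightarrow> smooth_on U f \<Longrightarrow> smooth_on U g \<Longrightarrow> smooth_on U (\<lambda>x. B (f x) (g x))"
  by (simp add: smooth_on_def Ck_on_bilinear)

lemma smooth_on_add: "open U \<Longrightarrow> smooth_on U f \<Longrightarrow> smooth_on U g \<Longrightarrow> smooth_on U (\<lambda>x. f x + g x)"
  by (simp add: smooth_on_def Ck_on_add)

lemma smooth_on_sum:
  "open U \<Longrightarrow> (\<And>i. i \<in> I \<Longrightarrow> smooth_on U (f i)) \<Longrightarrow> smooth_on U (\<lambda>x. \<Sum>i\<in>I. f i x)"
  by (simp add: smooth_on_def Ck_on_sum)

lemma smooth_on_const: "open U \<Longrightarrow> smooth_on U (\<lambda>x. c)"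
  by (simp add: smooth_on_def Ck_on_const)

lemma smooth_on_id: "open U \<Longrightarrow> smooth_on U (\<lambda>x. x)"
  by (rule smooth_onI[where f' = "\<lambda>x v. v"]) (auto intro: smooth_on_const)

lemma smooth_on_bounded_linear: "open U \<Longrightarrow> bounded_linear L \<Longrightarrow> smooth_on U L"
  using smooth_on_linear[OF _ _ smooth_on_id] by metis

lemma smooth_on_compose:
  fixes g :: "'b::euclidean_space \<Rightarrow> 'c::real_normed_vector"
  assumes "open U" "open V" "f ` U \<subseteq> V" "smooth_on U f" "smooth_on V g"
  shows "smooth_on U (\<lambda>x. g (f x))"
  using assms by (auto simp: smooth_on_def intro: Ck_on_compose)

lemma smooth_on_minus: "open U \<Longrightarrow> smooth_on U f \<Longrightarrow> smooth_on U (\<lambda>x. - f x)"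
  by (rule smooth_on_linear[OF _ bounded_linear_minus[OF bounded_linear_ident]])

lemma smooth_on_diff: "open U \<Longrightarrow> smooth_on U f \<Longrightarrow> smooth_on U g \<Longrightarrow> smooth_on U (\<lambda>x. f x - g x)"
  using smooth_on_add[OF _ _ smooth_on_minus] by fastforce

lemma smooth_on_mult:
  fixes f :: "_ \<Rightarrow> real"
  shows "open U \<Longrightarrow> smooth_on U f \<Longrightarrow> smooth_on U g \<Longrightarrow> smooth_on U (\<lambda>x. f x * g x)"
  by (rule smooth_on_bilinear[OF _ bounded_bilinear_mult])

lemma smooth_on_inverse: "smooth_on (- {0::real}) inverse"
proof -
  have "Ck_on n (- {0::real}) inverse" for n
  proof (induction n)
    case 0
    then show ?case by (auto intro!: continuous_intros)
  next
    case (Suc n)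
    have o: "open (- {0::real})" by auto
    have "Ck_on n (- {0::real}) (\<lambda>x. - (inverse x * v * inverse x))" for v
      by (rule Ck_on_linear[OF o bounded_linear_minus[OF bounded_linear_ident]
            Ck_on_bilinear[OF o bounded_bilinear_mult Ck_on_bilinear[OF o bounded_bilinear_mult Suc Ck_on_const[OF o]] Suc]])
    moreover have "(inverse has_derivative (\<lambda>v. - (inverse x * v * inverse x))) (at x)"
      if "x \<in> - {0::real}" for x
      using that by (auto intro!: derivative_eq_intros)
    ultimately show ?case by (intro Ck_on_SucI[OF o])
  qed
  then show ?thesis by (simp add: smooth_on_def)
qed

lemma smooth_on_norm: "smooth_on (- {0::'a::euclidean_space}) norm"
proof -
  have o: "open (- {0::'a})" by auto
  have "Ck_on n (- {0::'a}) norm" for n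
  proof (induction n)
    case 0
    then show ?case by (auto intro!: continuous_intros)
  next
    case (Suc n)
    have "Ck_on n (- {0::real}) inverse"
      using smooth_on_inverse by (simp add: smooth_on_def)
    then have inv: "Ck_on n (- {0::'a}) (\<lambda>x. inverse (norm x))"
      by (intro Ck_on_compose[OF o _ _ Suc, where V = "-{0}"]) auto
    have "Ck_on n (- {0::'a}) (\<lambda>x. (v \<bullet> x) * inverse (norm x))" for v
      by (rule Ck_on_bilinear[OF o bounded_bilinear_mult
            Ck_on_linear[OF o bounded_linear_inner_right smooth_on_CkD[OF smooth_on_id[OF o]]] inv])
    moreover have "(norm has_derivative (\<lambda>v. (v \<bullet> x) * inverse (norm x))) (at x)"
      if "x \<in> - {0::'a}" for x
      using that has_derivative_norm[of x]
      by (simp add: sgn_div_norm mult.commute inner_commute)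
    ultimately show ?case by (intro Ck_on_SucI[OF o])
  qed
  then show ?thesis by (simp add: smooth_on_def)
qed

lemma smooth_on_sin_cos: "smooth_on UNIV (sin :: real \<Rightarrow> real)" "smooth_on UNIV (cos :: real \<Rightarrow> real)"
proof -
  have "Ck_on n UNIV (sin :: real \<Rightarrow> real) \<and> Ck_on n UNIV (cos :: real \<Rightarrow> real)" for n
  proof (induction n)
    case 0
    then show ?case by (auto intro!: continuous_intros)
  next
    case (Suc n)
    then have sin: "Ck_on n UNIV (sin :: real \<Rightarrow> real)" and cos: "Ck_on n UNIV (cos :: real \<Rightarrow> real)"
      by auto
    have "Ck_on (Suc n) UNIV (sin :: real \<Rightarrow> real)"
      by (rule Ck_on_SucI[where f' = "\<lambda>x v. v * cos x"])
        (auto intro!: derivative_eq_intros Ck_on_linear[OF open_UNIV bounded_linear_mult_right cos])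
    moreover have "Ck_on (Suc n) UNIV (cos :: real \<Rightarrow> real)"
    proof (rule Ck_on_SucI[where f' = "\<lambda>x v. (- v) * sin x"])
      show "Ck_on n UNIV (\<lambda>x. (- v) * sin x)" for v :: real
        by (rule Ck_on_linear[OF open_UNIV bounded_linear_mult_right sin])
    qed (auto intro!: derivative_eq_intros)
    ultimately show ?case by blast
  qed
  then show "smooth_on UNIV (sin :: real \<Rightarrow> real)" "smooth_on UNIV (cos :: real \<Rightarrow> real)"
    by (simp_all add: smooth_on_def)
qed

lemma smooth_on_Pair:
  fixes f :: "'a::real_normed_vector \<Rightarrow> 'b::real_normed_vector"
    and g :: "'a \<Rightarrow> 'c::real_normed_vector"
  assumes "open U" "smooth_on U f" "smooth_on U g"
  shows "smooth_on U (\<lambda>x. (f x, g x))"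
proof -
  have L: "bounded_linear (\<lambda>x::'b. (x, 0 :: 'c))" "bounded_linear (\<lambda>x::'c. (0 :: 'b, x))"
    by (auto intro!: bounded_linear_Pair bounded_linear_ident bounded_linear_zero)
  have "smooth_on U (\<lambda>x. (f x, 0) + (0, g x))"
    by (rule smooth_on_add[OF assms(1) smooth_on_linear[OF assms(1) L(1) assms(2)]
          smooth_on_linear[OF assms(1) L(2) assms(3)]])
  then show ?thesis by simp
qed

lemma bounded_linear_axis:
  "bounded_linear (axis i :: 'b::real_normed_vector \<Rightarrow> 'b ^ 'i::finite)"
proof -
  have "norm (axis i y :: 'b ^ 'i) = norm y" for y
    by (simp add: norm_vec_def L2_set_def axis_def if_distrib[of norm] if_distrib[of "\<lambda>z. z\<^sup>2"] cong: if_cong)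
  then show ?thesis
    by (intro bounded_linear_intro[where K = 1]) (simp_all add: vec_eq_iff axis_def)
qed

lemma vec_lambda_eq_sum_axis: "(\<chi> i. x i) = (\<Sum>i\<in>UNIV. axis i (x i))"
  by (simp add: vec_eq_iff axis_def)

lemma smooth_on_vec_lambda:
  fixes f :: "'a::real_normed_vector \<Rightarrow> 'i::finite \<Rightarrow> 'b::real_normed_vector"
  assumes "open U" "\<And>i. smooth_on U (\<lambda>x. f x i)"
  shows "smooth_on U (\<lambda>x. \<chi> i. f x i)"
  unfolding vec_lambda_eq_sum_axis
  by (rule smooth_on_sum[OF assms(1) smooth_on_linear[OF assms(1) bounded_linear_axis assms(2)]])

section \<open>The Poincare lemma for one-forms\<close>

text \<open>The primitive is the integral of \<open>\<omega>\<close> along the segment from a base point \<open>a\<close>.  Differentiation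
  under the integral sign produces \<open>\<integral> \<omega> + t D\<omega>(x - a) dt\<close> once the symmetry of \<open>D\<omega>\<close> is used to
  interchange the two directions, and this integrand is the derivative of \<open>t \<omega>\<close> along the segment.\<close>

lemma poincare_lemma:
  fixes \<omega> :: "'a::euclidean_space \<Rightarrow> 'a \<Rightarrow> real"
  assumes S: "open S" "convex S"
    and lin: "\<And>x. x \<in> S \<Longrightarrow> linear (\<omega> x)"
    and smooth: "\<And>v. smooth_on S (\<lambda>x. \<omega> x v)"
    and closed: "\<And>x u v. x \<in> S \<Longrightarrow>
      frechet_derivative (\<lambda>x. \<omega> x v) (at x) u = frechet_derivative (\<lambda>x. \<omega> x u) (at x) v"
  shows "\<exists>f. \<forall>x\<in>S. (f has_derivative \<omega> x) (at x)"
proof (cases "S = {}")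
  case True
  then show ?thesis by blast
next
  case False
  then obtain a where a: "a \<in> S" by blast
  \<comment> \<open>The vector field dual to \<open>\<omega>\<close>.\<close>
  define F where "F x = (\<Sum>b\<in>Basis. \<omega> x b *\<^sub>R b)" for x
  have F: "F x \<bullet> v = \<omega> x v" if "x \<in> S" for x v
  proof -
    have "\<omega> x v = \<omega> x (\<Sum>b\<in>Basis. (v \<bullet> b) *\<^sub>R b)" by (simp add: euclidean_representation)
    also have "\<dots> = (\<Sum>b\<in>Basis. (v \<bullet> b) * \<omega> x b)"
      by (simp add: linear_sum[OF lin[OF that]] linear_scale[OF lin[OF that]])
    finally show ?thesis by (simp add: F_def inner_sum_left inner_sum_right mult.commute inner_commute)
  qed
  have smF: "smooth_on S F"
    unfolding F_def using S by (intro smooth_on_sum smooth_on_linear[OF _ bounded_linear_scaleR_left] smooth)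
  define F' where "F' x = frechet_derivative F (at x)" for x
  have F': "(F has_derivative F' x) (at x)" if "x \<in> S" for x
    unfolding F'_def by (rule smooth_on_has_derivative[OF smF that])
  have linF': "linear (F' x)" if "x \<in> S" for x
    using F'[OF that] has_derivative_linear by blast
  have sym: "F' x u \<bullet> v = F' x v \<bullet> u" if x: "x \<in> S" for x u v
  proof -
    have "((\<lambda>x. \<omega> x v) has_derivative (\<lambda>u. F' x u \<bullet> v)) (at x)" for v
      by (rule has_derivative_transform_within_open[OF bounded_linear.has_derivative[OF bounded_linear_inner_left F'[OF x]] S(1) x])
        (simp add: F)
    then have "frechet_derivative (\<lambda>x. \<omega> x v) (at x) u = F' x u \<bullet> v" for u v
      using frechet_derivative_at by metis
    then show ?thesis using closed[OF x] by metis
  qed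
  define p where "p x t = a + t *\<^sub>R (x - a)" for x t
  have p: "p x t \<in> S" if "x \<in> S" "t \<in> cbox 0 1" for x and t :: real
  proof -
    have "p x t = (1 - t) *\<^sub>R a + t *\<^sub>R x" by (simp add: p_def algebra_simps)
    then show ?thesis using that a S(2) by (simp add: convex_alt)
  qed
  define G where "G x t = F (p x t) + t *\<^sub>R F' (p x t) (x - a)" for x t
  define f where "f x = integral (cbox 0 1) (\<lambda>t::real. F (p x t) \<bullet> (x - a))" for x
  have contF: "continuous_on S F" by (rule smooth_on_imp_continuous_on[OF smF])
  have contF'b: "continuous_on S (\<lambda>x. F' x v)" for v
    unfolding F'_def by (rule smooth_on_imp_continuous_on[OF smooth_on_frechet[OF smF]])
  have contp: "continuous_on X (\<lambda>z. p (fst z) (snd z))" for X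
    unfolding p_def by (intro continuous_intros)
  let ?R = "Sigma S (\<lambda>_. cbox 0 (1::real))"
  have pR: "(\<lambda>z. p (fst z) (snd z)) ` ?R \<subseteq> S" using p by auto
  have contG: "continuous_on ?R (\<lambda>(x, t). G x t)"
  proof -
    have "continuous_on ?R (\<lambda>z. F (p (fst z) (snd z)) +
        snd z *\<^sub>R (\<Sum>b\<in>Basis. ((fst z - a) \<bullet> b) *\<^sub>R F' (p (fst z) (snd z)) b))"
      by (intro continuous_intros continuous_on_compose2[OF contF contp pR]
          continuous_on_compose2[OF contF'b contp pR])
    then show ?thesis
    proof (rule continuous_on_eq)
      fix z assume z: "z \<in> ?R"
      obtain x t where xt: "z = (x, t)" by (cases z)
      have "F' (p x t) (x - a) = F' (p x t) (\<Sum>b\<in>Basis. ((x - a) \<bullet> b) *\<^sub>R b)"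
        by (simp add: euclidean_representation)
      also have "\<dots> = (\<Sum>b\<in>Basis. ((x - a) \<bullet> b) *\<^sub>R F' (p x t) b)"
        using linF'[OF p] z xt by (simp add: linear_sum linear_scale)
      finally show "F (p (fst z) (snd z)) +
        snd z *\<^sub>R (\<Sum>b\<in>Basis. ((fst z - a) \<bullet> b) *\<^sub>R F' (p (fst z) (snd z)) b) = (case z of (x, t) \<Rightarrow> G x t)"
        by (simp add: xt G_def)
    qed
  qed
  have "(f has_derivative \<omega> x0) (at x0)" if x0: "x0 \<in> S" for x0
  proof -
    have "((\<lambda>x. integral (cbox 0 1) (\<lambda>t. F (p x t) \<bullet> (x - a))) has_derivative
        integral (cbox 0 1) (\<lambda>t. blinfun_inner_right (G x0 t))) (at x0 within S)"
    proof (rule leibniz_rule[where fx = "\<lambda>x t. blinfun_inner_right (G x t)"])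
      fix x and t :: real assume x: "x \<in> S" and t: "t \<in> cbox 0 1"
      have "((\<lambda>x. F (p x t)) has_derivative (\<lambda>h. F' (p x t) (t *\<^sub>R h))) (at x)"
      proof (rule has_derivative_compose[where f = "\<lambda>x. p x t" and g = F
            and f' = "\<lambda>h. t *\<^sub>R h" and g' = "F' (p x t)"])
        show "((\<lambda>x. p x t) has_derivative (\<lambda>h. t *\<^sub>R h)) (at x)"
          unfolding p_def by (auto intro!: derivative_eq_intros)
      qed (rule F'[OF p[OF x t]])
      moreover have "((\<lambda>x. x - a) has_derivative (\<lambda>h. h)) (at x)"
        by (auto intro!: derivative_eq_intros)
      ultimately have D: "((\<lambda>x. F (p x t) \<bullet> (x - a)) has_derivative
          (\<lambda>h. F (p x t) \<bullet> h + F' (p x t) (t *\<^sub>R h) \<bullet> (x - a))) (at x within S)"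
        by (intro has_derivative_at_withinI[OF has_derivative_inner])
      have "F (p x t) \<bullet> h + F' (p x t) (t *\<^sub>R h) \<bullet> (x - a) = G x t \<bullet> h" for h
        using linear_scale[OF linF'[OF p[OF x t]]] sym[OF p[OF x t], of h "x - a"]
        by (simp add: G_def inner_add_left)
      with D show "((\<lambda>x. F (p x t) \<bullet> (x - a)) has_derivative blinfun_apply (blinfun_inner_right (G x t)))
          (at x within S)" by simp
    next
      fix x assume x: "x \<in> S"
      have "continuous_on (cbox 0 1) (\<lambda>t. F (p x t) \<bullet> (x - a))"
      proof (intro continuous_intros continuous_on_compose2[OF contF])
        show "continuous_on (cbox 0 1) (\<lambda>t. p x t)" unfolding p_def by (intro continuous_intros)
      qed (use p[OF x] in auto)
      then show "(\<lambda>t. F (p x t) \<bullet> (x - a)) integrable_on cbox 0 1" by (rule integrable_continuous)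
    next
      show "continuous_on ?R (\<lambda>(x, t). blinfun_inner_right (G x t))"
        using bounded_linear.continuous_on[OF bounded_linear_blinfun_inner_right contG]
        by (simp add: case_prod_beta)
    qed (use x0 S in auto)
    then have D: "(f has_derivative integral (cbox 0 1) (\<lambda>t. blinfun_inner_right (G x0 t))) (at x0)"
      using at_within_open[OF x0 S(1)] by (simp add: f_def[abs_def])
    have "((\<lambda>t. t *\<^sub>R F (p x0 t)) has_vector_derivative G x0 t) (at t within {0..1})" if "t \<in> {0..1}" for t
    proof -
      have pt: "p x0 t \<in> S" using p[OF x0] that by auto
      have "((\<lambda>t. F (p x0 t)) has_derivative (\<lambda>h. F' (p x0 t) (h *\<^sub>R (x0 - a)))) (at t)"
      proof (rule has_derivative_compose[where f = "\<lambda>t. p x0 t" and g = F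
            and f' = "\<lambda>h. h *\<^sub>R (x0 - a)" and g' = "F' (p x0 t)"])
        show "((\<lambda>t. p x0 t) has_derivative (\<lambda>h. h *\<^sub>R (x0 - a))) (at t)"
          unfolding p_def by (auto intro!: derivative_eq_intros)
      qed (rule F'[OF pt])
      then have "((\<lambda>t. t *\<^sub>R F (p x0 t)) has_derivative
          (\<lambda>h. t *\<^sub>R F' (p x0 t) (h *\<^sub>R (x0 - a)) + h *\<^sub>R F (p x0 t))) (at t)"
        by (intro has_derivative_scaleR has_derivative_ident)
      moreover have "t *\<^sub>R F' (p x0 t) (h *\<^sub>R (x0 - a)) + h *\<^sub>R F (p x0 t) = h *\<^sub>R G x0 t" for h
        by (simp add: G_def linear_scale[OF linF'[OF pt]] scaleR_add_right mult.commute)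
      ultimately show ?thesis
        unfolding has_vector_derivative_def by (simp add: has_derivative_at_withinI)
    qed
    then have "(G x0 has_integral (1 *\<^sub>R F (p x0 1) - 0 *\<^sub>R F (p x0 0))) {0..1}"
      by (intro fundamental_theorem_of_calculus) auto
    then have I: "(G x0 has_integral F x0) (cbox 0 1)" by (simp add: p_def)
    then have "((\<lambda>t. blinfun_inner_right (G x0 t)) has_integral blinfun_inner_right (F x0)) (cbox 0 1)"
      using has_integral_linear[OF I bounded_linear_blinfun_inner_right] by (simp add: o_def)
    then have "integral (cbox 0 1) (\<lambda>t. blinfun_inner_right (G x0 t)) = blinfun_inner_right (F x0)"
      by (rule integral_unique)
    moreover have "blinfun_apply (blinfun_inner_right (F x0)) = \<omega> x0"
      using F[OF x0] by (simp add: fun_eq_iff)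
    ultimately show ?thesis using D by simp
  qed
  then show ?thesis by blast
qed

section \<open>The Hopf map\<close>

text \<open>The symmetric bilinear map whose diagonal is the coordinate \<open>r = conj W i W\<close>; thus
  \<open>2 *\<^sub>R hopf W\<close> is the differential of \<open>r\<close> at \<open>W\<close>.  The real part of \<open>conj W i Z\<close>,
  which is dropped here, is \<open>- \<langle>iW, Z\<rangle>\<close>.\<close>

definition hopf :: "quat \<Rightarrow> quat \<Rightarrow> real^3" where
  "hopf W Z = snd (qcnj W \<odot> qunit 1 \<odot> Z)"

lemmas quat_components = qmul_def qcnj_def qunit_def cross3_def inner_vec_def inner_prod_def sum_3
  vec_eq_iff forall_3 axis_def vector_def

lemma qmul_assoc: "x \<odot> y \<odot> z = x \<odot> (y \<odot> z)"
  by (cases x; cases y; cases z) (simp add: quat_components algebra_simps)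

lemma bilinear_qmul: "bilinear qmul"
  by (auto simp: bilinear_def linear_iff quat_components algebra_simps)

lemma bounded_bilinear_qmul: "bounded_bilinear qmul"
  using bilinear_qmul by (simp add: bilinear_conv_bounded_bilinear)

lemma bilinear_hopf: "bilinear hopf"
  unfolding hopf_def by (auto simp: bilinear_def linear_iff quat_components algebra_simps)

lemma bounded_bilinear_hopf: "bounded_bilinear hopf"
  using bilinear_hopf by (simp add: bilinear_conv_bounded_bilinear)

lemma linear_hopf_right: "linear (hopf W)"
  using bilinear_hopf unfolding bilinear_def by blast

text \<open>\<open>conj Z i W\<close> is the negative of the conjugate of \<open>conj W i Z\<close>, so it has the same imaginary part.\<close>

lemma hopf_commute: "hopf W Z = hopf Z W"
  unfolding hopf_def by (simp add: quat_components algebra_simps)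

lemma hopf_vertical: "hopf W (qunit 1 \<odot> W) = 0"
  unfolding hopf_def by (simp add: quat_components algebra_simps)

lemma inner_qunit_qmul: "(qunit 1 \<odot> Z) \<bullet> Z' = - (Z \<bullet> (qunit 1 \<odot> Z'))" "(qunit 1 \<odot> Z) \<bullet> (qunit 1 \<odot> Z') = Z \<bullet> Z'"
  by (simp_all add: quat_components algebra_simps)

text \<open>The polarised form of \<open>|conj W i Z|\<^sup>2 = |W|\<^sup>2 |Z|\<^sup>2\<close>.  For \<open>W \<noteq> 0\<close> it decomposes the flat
  metric into the part along the Hopf fibre through \<open>W\<close> and the part pulled back from \<open>\<real>\<^sup>3\<close>.\<close>

lemma hopf_pythagoras:
  "(W \<bullet> W) * (Z \<bullet> Z') = ((qunit 1 \<odot> W) \<bullet> Z) * ((qunit 1 \<odot> W) \<bullet> Z') + hopf W Z \<bullet> hopf W Z'"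
  unfolding hopf_def by (simp add: quat_components algebra_simps)

text \<open>Up to a constant and powers of \<open>|W|\<^sup>2\<close>, the left-hand side is the flux through the image parallelogram of the
  monopole field \<open>r/|r|\<^sup>3\<close>, and the right-hand side is the exterior derivative of the connection form
  \<open>\<langle>iW, dW\<rangle>/|W|\<^sup>2\<close>.\<close>

lemma hopf_triple:
  "hopf W W \<bullet> cross3 (hopf W Z) (hopf W Z') =
    (W \<bullet> W) * (((qunit 1 \<odot> Z) \<bullet> Z') * (W \<bullet> W) - (W \<bullet> Z) * ((qunit 1 \<odot> W) \<bullet> Z')
       + (W \<bullet> Z') * ((qunit 1 \<odot> W) \<bullet> Z))"
  unfolding hopf_def by (simp add: quat_components, algebra)

text \<open>The moment map of the circle action \<open>W \<mapsto> exp(it) W\<close> on \<open>\<H>\<close> is \<open>r/2\<close>.\<close>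

lemma moment_hopf: "(qunit 1 \<odot> W \<odot> (- qunit \<alpha>)) \<bullet> W = hopf W W $ \<alpha>"
  using exhaust_3[of \<alpha>] unfolding hopf_def by (auto simp: quat_components algebra_simps)

lemma has_derivative_hopf: "((\<lambda>W. hopf W W) has_derivative (\<lambda>Z. 2 *\<^sub>R hopf W Z)) (at W)"
proof -
  have "((\<lambda>W. hopf W W) has_derivative (\<lambda>Z. hopf W Z + hopf Z W)) (at W)"
    by (rule bounded_bilinear.FDERIV[OF bounded_bilinear_hopf has_derivative_ident has_derivative_ident])
  moreover have "hopf W Z + hopf Z W = 2 *\<^sub>R hopf W Z" for Z
    by (simp add: hopf_commute[of Z W] scaleR_2)
  ultimately show ?thesis by simp
qed

lemma smooth_on_hopf: "open S \<Longrightarrow> smooth_on S (\<lambda>W. hopf W W)"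
  by (rule smooth_on_bilinear[OF _ bounded_bilinear_hopf smooth_on_id smooth_on_id])

lemma qexp_i_zero: "qexp_i 0 \<odot> W = W"
  by (simp add: prod_eq_iff quat_components qexp_i_def)

lemma qexp_i_add: "qexp_i s \<odot> (qexp_i t \<odot> W) = qexp_i (s + t) \<odot> W"
  unfolding qmul_assoc[symmetric]
  by (rule arg_cong[where f = "\<lambda>x. x \<odot> W"])
    (simp add: quat_components qexp_i_def cos_add sin_add algebra_simps)

lemma qexp_i_commute: "qunit 1 \<odot> (qexp_i t \<odot> W) = qexp_i t \<odot> (qunit 1 \<odot> W)"
  unfolding qmul_assoc[symmetric]
  by (rule arg_cong[where f = "\<lambda>x. x \<odot> W"])
    (simp add: quat_components qexp_i_def algebra_simps)

lemma qexp_i_inner: "(qexp_i t \<odot> W) \<bullet> (qexp_i t \<odot> Z) = W \<bullet> Z"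
proof -
  have "((c, s *\<^sub>R axis 1 1) \<odot> W) \<bullet> ((c, s *\<^sub>R axis 1 1) \<odot> Z) = (s\<^sup>2 + c\<^sup>2) * (W \<bullet> Z)" for c s :: real
    unfolding power2_eq_square by (simp add: quat_components algebra_simps)
  then show ?thesis by (simp add: qexp_i_def)
qed

lemma qexp_i_hopf: "hopf (qexp_i t \<odot> W) (qexp_i t \<odot> Z) = hopf W Z"
proof -
  have "hopf ((c, s *\<^sub>R axis 1 1) \<odot> W) ((c, s *\<^sub>R axis 1 1) \<odot> Z) = (s\<^sup>2 + c\<^sup>2) *\<^sub>R hopf W Z" for c s :: real
    unfolding power2_eq_square hopf_def by (simp add: quat_components algebra_simps)
  then show ?thesis by (simp add: qexp_i_def)
qed

lemma norm_hopf: "norm (hopf W W) = W \<bullet> W"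
proof -
  have "W \<bullet> (qunit 1 \<odot> W) = 0"
    using inner_qunit_qmul(1)[of W W] by (simp add: inner_commute)
  then have "(norm (hopf W W))\<^sup>2 = (W \<bullet> W)\<^sup>2"
    using hopf_pythagoras[of W W W]
    by (simp add: power2_norm_eq_inner inner_commute) (simp add: power2_eq_square)
  then show ?thesis by (simp add: power2_eq_iff_nonneg)
qed

lemma qexp_i_has_derivative:
  "(qexp_i has_derivative (\<lambda>h. h *\<^sub>R (qunit 1 \<odot> qexp_i t))) (at t)"
proof -
  have "(qexp_i has_vector_derivative (qunit 1 \<odot> qexp_i t)) (at t)"
    unfolding qexp_i_def
    by (auto intro!: derivative_eq_intros has_vector_derivative_Pair simp: quat_components has_real_derivative_iff_has_vector_derivative[symmetric])
  then show ?thesis unfolding has_vector_derivative_def .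
qed

lemma has_vector_derivative_qexp_i:
  "((\<lambda>t. qexp_i t \<odot> W) has_vector_derivative (qunit 1 \<odot> (qexp_i t \<odot> W))) (at t)"
proof -
  have "(qexp_i has_vector_derivative (qunit 1 \<odot> qexp_i t)) (at t)"
    using qexp_i_has_derivative unfolding has_vector_derivative_def .
  from bounded_linear.has_vector_derivative[OF bounded_bilinear.bounded_linear_left[OF bounded_bilinear_qmul] this, of W]
  show ?thesis by (simp add: qmul_assoc)
qed

section \<open>The magnetic monopole and its potentials\<close>

lemma curl_has_derivative:
  assumes "(A has_derivative A') (at x)"
  shows "curl A x = vector [A' (axis 2 1) $ 3 - A' (axis 3 1) $ 2,
    A' (axis 3 1) $ 1 - A' (axis 1 1) $ 3, A' (axis 1 1) $ 2 - A' (axis 2 1) $ 1]"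
  using frechet_derivative_at[OF assms] by (simp add: curl_def)

text \<open>The curl represents the skew part of the derivative, that is, the exterior derivative of the one-form
  \<open>A \<cdot> dr\<close>.\<close>

lemma curl_inner_cross3:
  assumes A: "(A has_derivative A') (at x)"
  shows "A' u \<bullet> v - A' v \<bullet> u = curl A x \<bullet> cross3 u v"
proof -
  have lin: "linear A'" by (rule has_derivative_linear[OF A])
  have expand: "A' w = (\<Sum>i\<in>UNIV. w $ i *\<^sub>R A' (axis i 1))" for w
    using arg_cong[OF basis_expansion[of w], of A']
    unfolding scalar_mult_eq_scaleR linear_sum[OF lin] linear_scale[OF lin] by (rule sym)
  have comp: "A' w $ j = (\<Sum>i\<in>UNIV. w $ i * A' (axis i 1) $ j)" for w j
    by (subst expand[of w]) simp
  define a where "a i j = A' (axis i 1) $ j" for i j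
  have "A' u \<bullet> v - A' v \<bullet> u = (\<Sum>j\<in>UNIV. (\<Sum>i\<in>UNIV. u $ i * a i j) * v $ j) -
      (\<Sum>j\<in>UNIV. (\<Sum>i\<in>UNIV. v $ i * a i j) * u $ j)"
    unfolding inner_vec_def inner_real_def comp[of u] comp[of v] a_def ..
  also have "\<dots> = vector [a 2 3 - a 3 2, a 3 1 - a 1 3, a 1 2 - a 2 1] \<bullet> cross3 u v"
    by (simp add: inner_vec_def sum_3 cross3_def) (simp add: algebra_simps)
  finally show ?thesis
    unfolding curl_has_derivative[OF A] a_def .
qed

lemma grad_inverse_norm:
  assumes "x \<noteq> 0"
  shows "grad (\<lambda>y. 1 / norm y) x = - (1 / norm x ^ 3) *\<^sub>R x"
proof -
  have "((\<lambda>y. inverse (norm y)) has_derivative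
      (\<lambda>v. - (inverse (norm x) * (v \<bullet> sgn x) * inverse (norm x)))) (at x)"
    using assms by (intro Deriv.has_derivative_inverse has_derivative_norm) auto
  moreover have "- (inverse (norm x) * (v \<bullet> sgn x) * inverse (norm x)) = - (1 / norm x ^ 3) * (v \<bullet> x)" for v
    by (simp add: sgn_div_norm power3_eq_cube divide_inverse)
  ultimately have "((\<lambda>y. 1 / norm y) has_derivative (\<lambda>v. - (1 / norm x ^ 3) * (v \<bullet> x))) (at x)"
    by (simp add: inverse_eq_divide)
  then have "frechet_derivative (\<lambda>y. 1 / norm y) (at x) = (\<lambda>v. - (1 / norm x ^ 3) * (v \<bullet> x))"
    using frechet_derivative_at by metis
  then show ?thesis by (simp add: grad_def vec_eq_iff inner_axis' )
qed

text \<open>The classical Dirac potential \<open>(r \<times> n) / (|r| (|r| + n \<cdot> r))\<close>, with \<open>n\<close> a unit vector.  It is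
  singular only on the ray spanned by \<open>- n\<close>, which the choice \<open>n = r0 / |r0|\<close> keeps away from \<open>r0\<close>.\<close>

lemma local_potential_exists:
  assumes r0: "r0 \<noteq> (0 :: real^3)"
  shows "\<exists>U A. r0 \<in> U \<and> local_potential U A"
proof -
  define n where "n = r0 /\<^sub>R norm r0"
  have nn: "n \<bullet> n = 1"
    using r0 by (simp add: n_def dot_square_norm power2_eq_square)
  define U where "U = {r. r \<noteq> 0 \<and> norm r + n \<bullet> r > 0}"
  define g where "g r = inverse (norm r * (norm r + n \<bullet> r))" for r :: "real^3"
  define A where "A r = g r *\<^sub>R cross3 r n" for r
  have "U = - {0} \<inter> {r. norm r + n \<bullet> r > 0}" by (auto simp: U_def)
  then have oU: "open U"
    by (auto intro!: open_Collect_less continuous_intros)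
  have "n \<bullet> r0 = norm r0"
    using r0 by (simp add: n_def dot_square_norm power2_eq_square)
  then have r0U: "r0 \<in> U" using r0 by (simp add: U_def)
  have cross: "bounded_linear (\<lambda>r. cross3 r n)"
    by (simp add: linear_conv_bounded_linear[symmetric] linear_iff cross_add_left cross_mult_left)
  have norm: "smooth_on U norm"
    by (rule smooth_on_subset[OF smooth_on_norm]) (auto simp: U_def)
  have "smooth_on U (\<lambda>r. norm r * (norm r + n \<bullet> r))"
    by (rule smooth_on_mult[OF oU norm smooth_on_add[OF oU norm
            smooth_on_bounded_linear[OF oU bounded_linear_inner_right]]])
  then have "smooth_on U g"
    unfolding g_def
    by (intro smooth_on_compose[where g = inverse and V = "- {0}", OF oU _ _ _ smooth_on_inverse])
      (auto simp: U_def)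
  then have smA: "smooth_on U A"
    unfolding A_def
    by (rule smooth_on_bilinear[OF oU bounded_bilinear_scaleR _ smooth_on_bounded_linear[OF oU cross]])
  have "curl A r = grad (\<lambda>y. 1 / norm y) r" if r: "r \<in> U" for r
  proof -
    define \<rho> s where "\<rho> = norm r" and "s = n \<bullet> r"
    have \<rho>: "\<rho> > 0" "\<rho> + s > 0" using r by (auto simp: U_def \<rho>_def s_def)
    \<comment> \<open>The gradient of \<open>g\<close>.\<close>
    define G where "G = - (g r)\<^sup>2 *\<^sub>R ((2 + s / \<rho>) *\<^sub>R r + \<rho> *\<^sub>R n)"
    have r0: "r \<noteq> 0" using r by (simp add: U_def)
    have dnorm: "(norm has_derivative (\<lambda>v. (v \<bullet> r) / \<rho>)) (at r)"
      using has_derivative_norm[OF r0] by (simp add: sgn_div_norm \<rho>_def divide_inverse mult.commute)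
    have gr: "g r = inverse (\<rho> * (\<rho> + s))" by (simp add: g_def \<rho>_def s_def)
    have "((\<lambda>r. norm r * (norm r + n \<bullet> r)) has_derivative
        (\<lambda>v. \<rho> * ((v \<bullet> r) / \<rho> + n \<bullet> v) + (v \<bullet> r) / \<rho> * (\<rho> + s))) (at r)"
      unfolding \<rho>_def s_def
      by (rule has_derivative_mult[OF dnorm[unfolded \<rho>_def] has_derivative_add[OF dnorm[unfolded \<rho>_def]
              bounded_linear_imp_has_derivative[OF bounded_linear_inner_right]]])
    moreover have "norm r * (norm r + n \<bullet> r) \<noteq> 0" using \<rho> unfolding \<rho>_def s_def by simp
    ultimately have "(g has_derivative (\<lambda>v. - (inverse (\<rho> * (\<rho> + s)) *
          (\<rho> * ((v \<bullet> r) / \<rho> + n \<bullet> v) + (v \<bullet> r) / \<rho> * (\<rho> + s)) * inverse (\<rho> * (\<rho> + s))))) (at r)"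
      unfolding g_def[abs_def] \<rho>_def s_def by (intro Deriv.has_derivative_inverse)
    moreover have "- (inverse (\<rho> * (\<rho> + s)) *
          (\<rho> * ((v \<bullet> r) / \<rho> + n \<bullet> v) + (v \<bullet> r) / \<rho> * (\<rho> + s)) * inverse (\<rho> * (\<rho> + s))) = G \<bullet> v" for v
    proof -
      have "G \<bullet> v = - (g r)\<^sup>2 * ((2 + s / \<rho>) * (v \<bullet> r) + \<rho> * (n \<bullet> v))"
        by (simp add: G_def inner_add_left inner_commute[of v r])
      moreover have "\<rho> * ((v \<bullet> r) / \<rho> + n \<bullet> v) + (v \<bullet> r) / \<rho> * (\<rho> + s) = (2 + s / \<rho>) * (v \<bullet> r) + \<rho> * (n \<bullet> v)"
        using \<rho> by (simp add: field_simps)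
      ultimately show ?thesis by (simp add: gr power2_eq_square mult.assoc mult.left_commute)
    qed
    ultimately have dg: "(g has_derivative (\<lambda>v. G \<bullet> v)) (at r)" by simp
    have dA: "(A has_derivative (\<lambda>v. g r *\<^sub>R cross3 v n + (G \<bullet> v) *\<^sub>R cross3 r n)) (at r)"
      unfolding A_def by (rule has_derivative_scaleR[OF dg bounded_linear_imp_has_derivative[OF cross]])
    have axis_nth: "axis i (1::real) $ j = (if j = i then 1 else 0)" for i j :: 3
      by (simp add: axis_def)
    from curl_has_derivative[OF dA]
    have "curl A r = cross3 G (cross3 r n) - (2 * g r) *\<^sub>R n"
      by (simp add: vec_eq_iff forall_3 cross3_def inner_axis axis_nth algebra_simps)
    also have "\<dots> = - (g r)\<^sup>2 *\<^sub>R ((2 + s / \<rho>) *\<^sub>R (s *\<^sub>R r - \<rho>\<^sup>2 *\<^sub>R n) + \<rho> *\<^sub>R (r - s *\<^sub>R n)) - (2 * g r) *\<^sub>R n"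
    proof -
      have "cross3 r (cross3 r n) = s *\<^sub>R r - \<rho>\<^sup>2 *\<^sub>R n" "cross3 n (cross3 r n) = r - s *\<^sub>R n"
        by (simp add: Lagrange s_def \<rho>_def inner_commute dot_square_norm)
          (simp add: Lagrange nn s_def)
      then show ?thesis by (simp add: G_def cross_add_left cross_mult_left)
    qed
    also have "\<dots> = (- (g r)\<^sup>2 * ((2 + s / \<rho>) * s + \<rho>)) *\<^sub>R r +
        ((g r)\<^sup>2 * ((2 + s / \<rho>) * \<rho>\<^sup>2 + \<rho> * s) - 2 * g r) *\<^sub>R n"
    proof -
      have "- c *\<^sub>R (a *\<^sub>R (s *\<^sub>R r - q *\<^sub>R n) + \<rho> *\<^sub>R (r - s *\<^sub>R n)) - k *\<^sub>R n =
          (- c * (a * s + \<rho>)) *\<^sub>R r + (c * (a * q + \<rho> * s) - k) *\<^sub>R n" for a c k q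
        by (simp add: algebra_simps)
      then show ?thesis .
    qed
    also have "- (g r)\<^sup>2 * ((2 + s / \<rho>) * s + \<rho>) = - (1 / \<rho> ^ 3)"
    proof -
      have "(2 + s / \<rho>) * s + \<rho> = (\<rho> + s)\<^sup>2 / \<rho>"
        using \<rho> by (simp add: field_simps power2_eq_square)
      moreover have "(inverse (\<rho> * x))\<^sup>2 * (x\<^sup>2 / \<rho>) = 1 / \<rho> ^ 3" if "x > 0" for x
        using \<rho> that by (simp add: field_simps power2_eq_square power3_eq_cube)
      ultimately show ?thesis using \<rho> by (simp add: gr)
    qed
    also have "(g r)\<^sup>2 * ((2 + s / \<rho>) * \<rho>\<^sup>2 + \<rho> * s) - 2 * g r = 0"
    proof -
      have "(2 + s / \<rho>) * \<rho>\<^sup>2 + \<rho> * s = 2 * (\<rho> * (\<rho> + s))"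
        using \<rho> by (simp add: distrib_left distrib_right power2_eq_square)
      moreover have "(g r)\<^sup>2 * (2 * (\<rho> * (\<rho> + s))) = 2 * g r"
      proof -
        have "(inverse y)\<^sup>2 * (2 * y) = 2 * inverse y" if "y > 0" for y :: real
          using that by (simp add: power2_eq_square)
        then show ?thesis using \<rho> by (simp add: gr del: inverse_mult_distrib)
      qed
      ultimately show ?thesis by simp
    qed
    finally show ?thesis by (simp add: grad_inverse_norm[OF r0] \<rho>_def)
  qed
  then have "local_potential U A"
    using oU smA by (auto simp: local_potential_def U_def)
  with r0U show ?thesis by blast
qed

section \<open>Local coordinates on the punctured quaternions\<close>

text \<open>The one-form \<open>\<eta> - a \<cdot> dr\<close> at \<open>W\<close>, where \<open>\<eta> = - 2 \<langle>iW, dW\<rangle>/|W|\<^sup>2\<close> is a multiple of the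
  connection form of the Hopf fibration and \<open>dr = 2 hopf W\<close>.  For \<open>a = \<Omega>(r)\<close> this is to become the
  differential of the coordinate \<open>\<tau>\<close>.  The factor \<open>- 2\<close> is dictated by the equation
  \<open>curl \<Omega> = grad (1/r)\<close>: for no other factor is the form closed.\<close>

definition tau_form :: "real^3 \<Rightarrow> quat \<Rightarrow> quat \<Rightarrow> real" where
  "tau_form a W Z = - (2 / (W \<bullet> W)) * ((qunit 1 \<odot> W) \<bullet> Z) - 2 * (a \<bullet> hopf W Z)"

lemma tau_form_qexp_i: "tau_form a (qexp_i t \<odot> W) (qexp_i t \<odot> Z) = tau_form a W Z"
  by (simp add: tau_form_def qexp_i_commute qexp_i_inner qexp_i_hopf)

lemma tau_form_vertical: "W \<noteq> 0 \<Longrightarrow> tau_form a W (qunit 1 \<odot> W) = - 2"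
  by (simp add: tau_form_def hopf_vertical inner_qunit_qmul(2))

lemma linear_tau_form: "linear (tau_form a W)"
  unfolding linear_iff tau_form_def linear_add[OF linear_hopf_right] linear_scale[OF linear_hopf_right]
    inner_add_right inner_scaleR_right by (simp add: algebra_simps)

lemma linear_tau_form_hopf: "linear (\<lambda>Z. (tau_form a W Z, 2 *\<^sub>R hopf W Z))"
  by (rule linearI) (simp_all only: linear_add[OF linear_tau_form] linear_scale[OF linear_tau_form]
      linear_add[OF linear_hopf_right] linear_scale[OF linear_hopf_right] scaleR_add_right
      add_Pair scaleR_Pair scaleR_left_commute[of 2])

text \<open>A vector annihilated by \<open>dr\<close> and \<open>\<eta>\<close> is orthogonal to itself by \<open>hopf_pythagoras\<close>.\<close>

lemma inj_tau_form_hopf: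
  assumes "W \<noteq> 0"
  shows "inj (\<lambda>Z. (tau_form a W Z, 2 *\<^sub>R hopf W Z))"
  unfolding linear_injective_0[OF linear_tau_form_hopf]
proof (intro allI impI)
  fix Z assume "(tau_form a W Z, 2 *\<^sub>R hopf W Z) = 0"
  then have h: "hopf W Z = 0" and "tau_form a W Z = 0"
    by (simp_all add: prod_eq_iff)
  then have v: "(qunit 1 \<odot> W) \<bullet> Z = 0"
    using assms by (simp add: tau_form_def)
  have "(W \<bullet> W) * (Z \<bullet> Z) = 0"
    unfolding hopf_pythagoras h v by simp
  then show "Z = 0" using assms by simp
qed

lemma surj_tau_form_hopf:
  assumes "W \<noteq> 0"
  shows "\<exists>Z. tau_form a W Z = t \<and> 2 *\<^sub>R hopf W Z = r"
proof -
  have "surj (\<lambda>Z. (tau_form a W Z, 2 *\<^sub>R hopf W Z))"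
    by (rule linear_injective_imp_surjective[OF linear_tau_form_hopf inj_tau_form_hopf[OF assms]]) simp
  then obtain Z where "(t, r) = (tau_form a W Z, 2 *\<^sub>R hopf W Z)" by (rule surjE)
  then have "tau_form a W Z = t \<and> 2 *\<^sub>R hopf W Z = r" by simp
  then show ?thesis by (rule exI)
qed

lemma smooth_on_tau_form:
  assumes S: "open S" "0 \<notin> S" and U: "open U" "(\<lambda>W. hopf W W) ` S \<subseteq> U" and A: "smooth_on U A"
  shows "smooth_on S (\<lambda>W. tau_form (A (hopf W W)) W Z)"
proof -
  have "smooth_on S (\<lambda>W::quat. W \<bullet> W)"
    by (rule smooth_on_bilinear[OF S(1) bounded_bilinear_inner smooth_on_id[OF S(1)] smooth_on_id[OF S(1)]])
  moreover have "(\<lambda>W::quat. W \<bullet> W) ` S \<subseteq> - {0}"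
  proof (rule image_subsetI)
    fix W assume "W \<in> S"
    then have "W \<noteq> 0" using S(2) by blast
    then show "W \<bullet> W \<in> - {0}" unfolding Compl_iff singleton_iff inner_eq_zero_iff .
  qed
  ultimately have "smooth_on S (\<lambda>W. inverse (W \<bullet> W))"
    by (intro smooth_on_compose[where g = inverse and V = "- {0}", OF S(1) _ _ _ smooth_on_inverse]) auto
  then have i: "smooth_on S (\<lambda>W. - (2 * inverse (W \<bullet> W)))"
    by (intro smooth_on_minus[OF S(1)] smooth_on_linear[OF S(1) bounded_linear_mult_right])
  have v: "smooth_on S (\<lambda>W. (qunit 1 \<odot> W) \<bullet> Z)"
    by (rule smooth_on_bounded_linear[OF S(1)
          bounded_linear_compose[OF bounded_linear_inner_left bounded_bilinear.bounded_linear_right[OF bounded_bilinear_qmul]]])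
  have "smooth_on S (\<lambda>W. A (hopf W W))"
    by (rule smooth_on_compose[OF S(1) U smooth_on_hopf[OF S(1)] A])
  then have "smooth_on S (\<lambda>W. A (hopf W W) \<bullet> hopf W Z)"
    by (rule smooth_on_bilinear[OF S(1) bounded_bilinear_inner _
          smooth_on_bounded_linear[OF S(1) bounded_bilinear.bounded_linear_left[OF bounded_bilinear_hopf]]])
  then have "smooth_on S (\<lambda>W. 2 * (A (hopf W W) \<bullet> hopf W Z))"
    by (rule smooth_on_linear[OF S(1) bounded_linear_mult_right])
  from smooth_on_diff[OF S(1) smooth_on_mult[OF S(1) i v] this]
  show ?thesis by (simp add: tau_form_def divide_inverse)
qed

text \<open>The terms with \<open>A\<close> undifferentiated cancel by symmetry of the second derivative of \<open>r\<close>; those with the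
  derivative of \<open>A\<close> combine to the curl, which \<open>hopf_triple\<close> matches with the exterior derivative of \<open>\<eta>\<close>.\<close>

lemma tau_form_closed:
  assumes W: "W \<noteq> 0"
    and A: "(A has_derivative A') (at (hopf W W))"
    and curl: "curl A (hopf W W) = grad (\<lambda>y. 1 / norm y) (hopf W W)"
  shows "frechet_derivative (\<lambda>W. tau_form (A (hopf W W)) W Z) (at W) Z' =
    frechet_derivative (\<lambda>W. tau_form (A (hopf W W)) W Z') (at W) Z"
proof -
  define w where "w = W \<bullet> W"
  have w: "w > 0" using W by (simp add: w_def)
  \<comment> \<open>The derivative in direction \<open>Z'\<close> of the value of the one-form on the constant field \<open>Z\<close>.\<close>
  define D where "D Z Z' = - (2 / w) * ((qunit 1 \<odot> Z') \<bullet> Z) + 4 * (W \<bullet> Z') / w\<^sup>2 * ((qunit 1 \<odot> W) \<bullet> Z)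
      - 2 * (A (hopf W W) \<bullet> hopf Z' Z + A' (2 *\<^sub>R hopf W Z') \<bullet> hopf W Z)" for Z Z'
  have lin: "linear A'" by (rule has_derivative_linear[OF A])
  have D: "frechet_derivative (\<lambda>W. tau_form (A (hopf W W)) W Z) (at W) = D Z" for Z
  proof (rule frechet_derivative_at[symmetric])
    have dw: "((\<lambda>W. W \<bullet> W) has_derivative (\<lambda>Z'. W \<bullet> Z' + Z' \<bullet> W)) (at W)"
      by (rule has_derivative_inner[OF has_derivative_ident has_derivative_ident])
    have di: "((\<lambda>W. inverse (W \<bullet> W)) has_derivative
        (\<lambda>Z'. - (inverse (W \<bullet> W) * (W \<bullet> Z' + Z' \<bullet> W) * inverse (W \<bullet> W)))) (at W)"
      by (rule Deriv.has_derivative_inverse[OF _ dw]) (use W in simp)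
    have dv: "((\<lambda>W. (qunit 1 \<odot> W) \<bullet> Z) has_derivative (\<lambda>Z'. (qunit 1 \<odot> Z') \<bullet> Z)) (at W)"
      by (rule bounded_linear_imp_has_derivative[OF bounded_linear_compose[OF bounded_linear_inner_left
              bounded_bilinear.bounded_linear_right[OF bounded_bilinear_qmul]]])
    have dA: "((\<lambda>W. A (hopf W W)) has_derivative (\<lambda>Z'. A' (2 *\<^sub>R hopf W Z'))) (at W)"
      by (rule has_derivative_compose[where g = A and g' = A', OF has_derivative_hopf A])
    have dh: "((\<lambda>W. hopf W Z) has_derivative (\<lambda>Z'. hopf Z' Z)) (at W)"
      by (rule bounded_linear_imp_has_derivative[OF bounded_bilinear.bounded_linear_left[OF bounded_bilinear_hopf]])
    have "((\<lambda>W. - 2 * (inverse (W \<bullet> W) * ((qunit 1 \<odot> W) \<bullet> Z)) - 2 * (A (hopf W W) \<bullet> hopf W Z)) has_derivative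
       (\<lambda>Z'. - 2 * (inverse (W \<bullet> W) * ((qunit 1 \<odot> Z') \<bullet> Z) +
          - (inverse (W \<bullet> W) * (W \<bullet> Z' + Z' \<bullet> W) * inverse (W \<bullet> W)) * ((qunit 1 \<odot> W) \<bullet> Z))
          - 2 * (A (hopf W W) \<bullet> hopf Z' Z + A' (2 *\<^sub>R hopf W Z') \<bullet> hopf W Z))) (at W)"
      by (rule has_derivative_diff[OF has_derivative_mult_right[OF has_derivative_mult[OF di dv]]
            has_derivative_mult_right[OF has_derivative_inner[OF dA dh]]])
    moreover have "- 2 * (inverse (W \<bullet> W) * ((qunit 1 \<odot> Z') \<bullet> Z) +
          - (inverse (W \<bullet> W) * (W \<bullet> Z' + Z' \<bullet> W) * inverse (W \<bullet> W)) * ((qunit 1 \<odot> W) \<bullet> Z))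
          - 2 * (A (hopf W W) \<bullet> hopf Z' Z + A' (2 *\<^sub>R hopf W Z') \<bullet> hopf W Z) = D Z Z'" for Z'
      unfolding D_def w_def inner_commute[of Z' W] by (simp add: divide_inverse power2_eq_square distrib_left)
    moreover have "- 2 * (inverse (W \<bullet> W) * ((qunit 1 \<odot> W) \<bullet> Z)) - 2 * (A (hopf W W) \<bullet> hopf W Z) =
        tau_form (A (hopf W W)) W Z" for W
      by (simp add: tau_form_def divide_inverse)
    ultimately show "((\<lambda>W. tau_form (A (hopf W W)) W Z) has_derivative D Z) (at W)" by simp
  qed
  have "hopf W W \<noteq> 0" using norm_hopf[of W] w by (auto simp: w_def)
  then have "curl A (hopf W W) = - (1 / w ^ 3) *\<^sub>R hopf W W"
    by (simp add: curl grad_inverse_norm norm_hopf w_def)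
  then have "A' (hopf W Z') \<bullet> hopf W Z - A' (hopf W Z) \<bullet> hopf W Z' =
      - (1 / w ^ 3) * (hopf W W \<bullet> cross3 (hopf W Z') (hopf W Z))"
    using curl_inner_cross3[OF A, of "hopf W Z'" "hopf W Z"] by simp
  also have "\<dots> = - (1 / w\<^sup>2) * (((qunit 1 \<odot> Z') \<bullet> Z) * w - (W \<bullet> Z') * ((qunit 1 \<odot> W) \<bullet> Z)
       + (W \<bullet> Z) * ((qunit 1 \<odot> W) \<bullet> Z'))"
    unfolding hopf_triple using w by (simp add: w_def[symmetric] power2_eq_square power3_eq_cube)
  finally have key: "A' (hopf W Z') \<bullet> hopf W Z = A' (hopf W Z) \<bullet> hopf W Z' -
      (1 / w\<^sup>2) * (((qunit 1 \<odot> Z') \<bullet> Z) * w - (W \<bullet> Z') * ((qunit 1 \<odot> W) \<bullet> Z)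
       + (W \<bullet> Z) * ((qunit 1 \<odot> W) \<bullet> Z'))" by simp
  have skew: "(qunit 1 \<odot> Z) \<bullet> Z' = - ((qunit 1 \<odot> Z') \<bullet> Z)"
    using inner_qunit_qmul(1)[of Z Z'] by (simp add: inner_commute)
  have "D Z Z' = D Z' Z"
    unfolding D_def linear_scale[OF lin] inner_scaleR_left key skew hopf_commute[of Z' Z]
    using w by (simp add: field_simps power2_eq_square)
  then show ?thesis by (simp add: D)
qed

definition hopf_chart :: "(real^3) set \<Rightarrow> (real^3 \<Rightarrow> real^3) \<Rightarrow> quat set \<Rightarrow> (quat \<Rightarrow> real) \<Rightarrow> bool" where
  "hopf_chart U A N \<tau> \<longleftrightarrow> open N \<and> (\<forall>W\<in>N. W \<noteq> 0 \<and> hopf W W \<in> U) \<and> smooth_on N \<tau> \<and>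
     (\<forall>W\<in>N. (\<tau> has_derivative tau_form (A (hopf W W)) W) (at W)) \<and>
     inj_on (\<lambda>W. (\<tau> W, hopf W W)) N \<and> open ((\<lambda>W. (\<tau> W, hopf W W)) ` N)"

text \<open>\<open>\<tau>\<close> is a primitive of the closed form on a ball around \<open>W0\<close>; the Jacobian of \<open>(\<tau>, r)\<close> is
  invertible by \<open>inj_tau_form_hopf\<close>.\<close>

lemma hopf_chart_exists:
  assumes W0: "hopf W0 W0 \<in> U" and A: "local_potential U A"
  shows "\<exists>N \<tau>. W0 \<in> N \<and> hopf_chart U A N \<tau>"
proof -
  have U: "open U" "0 \<notin> U" and smA: "smooth_on U A"
    and curl: "\<And>r. r \<in> U \<Longrightarrow> curl A r = grad (\<lambda>y. 1 / norm y) r"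
    using A by (auto simp: local_potential_def)
  have cont: "continuous_on UNIV (\<lambda>W. hopf W W)"
    by (rule smooth_on_imp_continuous_on[OF smooth_on_hopf[OF open_UNIV]])
  have "open ((\<lambda>W. hopf W W) -` U)"
    by (rule open_vimage[OF U(1) cont])
  then obtain e where e: "e > 0" "ball W0 e \<subseteq> (\<lambda>W. hopf W W) -` U"
    using W0 open_contains_ball by blast
  define S where "S = ball W0 e"
  have S: "open S" "convex S" "W0 \<in> S" using e by (auto simp: S_def)
  have SU: "hopf W W \<in> U" if "W \<in> S" for W using e that by (auto simp: S_def)
  have nz: "W \<noteq> 0" if "W \<in> S" for W
  proof
    assume "W = 0"
    then have "hopf W W = 0" using linear_0[OF linear_hopf_right] by simp
    then show False using SU[OF that] U(2) by simp
  qed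
  let ?\<omega> = "\<lambda>W. tau_form (A (hopf W W)) W"
  have "0 \<notin> S" using nz by blast
  moreover have "(\<lambda>W. hopf W W) ` S \<subseteq> U" using SU by blast
  ultimately have smooth: "smooth_on S (\<lambda>W. ?\<omega> W Z)" for Z
    by (intro smooth_on_tau_form[OF S(1) _ U(1) _ smA])
  have "frechet_derivative (\<lambda>W. ?\<omega> W Z) (at W) Z' = frechet_derivative (\<lambda>W. ?\<omega> W Z') (at W) Z"
    if "W \<in> S" for W Z Z'
    by (rule tau_form_closed[OF nz[OF that] smooth_on_has_derivative[OF smA SU[OF that]] curl[OF SU[OF that]]])
  note closed = this
  obtain \<tau> where \<tau>: "\<And>W. W \<in> S \<Longrightarrow> (\<tau> has_derivative ?\<omega> W) (at W)"
    using poincare_lemma[OF S(1,2) linear_tau_form smooth closed] by blast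
  have sm\<tau>: "smooth_on S \<tau>"
    by (rule smooth_onI[OF S(1) \<tau> smooth])
  define f where "f W = (\<tau> W, hopf W W)" for W
  define f' where "f' W = Blinfun (\<lambda>Z. (?\<omega> W Z, 2 *\<^sub>R hopf W Z))" for W
  have bl: "bounded_linear (\<lambda>Z. (?\<omega> W Z, 2 *\<^sub>R hopf W Z))" for W
    using linear_tau_form_hopf linear_conv_bounded_linear by blast
  have f'_apply: "blinfun_apply (f' W) = (\<lambda>Z. (?\<omega> W Z, 2 *\<^sub>R hopf W Z))" for W
    unfolding f'_def by (rule bounded_linear_Blinfun_apply[OF bl])
  have df: "(f has_derivative blinfun_apply (f' W)) (at W)" if "W \<in> S" for W
    unfolding f'_apply f_def by (rule has_derivative_Pair[OF \<tau>[OF that] has_derivative_hopf])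
  have "continuous_on S (\<lambda>W. (?\<omega> W Z, 2 *\<^sub>R hopf W Z))" for Z
    by (intro continuous_on_Pair continuous_on_scaleR continuous_on_const
        smooth_on_imp_continuous_on[OF smooth]
        smooth_on_imp_continuous_on[OF smooth_on_bounded_linear[OF S(1)
            bounded_bilinear.bounded_linear_left[OF bounded_bilinear_hopf]]])
  then have cont: "continuous_on S f'"
    by (intro continuous_on_blinfun_componentwise) (simp add: f'_apply)
  obtain g where g: "linear g" "g \<circ> (\<lambda>Z. (?\<omega> W0 Z, 2 *\<^sub>R hopf W0 Z)) = id"
    using linear_injective_left_inverse[OF linear_tau_form_hopf inj_tau_form_hopf[OF nz[OF S(3)]]] by blast
  have blg: "bounded_linear g" using g(1) linear_conv_bounded_linear by blast
  have inv: "Blinfun g o\<^sub>L f' W0 = id_blinfun"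
  proof (rule blinfun_eqI)
    fix Z
    show "blinfun_apply (Blinfun g o\<^sub>L f' W0) Z = blinfun_apply id_blinfun Z"
      using fun_cong[OF g(2), of Z]
      unfolding blinfun_apply_blinfun_compose f'_apply bounded_linear_Blinfun_apply[OF blg] by simp
  qed
  obtain N V h where N: "open N" "N \<subseteq> S" "W0 \<in> N" "open V" "homeomorphism N V f h"
    by (rule inverse_function_theorem[OF S(1) df cont S(3) inv], assumption, rule that, assumption+)
  have "inj_on f N" "f ` N = V"
    using N(5) by (auto simp: homeomorphism_def intro: inj_on_inverseI)
  moreover have "smooth_on N \<tau>" by (rule smooth_on_subset[OF sm\<tau> N(2)])
  moreover have "\<forall>W\<in>N. W \<noteq> 0 \<and> hopf W W \<in> U" using nz SU N(2) by blast
  moreover have "\<forall>W\<in>N. (\<tau> has_derivative ?\<omega> W) (at W)" using \<tau> N(2) by blast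
  ultimately have "W0 \<in> N \<and> hopf_chart U A N \<tau>"
    using N(1,3,4) unfolding hopf_chart_def f_def by simp
  then show ?thesis by blast
qed

section \<open>The matrix H\<close>

lemma Hmat_nth:
  fixes \<theta> :: "real^'n::finite^'q::finite"
  shows "Hmat \<theta> \<Lambda> r $ \<beta> $ \<gamma> =
    (\<Sum>a\<in>\<Lambda>. \<theta> $ \<beta> $ a * \<theta> $ \<gamma> $ a) + (if \<gamma> = \<beta> then 1 / norm (r $ \<beta>) else 0)"
proof -
  have "(theta_tilde \<theta> \<Lambda> ** transpose (theta_tilde \<theta> \<Lambda>)) $ \<beta> $ \<gamma> =
      (\<Sum>a\<in>UNIV. if a \<in> \<Lambda> then \<theta> $ \<beta> $ a * \<theta> $ \<gamma> $ a else 0)"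
    unfolding matrix_matrix_mult_def transpose_def theta_tilde_def by (auto intro!: sum.cong)
  also have "\<dots> = (\<Sum>a\<in>\<Lambda>. \<theta> $ \<beta> $ a * \<theta> $ \<gamma> $ a)"
    by (simp add: sum.If_cases)
  finally show ?thesis by (simp add: Hmat_def)
qed

text \<open>The form defined by \<open>H\<close>, extended to vectors with values in an inner product space: it is needed for
  \<open>dr\<^sub>\<beta> \<cdot> dr\<^sub>\<gamma>\<close> as well as for products of real numbers.\<close>

lemma Hmat_bilinear:
  fixes \<theta> :: "real^'n::finite^'q::finite" and u v :: "'q \<Rightarrow> 'v::real_inner"
  shows "(\<Sum>\<beta>\<in>UNIV. \<Sum>\<gamma>\<in>UNIV. Hmat \<theta> \<Lambda> r $ \<beta> $ \<gamma> * (u \<beta> \<bullet> v \<gamma>)) =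
    (\<Sum>a\<in>\<Lambda>. (\<Sum>\<beta>\<in>UNIV. \<theta> $ \<beta> $ a *\<^sub>R u \<beta>) \<bullet> (\<Sum>\<gamma>\<in>UNIV. \<theta> $ \<gamma> $ a *\<^sub>R v \<gamma>)) +
    (\<Sum>\<beta>\<in>UNIV. (u \<beta> \<bullet> v \<beta>) / norm (r $ \<beta>))"
proof -
  have entry: "Hmat \<theta> \<Lambda> r $ \<beta> $ \<gamma> * (u \<beta> \<bullet> v \<gamma>) =
      (\<Sum>a\<in>\<Lambda>. (\<theta> $ \<beta> $ a *\<^sub>R u \<beta>) \<bullet> (\<theta> $ \<gamma> $ a *\<^sub>R v \<gamma>)) +
      (if \<gamma> = \<beta> then (u \<beta> \<bullet> v \<beta>) / norm (r $ \<beta>) else 0)" for \<beta> \<gamma>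
    by (simp add: Hmat_nth distrib_right sum_distrib_right mult.assoc mult.left_commute)
  have swap: "(\<Sum>\<beta>\<in>UNIV. \<Sum>\<gamma>\<in>UNIV. \<Sum>a\<in>\<Lambda>. x a \<beta> \<bullet> y a \<gamma>) =
      (\<Sum>a\<in>\<Lambda>. (\<Sum>\<beta>\<in>UNIV. x a \<beta>) \<bullet> (\<Sum>\<gamma>\<in>UNIV. y a \<gamma>))" for x y :: "'n \<Rightarrow> 'q \<Rightarrow> 'v"
  proof -
    have "(\<Sum>\<beta>\<in>UNIV. \<Sum>\<gamma>\<in>UNIV. \<Sum>a\<in>\<Lambda>. x a \<beta> \<bullet> y a \<gamma>) = (\<Sum>\<beta>\<in>UNIV. \<Sum>a\<in>\<Lambda>. \<Sum>\<gamma>\<in>UNIV. x a \<beta> \<bullet> y a \<gamma>)"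
      by (intro sum.cong refl) (rule sum.swap)
    also have "\<dots> = (\<Sum>a\<in>\<Lambda>. \<Sum>\<beta>\<in>UNIV. \<Sum>\<gamma>\<in>UNIV. x a \<beta> \<bullet> y a \<gamma>)"
      by (rule sum.swap)
    also have "\<dots> = (\<Sum>a\<in>\<Lambda>. (\<Sum>\<beta>\<in>UNIV. x a \<beta>) \<bullet> (\<Sum>\<gamma>\<in>UNIV. y a \<gamma>))"
      by (simp only: inner_sum_left) (simp only: inner_sum_right)
    finally show ?thesis .
  qed
  show ?thesis
    unfolding entry sum.distrib swap by simp
qed

lemma Hmat_sym: "Hmat \<theta> \<Lambda> r $ \<beta> $ \<gamma> = Hmat \<theta> \<Lambda> r $ \<gamma> $ \<beta>"
  by (auto simp: Hmat_def matrix_matrix_mult_def transpose_def mult.commute)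

lemma Hmat_invertible:
  assumes "\<And>\<beta>. r $ \<beta> \<noteq> 0"
  shows "invertible (Hmat \<theta> \<Lambda> r)"
proof -
  have "b = 0" if b: "Hmat \<theta> \<Lambda> r *v b = 0" for b
  proof -
    have "(\<Sum>\<beta>\<in>UNIV. \<Sum>\<gamma>\<in>UNIV. Hmat \<theta> \<Lambda> r $ \<beta> $ \<gamma> * (b $ \<beta> \<bullet> b $ \<gamma>)) = b \<bullet> (Hmat \<theta> \<Lambda> r *v b)"
      by (simp add: inner_vec_def matrix_vector_mult_def sum_distrib_left mult_ac)
    then have "(\<Sum>a\<in>\<Lambda>. (\<Sum>\<beta>\<in>UNIV. \<theta> $ \<beta> $ a *\<^sub>R b $ \<beta>) \<bullet> (\<Sum>\<gamma>\<in>UNIV. \<theta> $ \<gamma> $ a *\<^sub>R b $ \<gamma>)) +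
        (\<Sum>\<beta>\<in>UNIV. (b $ \<beta> \<bullet> b $ \<beta>) / norm (r $ \<beta>)) = 0"
      unfolding Hmat_bilinear b by simp
    moreover have "(\<Sum>a\<in>\<Lambda>. (\<Sum>\<beta>\<in>UNIV. \<theta> $ \<beta> $ a *\<^sub>R b $ \<beta>) \<bullet> (\<Sum>\<gamma>\<in>UNIV. \<theta> $ \<gamma> $ a *\<^sub>R b $ \<gamma>)) \<ge> 0"
      by (intro sum_nonneg inner_ge_zero)
    moreover have nonneg: "(b $ \<beta> \<bullet> b $ \<beta>) / norm (r $ \<beta>) \<ge> 0" for \<beta> by simp
    moreover have "(\<Sum>\<beta>\<in>UNIV. (b $ \<beta> \<bullet> b $ \<beta>) / norm (r $ \<beta>)) \<ge> 0"
      by (intro sum_nonneg nonneg)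
    ultimately have "(\<Sum>\<beta>\<in>UNIV. (b $ \<beta> \<bullet> b $ \<beta>) / norm (r $ \<beta>)) = 0" by linarith
    then have z: "(b $ \<beta> \<bullet> b $ \<beta>) / norm (r $ \<beta>) = 0" for \<beta>
      using sum_nonneg_eq_0_iff[of UNIV "\<lambda>\<beta>. (b $ \<beta> \<bullet> b $ \<beta>) / norm (r $ \<beta>)"] nonneg by simp
    have "b $ \<beta> = 0" for \<beta> using z[of \<beta>] assms[of \<beta>] by simp
    then show ?thesis by (simp add: vec_eq_iff)
  qed
  then show ?thesis
    by (simp add: invertible_left_inverse matrix_left_invertible_ker)
qed

text \<open>On vectors of the form \<open>H b\<close> the inverse form is the form of \<open>H\<close> itself; the
  inverse matrix is only ever applied to such vectors.\<close>

lemma Hmat_inverse_form: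
  assumes "\<And>\<beta>. r $ \<beta> \<noteq> 0"
  shows "(\<Sum>\<beta>\<in>UNIV. \<Sum>\<gamma>\<in>UNIV. matrix_inv (Hmat \<theta> \<Lambda> r) $ \<beta> $ \<gamma> *
      ((Hmat \<theta> \<Lambda> r *v b) $ \<beta> * (Hmat \<theta> \<Lambda> r *v b') $ \<gamma>)) =
    (\<Sum>\<beta>\<in>UNIV. \<Sum>\<gamma>\<in>UNIV. Hmat \<theta> \<Lambda> r $ \<beta> $ \<gamma> * (b $ \<beta> * b' $ \<gamma>))"
proof -
  let ?H = "Hmat \<theta> \<Lambda> r"
  have "?H ** matrix_inv ?H = mat 1 \<and> matrix_inv ?H ** ?H = mat 1"
    using Hmat_invertible[OF assms] unfolding matrix_inv_def invertible_def by (rule someI_ex)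
  then have inv: "matrix_inv ?H *v (?H *v b') = b'"
    by (simp add: matrix_vector_mul_assoc)
  have "(\<Sum>\<beta>\<in>UNIV. \<Sum>\<gamma>\<in>UNIV. A $ \<beta> $ \<gamma> * (x $ \<beta> * y $ \<gamma>)) = x \<bullet> (A *v y)" for A :: "real^'q^'q" and x y
    by (simp add: inner_vec_def matrix_vector_mult_def sum_distrib_left mult.left_commute)
  note form = this
  have "(?H *v b) \<bullet> b' = (b' v* ?H) \<bullet> b"
    by (simp only: dot_lmul_matrix inner_commute[of "?H *v b"])
  also have "b' v* ?H = transpose ?H *v b'"
    by (simp only: transpose_matrix_vector)
  also have "transpose ?H = ?H"
    by (simp add: vec_eq_iff transpose_def Hmat_sym[of \<theta> \<Lambda> r])
  finally have "(?H *v b) \<bullet> b' = b \<bullet> (?H *v b')"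
    by (simp only: inner_commute[of b])
  then show ?thesis unfolding form inv .
qed

section \<open>Isotropic subspaces of a quaternionic vector space\<close>

text \<open>Orthogonal projection to the complement of the family, followed by an isometry onto a coordinate
  subspace of the same dimension.\<close>

lemma orthonormal_family_splitting:
  fixes f :: "'s \<Rightarrow> real^'n"
  assumes S: "finite S"
    and orthonormal: "\<forall>s\<in>S. \<forall>t\<in>S. f s \<bullet> f t = (if s = t then 1 else 0)"
  shows "\<exists>(I :: 'n set) (Q :: real^'n \<Rightarrow> real^'n). card I + card S = CARD('n) \<and> linear Q \<and>
    (\<forall>X i. i \<notin> I \<longrightarrow> Q X $ i = 0) \<and>
    (\<forall>X Y. X \<bullet> Y = (\<Sum>s\<in>S. (f s \<bullet> X) * (f s \<bullet> Y)) + Q X \<bullet> Q Y) \<and>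
    (\<forall>y c. (\<forall>i. i \<notin> I \<longrightarrow> y $ i = 0) \<longrightarrow> (\<exists>X. Q X = y \<and> (\<forall>s\<in>S. f s \<bullet> X = c s)))"
proof -
  have f: "f s \<bullet> f t = (if s = t then 1 else 0)" if "s \<in> S" "t \<in> S" for s t
    using orthonormal that by blast
  define E where "E = {y \<in> UNIV. \<forall>x\<in>span (f ` S). orthogonal x y}"
  have E: "f s \<bullet> X = 0" if "X \<in> E" "s \<in> S" for X s
    using that by (auto simp: E_def orthogonal_def intro: span_base)
  have EI: "X \<in> E" if "\<And>s. s \<in> S \<Longrightarrow> f s \<bullet> X = 0" for X
  proof -
    have "orthogonal x X" if "x \<in> span (f ` S)" for x
      using that
      by (rule orthogonal_commute[THEN iffD1, OF orthogonal_to_span])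
        (auto simp: orthogonal_def inner_commute[of X] \<open>\<And>s. s \<in> S \<Longrightarrow> f s \<bullet> X = 0\<close>)
    then show ?thesis by (simp add: E_def)
  qed
  have inj: "inj_on f S"
    by (rule inj_onI) (metis f zero_neq_one)
  have "independent (f ` S)"
  proof (rule pairwise_orthogonal_independent)
    show "pairwise orthogonal (f ` S)"
      by (auto simp: pairwise_def orthogonal_def f)
    show "0 \<notin> f ` S" using f by force
  qed
  then have "dim (span (f ` S)) = card S"
    using inj by (simp add: dim_eq_card_independent card_image)
  then have dimE: "dim E + card S = CARD('n)"
    using dim_subspace_orthogonal_to_vectors[of "span (f ` S)" UNIV]
    by (simp add: E_def subspace_span)
  then obtain I :: "'n set" where I: "card I = dim E"
    by (metis le_add1 obtain_subset_with_card_n)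
  define C where "C = {x :: real^'n. \<forall>i. i \<notin> I \<longrightarrow> x $ i = 0}"
  have subE: "subspace E" unfolding subspace_def
    by (auto simp: E_def orthogonal_clauses)
  have subC: "subspace C" unfolding C_def by (auto simp: subspace_def)
  have dimC: "dim C = card I"
    unfolding C_def using dim_substandard_cart[of I, where 'a = real] by (simp add: dim_vec_eq)
  obtain u v where uv: "linear u" "linear v" "u ` E = C" "v ` C = E"
      "\<And>x. x \<in> E \<Longrightarrow> norm (u x) = norm x" "\<And>x. x \<in> C \<Longrightarrow> u (v x) = x"
    using isometries_subspaces[OF subE subC] dimC I by metis
  have iu: "u x \<bullet> u y = x \<bullet> y" if "x \<in> E" "y \<in> E" for x y
    using uv(5)[OF that(1)] uv(5)[OF that(2)] uv(5)[OF subspace_add[OF subE that]]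
    by (simp add: dot_norm linear_add[OF uv(1)])
  define P where "P X = X - (\<Sum>s\<in>S. (f s \<bullet> X) *\<^sub>R f s)" for X
  have fsum: "f t \<bullet> (\<Sum>s\<in>S. c s *\<^sub>R f s) = c t" if "t \<in> S" for c t
  proof -
    have "f t \<bullet> (\<Sum>s\<in>S. c s *\<^sub>R f s) = (\<Sum>s\<in>S. if s = t then c s else 0)"
      unfolding inner_sum_right by (rule sum.cong) (auto simp: f that)
    then show ?thesis using S that by simp
  qed
  have PE: "P X \<in> E" for X
    by (rule EI) (simp add: P_def inner_diff_right fsum)
  have linP: "linear P"
    by (rule linearI) (simp_all add: P_def inner_add_right algebra_simps sum.distrib scaleR_sum_right)
  have PP: "P X \<bullet> P Y = X \<bullet> Y - (\<Sum>s\<in>S. (f s \<bullet> X) * (f s \<bullet> Y))" for X Y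
  proof -
    have "P X \<bullet> P Y = P X \<bullet> Y - (\<Sum>s\<in>S. (f s \<bullet> Y) * (f s \<bullet> P X))"
      by (subst P_def[of Y]) (simp add: inner_diff_right inner_sum_right inner_commute)
    also have "\<dots> = P X \<bullet> Y" using E[OF PE] by simp
    also have "\<dots> = X \<bullet> Y - (\<Sum>s\<in>S. (f s \<bullet> X) * (f s \<bullet> Y))"
      by (simp add: P_def inner_diff_left inner_sum_left)
    finally show ?thesis .
  qed
  show ?thesis
  proof (intro exI[of _ I] exI[of _ "u \<circ> P"] conjI allI impI)
    show "card I + card S = CARD('n)" using dimE I by simp
    show "linear (u \<circ> P)" by (rule linear_compose[OF linP uv(1)])
    show "(u \<circ> P) X $ i = 0" if "i \<notin> I" for X i
      using PE[of X] uv(3) that by (auto simp: C_def)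
    show "X \<bullet> Y = (\<Sum>s\<in>S. (f s \<bullet> X) * (f s \<bullet> Y)) + (u \<circ> P) X \<bullet> (u \<circ> P) Y" for X Y
      by (simp add: iu[OF PE PE] PP)
    fix y :: "real^'n" and c assume "\<forall>i. i \<notin> I \<longrightarrow> y $ i = 0"
    then have y: "y \<in> C" by (simp add: C_def)
    define X where "X = v y + (\<Sum>s\<in>S. c s *\<^sub>R f s)"
    have fX: "f s \<bullet> X = c s" if "s \<in> S" for s
      using E[of "v y" s] uv(4) y that by (auto simp: X_def inner_add_right fsum)
    then have "P X = v y" by (simp add: P_def) (simp add: X_def)
    then show "\<exists>X. (u \<circ> P) X = y \<and> (\<forall>s\<in>S. f s \<bullet> X = c s)"
      using fX uv(6)[OF y] by (intro exI[of _ X]) simp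
  qed
qed

lemma mem_lie_l: "V \<in> lie_l \<Lambda> \<longleftrightarrow> (\<forall>a. a \<notin> \<Lambda> \<longrightarrow> V $ a = 0)"
proof
  assume "V \<in> lie_l \<Lambda>"
  then show "\<forall>a. a \<notin> \<Lambda> \<longrightarrow> V $ a = 0"
    unfolding lie_l_def by (induction rule: span_induct_alt) (auto simp: axis_def split: if_splits)
next
  assume V: "\<forall>a. a \<notin> \<Lambda> \<longrightarrow> V $ a = 0"
  have "V = (\<Sum>a\<in>\<Lambda>. V $ a *\<^sub>R axis a 1)"
    using V by (simp add: vec_eq_iff axis_def if_distrib cong: if_cong)
  then show "V \<in> lie_l \<Lambda>"
    unfolding lie_l_def by (metis (no_types, lifting) span_base imageI span_scale span_sum)
qed

text \<open>The vectors \<open>e\<^sub>a\<close> and \<open>J\<^sub>\<alpha> e\<^sub>a\<close> are orthonormal: for \<open>\<alpha> \<noteq> \<beta>\<close> the quaternion relations turn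
  \<open>\<langle>J\<^sub>\<alpha> e\<^sub>a, J\<^sub>\<beta> e\<^sub>b\<rangle>\<close> into \<open>\<plusminus> \<langle>J\<^sub>\<gamma> e\<^sub>a, e\<^sub>b\<rangle>\<close> with the third index \<open>\<gamma>\<close>, and this vanishes since the
  span of the \<open>e\<^sub>a\<close> is isotropic for \<open>\<omega>\<^sub>\<gamma>\<close>.  So they can be split off, and \<open>Q\<close> gives the remaining
  coordinates.\<close>

lemma hyperkaehler_splitting:
  fixes J :: "3 \<Rightarrow> real^'n \<Rightarrow> real^'n" and \<Lambda> :: "'n::finite set"
  assumes J: "quaternionic_triple J"
    and iso: "\<forall>\<alpha>. \<forall>V\<in>lie_l \<Lambda>. \<forall>V'\<in>lie_l \<Lambda>. J \<alpha> V \<bullet> V' = 0"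
  shows "\<exists>(I :: 'n set) (Q :: real^'n \<Rightarrow> real^'n). card I + 4 * card \<Lambda> = CARD('n) \<and> linear Q \<and>
    (\<forall>X i. i \<notin> I \<longrightarrow> Q X $ i = 0) \<and>
    (\<forall>X Y. X \<bullet> Y = (\<Sum>a\<in>\<Lambda>. X $ a * Y $ a) +
       (\<Sum>a\<in>\<Lambda>. \<Sum>\<alpha>\<in>UNIV. (J \<alpha> (axis a 1) \<bullet> X) * (J \<alpha> (axis a 1) \<bullet> Y)) + Q X \<bullet> Q Y) \<and>
    (\<forall>y c m. (\<forall>i. i \<notin> I \<longrightarrow> y $ i = 0) \<longrightarrow>
       (\<exists>X. Q X = y \<and> (\<forall>a\<in>\<Lambda>. X $ a = c a \<and> (\<forall>\<alpha>. J \<alpha> (axis a 1) \<bullet> X = m a \<alpha>))))"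
proof -
  have isotropic: "J \<alpha> V \<bullet> V' = 0" if "V \<in> lie_l \<Lambda>" "V' \<in> lie_l \<Lambda>" for \<alpha> V V'
    using iso that by blast
  have orth: "J \<alpha> X \<bullet> J \<alpha> Y = X \<bullet> Y" and sq: "J \<alpha> (J \<alpha> X) = - X" for \<alpha> X Y
    using J by (auto simp: quaternionic_triple_def orthogonal_transformation_def)
  have lin: "linear (J \<alpha>)" for \<alpha>
    using J by (auto simp: quaternionic_triple_def orthogonal_transformation_def)
  have rel: "J 1 (J 2 X) = J 3 X" "J 2 (J 1 X) = - J 3 X" for X
    using J by (auto simp: quaternionic_triple_def)
  have skew: "J \<alpha> X \<bullet> Y = - (X \<bullet> J \<alpha> Y)" for \<alpha> X Y
    using orth[of \<alpha> X "J \<alpha> Y"] by (simp add: sq)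
  have mixed: "J \<alpha> X \<bullet> J \<beta> Y = 0" if "\<alpha> \<noteq> \<beta>" "X \<in> lie_l \<Lambda>" "Y \<in> lie_l \<Lambda>" for \<alpha> \<beta> X Y
  proof -
    have "J 1 X \<bullet> J 2 Y = 0" if "X \<in> lie_l \<Lambda>" "Y \<in> lie_l \<Lambda>" for X Y
      using isotropic[OF that, of 3] by (simp add: skew rel)
    moreover have "J 1 X \<bullet> J 3 Y = 0" if "X \<in> lie_l \<Lambda>" "Y \<in> lie_l \<Lambda>" for X Y
      using isotropic[OF that, of 2] by (simp add: skew rel(1)[symmetric] sq)
    moreover have "J 2 X \<bullet> J 3 Y = 0" if "X \<in> lie_l \<Lambda>" "Y \<in> lie_l \<Lambda>" for X Y
    proof -
      have "J 3 Y = - J 2 (J 1 Y)" by (simp add: rel)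
      then show ?thesis using isotropic[OF that, of 1] orth[of 2 X "J 1 Y"] by (simp add: skew)
    qed
    ultimately show ?thesis
      using exhaust_3[of \<alpha>] exhaust_3[of \<beta>] that by (metis inner_commute)
  qed
  \<comment> \<open>The index \<open>None\<close> stands for \<open>e\<^sub>a\<close>, the index \<open>Some \<alpha>\<close> for \<open>J\<^sub>\<alpha> e\<^sub>a\<close>.\<close>
  define f :: "'n \<times> 3 option \<Rightarrow> real^'n" where
    "f s = (case snd s of None \<Rightarrow> axis (fst s) 1 | Some \<alpha> \<Rightarrow> J \<alpha> (axis (fst s) 1))" for s
  define S where "S = Sigma \<Lambda> (\<lambda>_. UNIV :: 3 option set)"
  have l: "axis a 1 \<in> lie_l \<Lambda>" if "a \<in> \<Lambda>" for a
    using that by (auto simp: mem_lie_l axis_def)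
  have ax: "axis a 1 \<bullet> (axis b 1 :: real^'n) = (if a = b then 1 else 0)" for a b
    by (simp add: inner_axis) (simp add: axis_def)
  have jj: "J \<alpha> (axis a 1) \<bullet> J \<beta> (axis b 1) = (if \<alpha> = \<beta> \<and> a = b then 1 else 0)"
    if "a \<in> \<Lambda>" "b \<in> \<Lambda>" for \<alpha> \<beta> a b
    using mixed[OF _ l[OF that(1)] l[OF that(2)], of \<alpha> \<beta>] by (cases "\<alpha> = \<beta>") (auto simp: orth ax)
  have ortho: "f s \<bullet> f t = (if s = t then 1 else 0)" if "s \<in> S" "t \<in> S" for s t
  proof -
    note mem = \<open>s \<in> S\<close> \<open>t \<in> S\<close>
    obtain a x b y where st: "s = (a, x)" "t = (b, y)" "a \<in> \<Lambda>" "b \<in> \<Lambda>"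
      using mem by (cases s; cases t) (auto simp: S_def)
    have "J \<alpha> (axis a 1) \<bullet> axis b 1 = 0" "axis a 1 \<bullet> J \<alpha> (axis b 1) = 0" for \<alpha>
      using isotropic[OF l[OF st(3)] l[OF st(4)]] isotropic[OF l[OF st(4)] l[OF st(3)]]
      by (simp_all add: inner_commute)
    then show ?thesis
      by (cases x; cases y) (simp_all add: f_def st ax jj)
  qed
  have fin: "finite S" by (simp add: S_def)
  have "\<forall>s\<in>S. \<forall>t\<in>S. f s \<bullet> f t = (if s = t then 1 else 0)"
    using ortho by (intro ballI)
  note orthonormal_family_splitting[OF fin this]
  then
  obtain I :: "'n set" and Q :: "real^'n \<Rightarrow> real^'n" where IQ: "card I + card S = CARD('n)" "linear Q"
    "\<forall>X i. i \<notin> I \<longrightarrow> Q X $ i = 0"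
    and inner: "\<forall>X Y. X \<bullet> Y = (\<Sum>s\<in>S. (f s \<bullet> X) * (f s \<bullet> Y)) + Q X \<bullet> Q Y"
    and onto: "\<forall>y c. (\<forall>i. i \<notin> I \<longrightarrow> y $ i = 0) \<longrightarrow> (\<exists>X. Q X = y \<and> (\<forall>s\<in>S. f s \<bullet> X = c s))"
    by (elim exE conjE) (rule that, assumption+)
  show ?thesis
  proof (intro exI[of _ I] exI[of _ Q] conjI IQ(2,3) allI impI)
    have "card S = card \<Lambda> * 4" by (simp add: S_def card_cartesian_product card_UNIV_option)
    then show "card I + 4 * card \<Lambda> = CARD('n)" using IQ(1) by simp
    have split: "(\<Sum>s\<in>S. F s) = (\<Sum>a\<in>\<Lambda>. F (a, None)) + (\<Sum>a\<in>\<Lambda>. \<Sum>\<alpha>\<in>UNIV. F (a, Some \<alpha>))"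
      for F :: "_ \<Rightarrow> real"
    proof -
      have "sum F S = (\<Sum>a\<in>\<Lambda>. \<Sum>x\<in>UNIV. F (a, x))"
        using sum.Sigma[of \<Lambda> "\<lambda>_. UNIV" "\<lambda>a x. F (a, x)"] by (simp add: S_def)
      then show ?thesis by (simp add: UNIV_option_conv sum.reindex sum.distrib)
    qed
    show "X \<bullet> Y = (\<Sum>a\<in>\<Lambda>. X $ a * Y $ a) +
       (\<Sum>a\<in>\<Lambda>. \<Sum>\<alpha>\<in>UNIV. (J \<alpha> (axis a 1) \<bullet> X) * (J \<alpha> (axis a 1) \<bullet> Y)) + Q X \<bullet> Q Y" for X Y
      unfolding inner[rule_format, of X Y] split by (simp add: f_def inner_axis')
    fix y :: "real^'n" and c m assume "\<forall>i. i \<notin> I \<longrightarrow> y $ i = 0"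
    then have "\<exists>X. Q X = y \<and> (\<forall>s\<in>S. f s \<bullet> X = (case snd s of None \<Rightarrow> c (fst s) | Some \<alpha> \<Rightarrow> m (fst s) \<alpha>))"
      by (rule onto[THEN spec, THEN spec, THEN mp])
    then obtain X where "Q X = y"
      and X: "\<And>s. s \<in> S \<Longrightarrow> f s \<bullet> X = (case snd s of None \<Rightarrow> c (fst s) | Some \<alpha> \<Rightarrow> m (fst s) \<alpha>)"
      by (elim exE conjE) (rule that, assumption, blast)
    moreover have "X $ a = c a" "J \<alpha> (axis a 1) \<bullet> X = m a \<alpha>" if "a \<in> \<Lambda>" for a \<alpha>
      using X[of "(a, None)"] X[of "(a, Some \<alpha>)"] that by (auto simp: S_def f_def inner_axis')
    ultimately show "\<exists>X. Q X = y \<and> (\<forall>a\<in>\<Lambda>. X $ a = c a \<and> (\<forall>\<alpha>. J \<alpha> (axis a 1) \<bullet> X = m a \<alpha>))"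
      by (intro exI[of _ X]) simp
  qed
qed

section \<open>The zero level of the moment map\<close>

lemma has_derivative_vec_lambda:
  fixes f :: "'a::real_normed_vector \<Rightarrow> 'i::finite \<Rightarrow> 'b::real_normed_vector"
  assumes "\<And>i. ((\<lambda>x. f x i) has_derivative (\<lambda>v. f' v i)) F"
  shows "((\<lambda>x. \<chi> i. f x i) has_derivative (\<lambda>v. \<chi> i. f' v i)) F"
  unfolding vec_lambda_eq_sum_axis
  by (intro has_derivative_sum bounded_linear.has_derivative[OF bounded_linear_axis] assms)

lemma has_vector_derivative_vec_lambda:
  fixes f :: "real \<Rightarrow> 'i::finite \<Rightarrow> 'b::real_normed_vector"
  assumes "\<And>i. ((\<lambda>x. f x i) has_vector_derivative f' i) F"
  shows "((\<lambda>x. \<chi> i. f x i) has_vector_derivative (\<chi> i. f' i)) F"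
proof -
  have "((\<lambda>x. \<chi> i. f x i) has_derivative (\<lambda>v. \<chi> i. v *\<^sub>R f' i)) F"
    by (rule has_derivative_vec_lambda) (use assms in \<open>simp add: has_vector_derivative_def\<close>)
  moreover have "(\<lambda>v. \<chi> i. v *\<^sub>R f' i) = (\<lambda>v. v *\<^sub>R (\<chi> i. f' i))"
    by (simp add: vec_eq_iff fun_eq_iff)
  ultimately show ?thesis unfolding has_vector_derivative_def by simp
qed

lemma inner_quat_vec: "(V :: quat^'q::finite) \<bullet> W = (\<Sum>\<beta>\<in>UNIV. V $ \<beta> \<bullet> W $ \<beta>)"
  by (simp add: inner_vec_def)

text \<open>The component \<open>\<mu>\<^sub>\<alpha>(e\<^sub>a)\<close> of the moment map, in terms of \<open>r\<close>; below it is its differential.\<close>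

definition hk_constraint ::
  "(3 \<Rightarrow> real^'n \<Rightarrow> real^'n) \<Rightarrow> real^'n^'q \<Rightarrow> 'n \<Rightarrow> 3 \<Rightarrow> ('n::finite, 'q::finite) group_space \<Rightarrow> real" where
  "hk_constraint J \<theta> a \<alpha> P = J \<alpha> (axis a 1) \<bullet> fst P +
     1/2 * (\<Sum>\<beta>\<in>UNIV. \<theta> $ \<beta> $ a * hopf (snd P $ \<beta>) (snd P $ \<beta>) $ \<alpha>)"

definition hk_constraint_deriv ::
  "(3 \<Rightarrow> real^'n \<Rightarrow> real^'n) \<Rightarrow> real^'n^'q \<Rightarrow> 'n \<Rightarrow> 3 \<Rightarrow>
    ('n::finite, 'q::finite) group_space \<Rightarrow> ('n, 'q) group_space \<Rightarrow> real" where
  "hk_constraint_deriv J \<theta> a \<alpha> P u = J \<alpha> (axis a 1) \<bullet> fst u +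
     (\<Sum>\<beta>\<in>UNIV. \<theta> $ \<beta> $ a * hopf (snd P $ \<beta>) (snd u $ \<beta>) $ \<alpha>)"

lemma rvec_hopf: "rvec P = (\<chi> \<beta>. hopf (snd P $ \<beta>) (snd P $ \<beta>))"
  by (simp add: rvec_def hopf_def)

lemma has_derivative_rvec: "(rvec has_derivative (\<lambda>u. \<chi> \<beta>. 2 *\<^sub>R hopf (snd P $ \<beta>) (snd u $ \<beta>))) (at P)"
  unfolding rvec_hopf[abs_def]
proof (rule has_derivative_vec_lambda)
  fix \<beta>
  have "((\<lambda>P. snd P $ \<beta>) has_derivative (\<lambda>u. snd u $ \<beta>)) (at P)"
    by (rule bounded_linear_imp_has_derivative[OF bounded_linear_compose[OF bounded_linear_vec_nth bounded_linear_snd]])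
  from has_derivative_compose[OF this has_derivative_hopf]
  show "((\<lambda>P. hopf (snd P $ \<beta>) (snd P $ \<beta>)) has_derivative (\<lambda>u. 2 *\<^sub>R hopf (snd P $ \<beta>) (snd u $ \<beta>))) (at P)" .
qed

lemma has_derivative_hk_constraint:
  fixes P :: "('n::finite, 'q::finite) group_space"
  shows "(hk_constraint J \<theta> a \<alpha> has_derivative hk_constraint_deriv J \<theta> a \<alpha> P) (at P)"
proof -
  have r: "((\<lambda>P. rvec P $ \<beta> $ \<alpha>) has_derivative (\<lambda>u. 2 * hopf (snd P $ \<beta>) (snd u $ \<beta>) $ \<alpha>)) (at P)" for \<beta>
  proof -
    have "bounded_linear (\<lambda>r :: (real^3)^'q. r $ \<beta> $ \<alpha>)"
      by (rule bounded_linear_compose[OF bounded_linear_vec_nth bounded_linear_vec_nth])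
    from bounded_linear.has_derivative[OF this has_derivative_rvec] show ?thesis by simp
  qed
  have "((\<lambda>P. J \<alpha> (axis a 1) \<bullet> fst P + 1/2 * (\<Sum>\<beta>\<in>UNIV. \<theta> $ \<beta> $ a * rvec P $ \<beta> $ \<alpha>)) has_derivative
      (\<lambda>u. J \<alpha> (axis a 1) \<bullet> fst u + 1/2 * (\<Sum>\<beta>\<in>UNIV. \<theta> $ \<beta> $ a * (2 * hopf (snd P $ \<beta>) (snd u $ \<beta>) $ \<alpha>)))) (at P)"
    by (rule has_derivative_add[OF bounded_linear_imp_has_derivative[OF
            bounded_linear_compose[OF bounded_linear_inner_right bounded_linear_fst]]
          has_derivative_mult_right[OF has_derivative_sum[OF has_derivative_mult_right[OF r]]]])
  moreover have "(\<lambda>P. J \<alpha> (axis a 1) \<bullet> fst P + 1/2 * (\<Sum>\<beta>\<in>UNIV. \<theta> $ \<beta> $ a * rvec P $ \<beta> $ \<alpha>)) = hk_constraint J \<theta> a \<alpha>"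
    by (simp add: fun_eq_iff hk_constraint_def rvec_hopf)
  moreover have "(\<lambda>u. J \<alpha> (axis a 1) \<bullet> fst u + 1/2 * (\<Sum>\<beta>\<in>UNIV. \<theta> $ \<beta> $ a * (2 * hopf (snd P $ \<beta>) (snd u $ \<beta>) $ \<alpha>)))
      = hk_constraint_deriv J \<theta> a \<alpha> P"
    by (simp add: fun_eq_iff hk_constraint_deriv_def sum_distrib_left)
  ultimately show ?thesis by simp
qed

lemma moment_map_hopf:
  fixes P :: "('n::finite, 'q::finite) group_space"
  shows "moment_map J \<theta> P V $ \<alpha> = J \<alpha> V \<bullet> fst P +
     1/2 * (\<Sum>\<beta>\<in>UNIV. (V \<bullet> \<theta> $ \<beta>) * hopf (snd P $ \<beta>) (snd P $ \<beta>) $ \<alpha>)"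
proof -
  obtain X W where P: "P = (X, W)" by (cases P)
  have "kahler_form J \<alpha> ((V, 0) :: ('n, 'q) group_space) (X, 0) = J \<alpha> V \<bullet> X"
    by (simp add: kahler_form_def)
  moreover have "((c *\<^sub>R (qunit 1 \<odot> w)) \<odot> (- qunit \<alpha>)) \<bullet> w = c * hopf w w $ \<alpha>" for c w
    by (simp add: bounded_bilinear.scaleR_left[OF bounded_bilinear_qmul] moment_hopf)
  then have "kahler_form J \<alpha> ((0, rho \<theta> V W) :: ('n, 'q) group_space) (0, W) =
      (\<Sum>\<beta>\<in>UNIV. (V \<bullet> \<theta> $ \<beta>) * hopf (W $ \<beta>) (W $ \<beta>) $ \<alpha>)"
    by (simp add: kahler_form_def inner_quat_vec rho_def)
  ultimately show ?thesis by (simp add: P)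
qed

lemma zero_level_iff:
  fixes J :: "3 \<Rightarrow> real^'n \<Rightarrow> real^'n::finite"
  assumes J: "\<And>\<alpha>. linear (J \<alpha>)"
  shows "P \<in> zero_level J \<theta> \<Lambda> \<longleftrightarrow> (\<forall>a\<in>\<Lambda>. \<forall>\<alpha>. hk_constraint J \<theta> a \<alpha> P = 0)"
proof
  assume P: "P \<in> zero_level J \<theta> \<Lambda>"
  show "\<forall>a\<in>\<Lambda>. \<forall>\<alpha>. hk_constraint J \<theta> a \<alpha> P = 0"
  proof (intro ballI allI)
    fix a \<alpha> assume "a \<in> \<Lambda>"
    then have "axis a 1 \<in> lie_l \<Lambda>" by (auto simp: mem_lie_l axis_def)
    then have "moment_map J \<theta> P (axis a 1) $ \<alpha> = 0"
      using P unfolding zero_level_def by simp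
    then show "hk_constraint J \<theta> a \<alpha> P = 0"
      by (simp add: moment_map_hopf hk_constraint_def inner_axis')
  qed
next
  assume C: "\<forall>a\<in>\<Lambda>. \<forall>\<alpha>. hk_constraint J \<theta> a \<alpha> P = 0"
  have "moment_map J \<theta> P V $ \<alpha> = 0" if V: "V \<in> lie_l \<Lambda>" for V \<alpha>
  proof -
    have V_eq: "V = (\<Sum>a\<in>\<Lambda>. V $ a *\<^sub>R axis a 1)"
      using V by (simp add: mem_lie_l vec_eq_iff axis_def if_distrib cong: if_cong)
    have JV: "J \<alpha> V = (\<Sum>a\<in>\<Lambda>. V $ a *\<^sub>R J \<alpha> (axis a 1))"
      by (subst V_eq) (simp add: linear_sum[OF J] linear_scale[OF J])
    have V\<theta>: "V \<bullet> \<theta> $ \<beta> = (\<Sum>a\<in>\<Lambda>. V $ a * \<theta> $ \<beta> $ a)" for \<beta>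
      by (subst V_eq) (simp add: inner_sum_left inner_axis')
    have "(\<Sum>\<beta>\<in>UNIV. (V \<bullet> \<theta> $ \<beta>) * hopf (snd P $ \<beta>) (snd P $ \<beta>) $ \<alpha>) =
        (\<Sum>a\<in>\<Lambda>. V $ a * (\<Sum>\<beta>\<in>UNIV. \<theta> $ \<beta> $ a * hopf (snd P $ \<beta>) (snd P $ \<beta>) $ \<alpha>))"
      unfolding V\<theta> sum_distrib_left sum_distrib_right
      by (subst sum.swap) (simp add: mult.assoc)
    then have "moment_map J \<theta> P V $ \<alpha> = (\<Sum>a\<in>\<Lambda>. V $ a * hk_constraint J \<theta> a \<alpha> P)"
      by (simp add: moment_map_hopf JV hk_constraint_def inner_sum_left distrib_left sum.distrib sum_distrib_left)
    then show ?thesis using C by simp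
  qed
  then show "P \<in> zero_level J \<theta> \<Lambda>"
    by (simp add: zero_level_def vec_eq_iff)
qed

section \<open>Orbits, tangent vectors and horizontal vectors\<close>

text \<open>The component of \<open>X\<close> in the Lie algebra \<open>\<l>\<close>.\<close>

definition lproj :: "'n set \<Rightarrow> real^'n \<Rightarrow> real^'n::finite" where
  "lproj \<Lambda> X = (\<chi> a. if a \<in> \<Lambda> then X $ a else 0)"

text \<open>The quaternionic coordinates of the unique point on the orbit of \<open>P\<close> whose component in \<open>\<l>\<close> is
  \<open>0\<close>.\<close>

definition gauged :: "real^'n^'q \<Rightarrow> 'n set \<Rightarrow> ('n::finite, 'q::finite) group_space \<Rightarrow> quat^'q" where
  "gauged \<theta> \<Lambda> P = theta_act \<theta> (- lproj \<Lambda> (fst P)) (snd P)"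

lemma gauged_nth: "gauged \<theta> \<Lambda> P $ \<beta> = qexp_i (- (lproj \<Lambda> (fst P) \<bullet> \<theta> $ \<beta>)) \<odot> snd P $ \<beta>"
  by (simp add: gauged_def theta_act_def)

lemma linear_lproj: "linear (lproj \<Lambda>)"
  by (rule linearI) (simp_all add: lproj_def vec_eq_iff)

lemma lproj_lie_l: "V \<in> lie_l \<Lambda> \<Longrightarrow> lproj \<Lambda> V = V"
  by (auto simp: mem_lie_l lproj_def vec_eq_iff)

lemma lie_l_add: "V \<in> lie_l \<Lambda> \<Longrightarrow> V' \<in> lie_l \<Lambda> \<Longrightarrow> V + V' \<in> lie_l \<Lambda>"
  and lie_l_minus: "V \<in> lie_l \<Lambda> \<Longrightarrow> - V \<in> lie_l \<Lambda>"
  and lie_l_zero: "0 \<in> lie_l \<Lambda>"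
  by (auto simp: mem_lie_l)

lemma theta_act_add: "theta_act \<theta> S (theta_act \<theta> T W) = theta_act \<theta> (S + T) W"
  by (simp add: theta_act_def vec_eq_iff qexp_i_add inner_add_left)

lemma theta_act_zero: "theta_act \<theta> 0 W = W"
  by (simp add: theta_act_def vec_eq_iff qexp_i_zero)

lemma orbit_iff: "P' \<in> orbit \<theta> \<Lambda> P \<longleftrightarrow> (\<exists>V\<in>lie_l \<Lambda>. P' = (V + fst P, theta_act \<theta> V (snd P)))"
proof -
  obtain X W where "P = (X, W)" by (cases P)
  then show ?thesis unfolding orbit_def subgroup_L_def image_image by auto
qed

lemma orbit_self: "P \<in> orbit \<theta> \<Lambda> P"
  unfolding orbit_iff by (rule bexI[OF _ lie_l_zero]) (simp add: theta_act_zero)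

lemma orbit_eq: "P' \<in> orbit \<theta> \<Lambda> P \<Longrightarrow> orbit \<theta> \<Lambda> P' = orbit \<theta> \<Lambda> P"
proof -
  have sub: "orbit \<theta> \<Lambda> P' \<subseteq> orbit \<theta> \<Lambda> P" if mem: "P' \<in> orbit \<theta> \<Lambda> P" for P P'
  proof
    obtain V where V: "V \<in> lie_l \<Lambda>" "P' = (V + fst P, theta_act \<theta> V (snd P))"
      using mem unfolding orbit_iff by blast
    fix P'' assume "P'' \<in> orbit \<theta> \<Lambda> P'"
    then obtain V' where V': "V' \<in> lie_l \<Lambda>" "P'' = (V' + fst P', theta_act \<theta> V' (snd P'))"
      unfolding orbit_iff by blast
    have "P'' = ((V' + V) + fst P, theta_act \<theta> (V' + V) (snd P))"
      unfolding V'(2) V(2) by (simp add: theta_act_add add.assoc)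
    then show "P'' \<in> orbit \<theta> \<Lambda> P" unfolding orbit_iff using lie_l_add[OF V'(1) V(1)] by blast
  qed
  assume P': "P' \<in> orbit \<theta> \<Lambda> P"
  then obtain V where V: "V \<in> lie_l \<Lambda>" "P' = (V + fst P, theta_act \<theta> V (snd P))"
    unfolding orbit_iff by blast
  have "P = (- V + fst P', theta_act \<theta> (- V) (snd P'))"
    unfolding V(2) by (simp add: theta_act_add theta_act_zero)
  then have "P \<in> orbit \<theta> \<Lambda> P'" unfolding orbit_iff using lie_l_minus[OF V(1)] by blast
  with P' sub show ?thesis by blast
qed

lemma gauged_orbit: "P' \<in> orbit \<theta> \<Lambda> P \<Longrightarrow> gauged \<theta> \<Lambda> P' = gauged \<theta> \<Lambda> P"
  unfolding orbit_iff
  by (auto simp: gauged_def theta_act_add linear_add[OF linear_lproj] lproj_lie_l)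

lemma rvec_theta_act: "rvec (X, theta_act \<theta> V W) = rvec (X', W)"
  by (simp add: rvec_hopf theta_act_def qexp_i_hopf)

lemma hopf_gauged: "hopf (gauged \<theta> \<Lambda> P $ \<beta>) (gauged \<theta> \<Lambda> P $ \<beta>) = rvec P $ \<beta>"
  by (simp add: gauged_nth qexp_i_hopf rvec_hopf)

lemma hk_constraint_rvec:
  "hk_constraint J \<theta> a \<alpha> P = J \<alpha> (axis a 1) \<bullet> fst P + 1/2 * (\<Sum>\<beta>\<in>UNIV. \<theta> $ \<beta> $ a * rvec P $ \<beta> $ \<alpha>)"
  by (simp add: hk_constraint_def rvec_hopf)

text \<open>A derivative within \<open>M\<close> need not be unique when \<open>M\<close> is a proper submanifold.  On the velocity of a curve
  in \<open>M\<close> it is, since there it is the derivative of the function along that curve.\<close>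

lemma frechet_derivative_within_tangent:
  assumes F: "(F has_derivative F') (at P)" and v: "v \<in> tangent_space M P"
  shows "frechet_derivative F (at P within M) v = F' v"
proof -
  define D where "D = frechet_derivative F (at P within M)"
  have "F differentiable (at P within M)"
    using F by (auto simp: differentiable_def intro: has_derivative_at_withinI)
  then have D: "(F has_derivative D) (at P within M)"
    unfolding D_def by (simp add: frechet_derivative_works)
  obtain c where c: "c 0 = P" "\<forall>\<^sub>F t in nhds 0. c t \<in> M" "(c has_vector_derivative v) (at (0::real))"
    using v by (auto simp: tangent_space_def)
  obtain T where T: "open T" "0 \<in> T" "\<And>t. t \<in> T \<Longrightarrow> c t \<in> M"
    using c(2) by (auto simp: eventually_nhds)
  have dc: "(c has_derivative (\<lambda>t. t *\<^sub>R v)) (at 0 within T)"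
    using c(3) by (simp add: has_vector_derivative_def has_derivative_at_withinI)
  have "(F has_derivative D) (at (c 0) within c ` T)"
  proof (rule has_derivative_subset)
    show "(F has_derivative D) (at (c 0) within M)" unfolding c(1) by (rule D)
    show "c ` T \<subseteq> M" using T(3) by (rule image_subsetI)
  qed
  from has_derivative_in_compose[OF dc this]
  have "((\<lambda>t. F (c t)) has_derivative (\<lambda>t. D (t *\<^sub>R v))) (at 0)"
    unfolding at_within_open[OF T(2,1)] .
  moreover have "((\<lambda>t. F (c t)) has_derivative (\<lambda>t. F' (t *\<^sub>R v))) (at 0)"
  proof (rule has_derivative_compose[where f = c and g = F and f' = "\<lambda>t. t *\<^sub>R v" and g' = F'])
    show "(c has_derivative (\<lambda>t. t *\<^sub>R v)) (at 0)"
      using c(3) unfolding has_vector_derivative_def .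
    show "(F has_derivative F') (at (c 0))" unfolding c(1) by (rule F)
  qed
  ultimately have "(\<lambda>t. D (t *\<^sub>R v)) = (\<lambda>t. F' (t *\<^sub>R v))"
    by (rule has_derivative_unique)
  from fun_cong[OF this, of 1] show ?thesis by (simp add: D_def)
qed

text \<open>Linearity of \<open>J\<close> and the conclusion of \<open>hyperkaehler_splitting\<close> are all that has to be known about the hyper-Kaehler structure
  of \<open>\<real>\<^sup>4\<^sup>p\<close> and the isotropic subspace.\<close>

locale hk_quotient =
  fixes J :: "3 \<Rightarrow> real^'n::finite \<Rightarrow> real^'n" and \<theta> :: "real^'n^'q::finite"
    and \<Lambda> I :: "'n set" and Q :: "real^'n \<Rightarrow> real^'n"
  assumes linear_J: "linear (J \<alpha>)"
    and linear_Q: "linear Q"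
    and Q_supp: "\<And>X i. i \<notin> I \<Longrightarrow> Q X $ i = 0"
    and inner_split: "\<And>X Y. X \<bullet> Y = (\<Sum>a\<in>\<Lambda>. X $ a * Y $ a) +
       (\<Sum>a\<in>\<Lambda>. \<Sum>\<alpha>\<in>UNIV. (J \<alpha> (axis a 1) \<bullet> X) * (J \<alpha> (axis a 1) \<bullet> Y)) + Q X \<bullet> Q Y"
    and Q_onto: "\<And>y c m. \<forall>i. i \<notin> I \<longrightarrow> y $ i = 0 \<Longrightarrow>
       \<exists>X. Q X = y \<and> (\<forall>a\<in>\<Lambda>. X $ a = c a \<and> (\<forall>\<alpha>. J \<alpha> (axis a 1) \<bullet> X = m a \<alpha>))"
begin

abbreviation "M \<equiv> zero_level J \<theta> \<Lambda>"

abbreviation "\<pi> \<equiv> orbit \<theta> \<Lambda>"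

lemma M_iff: "P \<in> M \<longleftrightarrow> (\<forall>a\<in>\<Lambda>. \<forall>\<alpha>. hk_constraint J \<theta> a \<alpha> P = 0)"
  by (rule zero_level_iff[OF linear_J])

lemma split_ext:
  assumes "Q X = Q Y" "\<And>a. a \<in> \<Lambda> \<Longrightarrow> X $ a = Y $ a"
    and "\<And>a \<alpha>. a \<in> \<Lambda> \<Longrightarrow> J \<alpha> (axis a 1) \<bullet> X = J \<alpha> (axis a 1) \<bullet> Y"
  shows "X = Y"
proof -
  have "Q (X - Y) = 0" using assms(1) by (simp add: linear_diff[OF linear_Q])
  then have "(X - Y) \<bullet> (X - Y) = 0"
    using inner_split[of "X - Y" "X - Y"] assms(2,3) by (simp add: inner_diff_right)
  then show ?thesis by simp
qed

lemma lie_l_split: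
  assumes V: "V \<in> lie_l \<Lambda>"
  shows "Q V = 0" "a \<in> \<Lambda> \<Longrightarrow> J \<alpha> (axis a 1) \<bullet> V = 0"
proof -
  have "\<forall>i. i \<notin> I \<longrightarrow> (0 :: real^'n) $ i = 0" by simp
  from Q_onto[OF this, of "\<lambda>a. V $ a" "\<lambda>_ _. 0"] obtain X where
    X: "Q X = 0" "\<forall>a\<in>\<Lambda>. X $ a = V $ a \<and> (\<forall>\<alpha>. J \<alpha> (axis a 1) \<bullet> X = 0)" by blast
  have "V \<bullet> V = (\<Sum>a\<in>\<Lambda>. V $ a * V $ a)"
    unfolding inner_vec_def by (rule sum.mono_neutral_cong_right) (use V in \<open>auto simp: mem_lie_l\<close>)
  moreover have "X \<bullet> X = (\<Sum>a\<in>\<Lambda>. V $ a * V $ a)" "X \<bullet> V = (\<Sum>a\<in>\<Lambda>. V $ a * V $ a)"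
    using X by (simp_all add: inner_split[of X])
  ultimately have "(V - X) \<bullet> (V - X) = 0"
    by (simp add: inner_diff_left inner_diff_right inner_commute)
  then have "V = X" by simp
  then show "Q V = 0" "a \<in> \<Lambda> \<Longrightarrow> J \<alpha> (axis a 1) \<bullet> V = 0" using X by auto
qed

lemma orbit_subset_M: "P \<in> M \<Longrightarrow> P' \<in> \<pi> P \<Longrightarrow> P' \<in> M"
proof -
  assume P: "P \<in> M" and "P' \<in> \<pi> P"
  then obtain V where V: "V \<in> lie_l \<Lambda>" "P' = (V + fst P, theta_act \<theta> V (snd P))"
    unfolding orbit_iff by blast
  have "rvec P' = rvec P" using rvec_theta_act[of _ \<theta> V "snd P" "fst P"] by (simp add: V(2))
  moreover have "J \<alpha> (axis a 1) \<bullet> fst P' = J \<alpha> (axis a 1) \<bullet> fst P" if "a \<in> \<Lambda>" for a \<alpha>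
    using lie_l_split(2)[OF V(1) that] by (simp add: V(2) inner_add_right)
  ultimately show ?thesis using P by (simp add: M_iff hk_constraint_rvec)
qed

text \<open>On the level set the components of \<open>X\<close> along the \<open>J\<^sub>\<alpha> e\<^sub>a\<close> are functions of \<open>r\<close>, hence of the gauged
  coordinates.  So the two points can only differ by the translation by the difference of their
  components in \<open>\<l>\<close>.\<close>

lemma orbit_eqI:
  assumes M: "P \<in> M" "P' \<in> M" and eq: "Q (fst P) = Q (fst P')" "gauged \<theta> \<Lambda> P = gauged \<theta> \<Lambda> P'"
  shows "\<pi> P = \<pi> P'"
proof -
  define V where "V = lproj \<Lambda> (fst P') - lproj \<Lambda> (fst P)"
  have V: "V \<in> lie_l \<Lambda>" by (simp add: V_def mem_lie_l lproj_def)
  have r: "rvec P = rvec P'"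
    using eq(2) hopf_gauged[of \<theta> \<Lambda> P] hopf_gauged[of \<theta> \<Lambda> P'] by (simp add: vec_eq_iff)
  have "V + fst P = fst P'"
  proof (rule split_ext)
    show "Q (V + fst P) = Q (fst P')"
      by (simp add: linear_add[OF linear_Q] lie_l_split(1)[OF V] eq(1))
    fix a assume a: "a \<in> \<Lambda>"
    show "(V + fst P) $ a = fst P' $ a" using a by (simp add: V_def lproj_def)
    show "J \<alpha> (axis a 1) \<bullet> (V + fst P) = J \<alpha> (axis a 1) \<bullet> fst P'" for \<alpha>
    proof -
      have "hk_constraint J \<theta> a \<alpha> P = hk_constraint J \<theta> a \<alpha> P'"
        using M a unfolding M_iff by simp
      then show ?thesis
        using lie_l_split(2)[OF V a, of \<alpha>] by (simp add: hk_constraint_rvec r inner_add_right)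
    qed
  qed
  moreover have "theta_act \<theta> V (snd P) = snd P'"
  proof -
    have "theta_act \<theta> V (snd P) = theta_act \<theta> (lproj \<Lambda> (fst P')) (gauged \<theta> \<Lambda> P)"
      by (simp add: gauged_def theta_act_add V_def)
    also have "\<dots> = snd P'" unfolding eq(2) by (simp add: gauged_def theta_act_add theta_act_zero)
    finally show ?thesis .
  qed
  ultimately have "P' = (V + fst P, theta_act \<theta> V (snd P))" by simp
  then have "P' \<in> \<pi> P" unfolding orbit_iff using V by blast
  then show ?thesis using orbit_eq by blast
qed

lemma tangent_space_M_imp:
  assumes "u \<in> tangent_space M P" "a \<in> \<Lambda>"
  shows "hk_constraint_deriv J \<theta> a \<alpha> P u = 0"
proof -
  let ?C = "hk_constraint J \<theta> a \<alpha>" and ?D = "hk_constraint_deriv J \<theta> a \<alpha> P"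
  obtain c where c: "c 0 = P" "\<forall>\<^sub>F t in nhds 0. c t \<in> M" "(c has_vector_derivative u) (at (0::real))"
    using assms(1) unfolding tangent_space_def by blast
  obtain T where T: "open T" "0 \<in> T" "\<And>t. t \<in> T \<Longrightarrow> c t \<in> M"
    using c(2) unfolding eventually_nhds by blast
  have "((\<lambda>t. ?C (c t)) has_derivative (\<lambda>t. ?D (t *\<^sub>R u))) (at 0)"
  proof (rule has_derivative_compose[where f = c and g = ?C and f' = "\<lambda>t. t *\<^sub>R u" and g' = ?D])
    show "(c has_derivative (\<lambda>t. t *\<^sub>R u)) (at 0)"
      using c(3) unfolding has_vector_derivative_def .
    show "(?C has_derivative ?D) (at (c 0))" unfolding c(1) by (rule has_derivative_hk_constraint)
  qed
  then have "((\<lambda>t. 0) has_derivative (\<lambda>t. ?D (t *\<^sub>R u))) (at 0)"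
  proof (rule has_derivative_transform_within_open[OF _ T(1,2)])
    show "?C (c t) = 0" if "t \<in> T" for t using T(3)[OF that] assms(2) by (simp add: M_iff)
  qed
  from has_derivative_unique[OF this has_derivative_const]
  have "(\<lambda>t. ?D (t *\<^sub>R u)) = (\<lambda>t. 0)" .
  from fun_cong[OF this, of 1] show ?thesis by simp
qed

text \<open>The constraints are quadratic in \<open>W\<close> and linear in \<open>X\<close>.  Along the straight line with velocity \<open>u\<close> they
  fail only to second order, by \<open>t\<^sup>2\<close> times a constant, and this is compensated by a translation
  \<open>t\<^sup>2 X\<close>.\<close>

lemma tangent_space_M_intro:
  assumes P: "P \<in> M" and u: "\<And>a \<alpha>. a \<in> \<Lambda> \<Longrightarrow> hk_constraint_deriv J \<theta> a \<alpha> P u = 0"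
  shows "u \<in> tangent_space M P"
proof -
  have "\<exists>X. Q X = 0 \<and> (\<forall>a\<in>\<Lambda>. X $ a = 0 \<and> (\<forall>\<alpha>. J \<alpha> (axis a 1) \<bullet> X =
      - (1/2 * (\<Sum>\<beta>\<in>UNIV. \<theta> $ \<beta> $ a * hopf (snd u $ \<beta>) (snd u $ \<beta>) $ \<alpha>))))"
    by (rule Q_onto) simp
  then obtain X where XX: "Q X = 0 \<and> (\<forall>a\<in>\<Lambda>. X $ a = 0 \<and> (\<forall>\<alpha>. J \<alpha> (axis a 1) \<bullet> X =
      - (1/2 * (\<Sum>\<beta>\<in>UNIV. \<theta> $ \<beta> $ a * hopf (snd u $ \<beta>) (snd u $ \<beta>) $ \<alpha>))))"
    ..
  have X: "J \<alpha> (axis a 1) \<bullet> X = - (1/2 * (\<Sum>\<beta>\<in>UNIV. \<theta> $ \<beta> $ a * hopf (snd u $ \<beta>) (snd u $ \<beta>) $ \<alpha>))"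
    if "a \<in> \<Lambda>" for a \<alpha>
    using XX that by blast
  define c where "c t = (fst P + t *\<^sub>R fst u + t\<^sup>2 *\<^sub>R X, snd P + t *\<^sub>R snd u)" for t
  have "c t \<in> M" for t
    unfolding M_iff
  proof (intro ballI allI)
    fix a \<alpha> assume a: "a \<in> \<Lambda>"
    have h: "hopf (w + t *\<^sub>R z) (w + t *\<^sub>R z) = hopf w w + (2 * t) *\<^sub>R hopf w z + t\<^sup>2 *\<^sub>R hopf z z" for w z
    proof -
      have double: "(2 * t) *\<^sub>R x = t *\<^sub>R x + t *\<^sub>R x" for x :: "real^3"
        by (simp add: scaleR_add_left[symmetric])
      show ?thesis
      unfolding double bounded_bilinear.add_left[OF bounded_bilinear_hopf] bounded_bilinear.add_right[OF bounded_bilinear_hopf]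
        bounded_bilinear.scaleR_left[OF bounded_bilinear_hopf] bounded_bilinear.scaleR_right[OF bounded_bilinear_hopf]
        hopf_commute[of z w]
      by (simp add: power2_eq_square scaleR_add_right)
    qed
    have "hk_constraint J \<theta> a \<alpha> (c t) = hk_constraint J \<theta> a \<alpha> P + t * hk_constraint_deriv J \<theta> a \<alpha> P u +
       t\<^sup>2 * (J \<alpha> (axis a 1) \<bullet> X + 1/2 * (\<Sum>\<beta>\<in>UNIV. \<theta> $ \<beta> $ a * hopf (snd u $ \<beta>) (snd u $ \<beta>) $ \<alpha>))"
      unfolding hk_constraint_def hk_constraint_deriv_def c_def
      by (simp add: h inner_add_right distrib_left sum.distrib sum_distrib_left mult_ac)
    then show "hk_constraint J \<theta> a \<alpha> (c t) = 0"
      using P u[OF a] X[OF a] a by (simp add: M_iff)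
  qed
  moreover have "c 0 = P" by (simp add: c_def)
  moreover have "(c has_vector_derivative u) (at 0)"
  proof -
    have "((\<lambda>t. fst P + t *\<^sub>R fst u + t\<^sup>2 *\<^sub>R X) has_vector_derivative fst u) (at 0)"
      by (auto intro!: derivative_eq_intros)
    moreover have "((\<lambda>t. snd P + t *\<^sub>R snd u) has_vector_derivative snd u) (at 0)"
      by (auto intro!: derivative_eq_intros)
    ultimately have "(c has_vector_derivative (fst u, snd u)) (at 0)"
      unfolding c_def by (rule has_vector_derivative_Pair)
    then show ?thesis by simp
  qed
  ultimately show ?thesis unfolding tangent_space_def by auto
qed

text \<open>Orthogonality to the velocity of the one-parameter group generated by \<open>e\<^sub>a\<close>.\<close>

lemma horizontal_space_imp:
  assumes P: "P \<in> M" and u: "u \<in> horizontal_space M \<pi> P" and a: "a \<in> \<Lambda>"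
  shows "fst u $ a = - (\<Sum>\<beta>\<in>UNIV. \<theta> $ \<beta> $ a * ((qunit 1 \<odot> snd P $ \<beta>) \<bullet> snd u $ \<beta>))"
proof -
  define v where "v = (axis a 1 :: real^'n, \<chi> \<beta>. \<theta> $ \<beta> $ a *\<^sub>R (qunit 1 \<odot> snd P $ \<beta>))"
  define c where "c t = (t *\<^sub>R axis a 1 + fst P, theta_act \<theta> (t *\<^sub>R axis a 1) (snd P))" for t :: real
  have c_orbit: "c t \<in> \<pi> P" for t
  proof -
    have "t *\<^sub>R axis a 1 \<in> lie_l \<Lambda>" using a by (auto simp: mem_lie_l axis_def)
    then show ?thesis unfolding orbit_iff c_def by blast
  qed
  have "c t \<in> {P' \<in> M. \<pi> P' = \<pi> P}" for t
    using orbit_subset_M[OF P c_orbit] orbit_eq[OF c_orbit] by simp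
  moreover have "c 0 = P" by (simp add: c_def theta_act_zero)
  moreover have "(c has_vector_derivative v) (at 0)"
    unfolding c_def v_def
  proof (rule has_vector_derivative_Pair)
    show "((\<lambda>t. t *\<^sub>R axis a 1 + fst P) has_vector_derivative axis a 1) (at 0)"
      by (auto intro!: derivative_eq_intros)
    have "((\<lambda>t. qexp_i (t * \<theta> $ \<beta> $ a) \<odot> snd P $ \<beta>) has_vector_derivative \<theta> $ \<beta> $ a *\<^sub>R (qunit 1 \<odot> snd P $ \<beta>)) (at 0)" for \<beta>
    proof -
      have "((\<lambda>t. t * \<theta> $ \<beta> $ a) has_vector_derivative \<theta> $ \<beta> $ a) (at 0)"
        by (auto intro!: derivative_eq_intros simp: has_real_derivative_iff_has_vector_derivative[symmetric])
      from vector_diff_chain_at[OF this has_vector_derivative_qexp_i]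
      show ?thesis by (simp add: o_def qexp_i_zero)
    qed
    then show "((\<lambda>t. theta_act \<theta> (t *\<^sub>R axis a 1) (snd P)) has_vector_derivative
        (\<chi> \<beta>. \<theta> $ \<beta> $ a *\<^sub>R (qunit 1 \<odot> snd P $ \<beta>))) (at 0)"
      unfolding theta_act_def
      by (intro has_vector_derivative_vec_lambda) (simp add: inner_axis')
  qed
  ultimately have "v \<in> tangent_space {P' \<in> M. \<pi> P' = \<pi> P} P"
    unfolding tangent_space_def by auto
  then have "u \<bullet> v = 0" using u unfolding horizontal_space_def by blast
  moreover have "u \<bullet> v = fst u $ a + (\<Sum>\<beta>\<in>UNIV. \<theta> $ \<beta> $ a * ((qunit 1 \<odot> snd P $ \<beta>) \<bullet> snd u $ \<beta>))"
  proof -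
    have "u \<bullet> v = fst u \<bullet> fst v + snd u \<bullet> snd v" by (rule inner_prod_def)
    also have "fst u \<bullet> fst v = fst u $ a" by (simp add: v_def inner_axis)
    also have "snd u \<bullet> snd v = (\<Sum>\<beta>\<in>UNIV. \<theta> $ \<beta> $ a * ((qunit 1 \<odot> snd P $ \<beta>) \<bullet> snd u $ \<beta>))"
      unfolding inner_quat_vec v_def snd_conv vec_lambda_beta inner_scaleR_right
      by (simp only: inner_commute)
    finally show ?thesis .
  qed
  ultimately show ?thesis by simp
qed

end

section \<open>The chart of the quotient\<close>

lemma smooth_on_qexp_i: "smooth_on UNIV qexp_i"
  unfolding qexp_i_def[abs_def]
  by (rule smooth_on_Pair[OF open_UNIV smooth_on_sin_cos(2)
        smooth_on_linear[OF open_UNIV bounded_linear_scaleR_left smooth_on_sin_cos(1)]])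

lemma bounded_linear_phase: "bounded_linear (\<lambda>P :: ('n::finite, 'q::finite) group_space. - (lproj \<Lambda> (fst P) \<bullet> \<theta>))"
proof -
  have "bounded_linear (lproj \<Lambda>)" using linear_lproj linear_conv_bounded_linear by blast
  from bounded_linear_minus[OF bounded_linear_compose[OF bounded_linear_inner_left bounded_linear_compose[OF this bounded_linear_fst]]]
  show ?thesis .
qed

lemma bounded_linear_snd_nth: "bounded_linear (\<lambda>P :: ('n::finite, 'q::finite) group_space. snd P $ \<beta>)"
  by (rule bounded_linear_compose[OF bounded_linear_vec_nth bounded_linear_snd])

lemma smooth_on_gauged: "smooth_on UNIV (\<lambda>P :: ('n::finite, 'q::finite) group_space. gauged \<theta> \<Lambda> P $ \<beta>)"
  unfolding gauged_nth
  by (rule smooth_on_bilinear[OF open_UNIV bounded_bilinear_qmul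
        smooth_on_compose[OF open_UNIV open_UNIV subset_UNIV
          smooth_on_bounded_linear[OF open_UNIV bounded_linear_phase] smooth_on_qexp_i]
        smooth_on_bounded_linear[OF open_UNIV bounded_linear_snd_nth]])

text \<open>A motion in \<open>\<l>\<close> rotates the gauged coordinate back along the Hopf fibre, whence the correction of the
  velocity by a multiple of \<open>i W\<close>.\<close>

lemma has_derivative_gauged:
  fixes P :: "('n::finite, 'q::finite) group_space"
  shows "((\<lambda>P. gauged \<theta> \<Lambda> P $ \<beta>) has_derivative
    (\<lambda>u. qexp_i (- (lproj \<Lambda> (fst P) \<bullet> \<theta> $ \<beta>)) \<odot>
       (snd u $ \<beta> - (lproj \<Lambda> (fst u) \<bullet> \<theta> $ \<beta>) *\<^sub>R (qunit 1 \<odot> snd P $ \<beta>)))) (at P)"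
proof -
  let ?s = "- (lproj \<Lambda> (fst P) \<bullet> \<theta> $ \<beta>)"
  have e: "((\<lambda>P :: ('n, 'q) group_space. qexp_i (- (lproj \<Lambda> (fst P) \<bullet> \<theta> $ \<beta>))) has_derivative
      (\<lambda>u. (- (lproj \<Lambda> (fst u) \<bullet> \<theta> $ \<beta>)) *\<^sub>R (qunit 1 \<odot> qexp_i ?s))) (at P)"
    by (rule has_derivative_compose[OF bounded_linear_imp_has_derivative[OF bounded_linear_phase] qexp_i_has_derivative])
  have "((\<lambda>P. gauged \<theta> \<Lambda> P $ \<beta>) has_derivative
      (\<lambda>u. qexp_i ?s \<odot> snd u $ \<beta> +
        ((- (lproj \<Lambda> (fst u) \<bullet> \<theta> $ \<beta>)) *\<^sub>R (qunit 1 \<odot> qexp_i ?s)) \<odot> snd P $ \<beta>)) (at P)"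
    unfolding gauged_nth
    by (rule bounded_bilinear.FDERIV[OF bounded_bilinear_qmul e
          bounded_linear_imp_has_derivative[OF bounded_linear_snd_nth]])
  moreover have "qexp_i ?s \<odot> z + ((- c) *\<^sub>R (qunit 1 \<odot> qexp_i ?s)) \<odot> w =
      qexp_i ?s \<odot> (z - c *\<^sub>R (qunit 1 \<odot> w))" for z w c
    by (simp add: bounded_bilinear.diff_right[OF bounded_bilinear_qmul] bounded_bilinear.scaleR_left[OF bounded_bilinear_qmul]
        bounded_bilinear.minus_left[OF bounded_bilinear_qmul]
        bounded_bilinear.scaleR_right[OF bounded_bilinear_qmul] qmul_assoc qexp_i_commute)
  ultimately show ?thesis by simp
qed

locale hk_chart = hk_quotient J \<theta> \<Lambda> I Q
  for J :: "3 \<Rightarrow> real^'n::finite \<Rightarrow> real^'n" and \<theta> :: "real^'n^'q::finite"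
    and \<Lambda> I :: "'n set" and Q :: "real^'n \<Rightarrow> real^'n" +
  fixes U :: "'q \<Rightarrow> (real^3) set" and A :: "'q \<Rightarrow> real^3 \<Rightarrow> real^3"
    and N :: "'q \<Rightarrow> quat set" and \<tau> :: "'q \<Rightarrow> quat \<Rightarrow> real"
  assumes chart: "hopf_chart (U \<beta>) (A \<beta>) (N \<beta>) (\<tau> \<beta>)"
begin

lemma open_N: "open (N \<beta>)"
  and N_nonzero: "W \<in> N \<beta> \<Longrightarrow> W \<noteq> 0"
  and N_hopf: "W \<in> N \<beta> \<Longrightarrow> hopf W W \<in> U \<beta>"
  and smooth_tau: "smooth_on (N \<beta>) (\<tau> \<beta>)"
  and has_derivative_tau: "W \<in> N \<beta> \<Longrightarrow> (\<tau> \<beta> has_derivative tau_form (A \<beta> (hopf W W)) W) (at W)"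
  and inj_tau: "inj_on (\<lambda>W. (\<tau> \<beta> W, hopf W W)) (N \<beta>)"
  and open_tau: "open ((\<lambda>W. (\<tau> \<beta> W, hopf W W)) ` N \<beta>)"
  using chart[of \<beta>] unfolding hopf_chart_def by blast+

text \<open>The chart, written on the level set, where it is the restriction of a smooth map of the ambient space.\<close>

definition coord :: "('n, 'q) group_space \<Rightarrow> ('n, 'q) coords" where
  "coord P = (Q (fst P), \<chi> \<beta>. \<tau> \<beta> (gauged \<theta> \<Lambda> P $ \<beta>), rvec P)"

text \<open>This formula for the differential of \<open>coord\<close> refers to \<open>snd P\<close> instead of the gauged coordinates because
  \<open>tau_form\<close> and \<open>hopf\<close> are invariant under the rotation that relates the two.\<close>

definition dcoord :: "('n, 'q) group_space \<Rightarrow> ('n, 'q) group_space \<Rightarrow> ('n, 'q) coords" where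
  "dcoord P u = (Q (fst u),
     \<chi> \<beta>. tau_form (A \<beta> (rvec P $ \<beta>)) (snd P $ \<beta>)
       (snd u $ \<beta> - (lproj \<Lambda> (fst u) \<bullet> \<theta> $ \<beta>) *\<^sub>R (qunit 1 \<odot> snd P $ \<beta>)),
     \<chi> \<beta>. 2 *\<^sub>R hopf (snd P $ \<beta>) (snd u $ \<beta>))"

definition dom :: "('n, 'q) group_space set" where
  "dom = {P. \<forall>\<beta>. gauged \<theta> \<Lambda> P $ \<beta> \<in> N \<beta>}"

definition D :: "('n, 'q) group_space set set" where
  "D = \<pi> ` (M \<inter> dom)"

text \<open>Any representative will do, by \<open>coord_orbit\<close>.\<close>

definition \<phi> :: "('n, 'q) group_space set \<Rightarrow> ('n, 'q) coords" where
  "\<phi> orb = coord (SOME P. P \<in> orb)"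

lemma coord_orbit: "P' \<in> \<pi> P \<Longrightarrow> coord P' = coord P"
proof -
  assume P': "P' \<in> \<pi> P"
  then obtain V where V: "V \<in> lie_l \<Lambda>" "P' = (V + fst P, theta_act \<theta> V (snd P))"
    unfolding orbit_iff by blast
  have "rvec P' = rvec P" using rvec_theta_act[of _ \<theta> V "snd P" "fst P"] by (simp add: V(2))
  moreover have "Q (fst P') = Q (fst P)"
    by (simp add: V(2) linear_add[OF linear_Q] lie_l_split(1)[OF V(1)])
  ultimately show ?thesis by (simp add: coord_def gauged_orbit[OF P'])
qed

lemma phi_orbit: "\<phi> (\<pi> P) = coord P"
  unfolding \<phi>_def by (rule coord_orbit, rule someI, rule orbit_self)

lemma phi_comp_orbit: "\<phi> \<circ> \<pi> = coord"
  by (simp add: fun_eq_iff phi_orbit)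

lemma orbit_in_D: "P \<in> M \<Longrightarrow> \<pi> P \<in> D \<longleftrightarrow> P \<in> dom"
proof
  assume P: "P \<in> M"
  assume "\<pi> P \<in> D"
  then obtain P' where P': "P' \<in> dom" "\<pi> P = \<pi> P'" unfolding D_def by blast
  then have "P \<in> \<pi> P'" using orbit_self by blast
  then show "P \<in> dom" using P'(1) by (simp add: dom_def gauged_orbit)
qed (auto simp: D_def)

lemma open_dom: "open dom"
proof -
  have c: "continuous_on UNIV (\<lambda>P. gauged \<theta> \<Lambda> P $ \<beta>)" for \<beta>
    by (rule smooth_on_imp_continuous_on[OF smooth_on_gauged])
  have "dom = (\<Inter>\<beta>. (\<lambda>P. gauged \<theta> \<Lambda> P $ \<beta>) -` N \<beta>)" by (auto simp: dom_def)
  also have "open \<dots>"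
    by (intro open_INT ballI open_vimage open_N c) simp
  finally show ?thesis .
qed

lemma dom_nonzero:
  assumes "P \<in> dom"
  shows "snd P $ \<beta> \<noteq> 0" "rvec P $ \<beta> \<noteq> 0" "rvec P $ \<beta> \<in> U \<beta>"
proof -
  have g: "gauged \<theta> \<Lambda> P $ \<beta> \<in> N \<beta>" using assms by (simp add: dom_def)
  have "gauged \<theta> \<Lambda> P $ \<beta> \<bullet> gauged \<theta> \<Lambda> P $ \<beta> = snd P $ \<beta> \<bullet> snd P $ \<beta>"
    unfolding gauged_nth by (rule qexp_i_inner)
  then show nz: "snd P $ \<beta> \<noteq> 0" using N_nonzero[OF g] by force
  show "rvec P $ \<beta> \<in> U \<beta>" using N_hopf[OF g] by (simp add: hopf_gauged)
  have "norm (rvec P $ \<beta>) = snd P $ \<beta> \<bullet> snd P $ \<beta>" by (simp add: rvec_hopf norm_hopf)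
  moreover have "snd P $ \<beta> \<bullet> snd P $ \<beta> \<noteq> 0" using nz inner_eq_zero_iff by blast
  ultimately show "rvec P $ \<beta> \<noteq> 0" by force
qed

lemma has_derivative_coord:
  assumes P: "P \<in> dom"
  shows "(coord has_derivative dcoord P) (at P)"
  unfolding coord_def[abs_def] dcoord_def[abs_def]
proof (intro has_derivative_Pair has_derivative_vec_lambda has_derivative_rvec)
  have "bounded_linear Q" using linear_Q linear_conv_bounded_linear by blast
  from bounded_linear_imp_has_derivative[OF bounded_linear_compose[OF this bounded_linear_fst]]
  show "((\<lambda>P. Q (fst P)) has_derivative (\<lambda>u. Q (fst u))) (at P)" .
  fix \<beta>
  have g: "gauged \<theta> \<Lambda> P $ \<beta> \<in> N \<beta>" using P by (simp add: dom_def)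
  let ?e = "qexp_i (- (lproj \<Lambda> (fst P) \<bullet> \<theta> $ \<beta>))"
  let ?z = "\<lambda>u. snd u $ \<beta> - (lproj \<Lambda> (fst u) \<bullet> \<theta> $ \<beta>) *\<^sub>R (qunit 1 \<odot> snd P $ \<beta>)"
  have "((\<lambda>P. \<tau> \<beta> (gauged \<theta> \<Lambda> P $ \<beta>)) has_derivative
      (\<lambda>u. tau_form (A \<beta> (hopf (gauged \<theta> \<Lambda> P $ \<beta>) (gauged \<theta> \<Lambda> P $ \<beta>))) (gauged \<theta> \<Lambda> P $ \<beta>) (?e \<odot> ?z u))) (at P)"
    by (rule has_derivative_compose[where g = "\<tau> \<beta>", OF has_derivative_gauged has_derivative_tau[OF g]])
  then show "((\<lambda>P. \<tau> \<beta> (gauged \<theta> \<Lambda> P $ \<beta>)) has_derivative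
      (\<lambda>u. tau_form (A \<beta> (rvec P $ \<beta>)) (snd P $ \<beta>) (?z u))) (at P)"
    unfolding gauged_nth[of \<theta> \<Lambda> P] tau_form_qexp_i qexp_i_hopf rvec_hopf vec_lambda_beta .
qed

lemma smooth_on_coord: "smooth_on dom coord"
  unfolding coord_def[abs_def]
proof (intro smooth_on_Pair open_dom)
  have "bounded_linear Q" using linear_Q linear_conv_bounded_linear by blast
  from smooth_on_bounded_linear[OF open_dom bounded_linear_compose[OF this bounded_linear_fst]]
  show "smooth_on dom (\<lambda>P. Q (fst P))" .
  show "smooth_on dom (\<lambda>P. \<chi> \<beta>. \<tau> \<beta> (gauged \<theta> \<Lambda> P $ \<beta>))"
  proof (rule smooth_on_vec_lambda[OF open_dom])
    fix \<beta>
    have "(\<lambda>P. gauged \<theta> \<Lambda> P $ \<beta>) ` dom \<subseteq> N \<beta>" by (auto simp: dom_def)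
    from smooth_on_compose[OF open_dom open_N this smooth_on_subset[OF smooth_on_gauged subset_UNIV] smooth_tau]
    show "smooth_on dom (\<lambda>P. \<tau> \<beta> (gauged \<theta> \<Lambda> P $ \<beta>))" .
  qed
  show "smooth_on dom rvec"
    unfolding rvec_hopf[abs_def]
  proof (rule smooth_on_vec_lambda[OF open_dom])
    fix \<beta>
    note s = smooth_on_bounded_linear[OF open_dom bounded_linear_snd_nth[of \<beta>]]
    show "smooth_on dom (\<lambda>P. hopf (snd P $ \<beta>) (snd P $ \<beta>))"
      by (rule smooth_on_bilinear[OF open_dom bounded_bilinear_hopf s s])
  qed
qed

text \<open>The generator of the circle action on the factor \<open>\<beta>\<close> leaves \<open>r\<close> fixed, and \<open>\<eta>\<close> has the
  value \<open>- 2\<close> on it.\<close>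

lemma dcoord_vertical:
  assumes P: "P \<in> dom"
  shows "dcoord P (0, axis \<beta> (qunit 1 \<odot> snd P $ \<beta>)) = (0, axis \<beta> (- 2), 0)"
proof -
  have "tau_form (A \<gamma> (rvec P $ \<gamma>)) (snd P $ \<gamma>) (axis \<beta> (qunit 1 \<odot> snd P $ \<beta>) $ \<gamma>) = axis \<beta> (- 2) $ \<gamma>" for \<gamma>
    using tau_form_vertical[OF dom_nonzero(1)[OF P]] linear_0[OF linear_tau_form]
    by (simp add: axis_def)
  moreover have "hopf (snd P $ \<gamma>) (axis \<beta> (qunit 1 \<odot> snd P $ \<beta>) $ \<gamma>) = 0" for \<gamma>
    using linear_0[OF linear_hopf_right] by (simp add: axis_def hopf_vertical)
  ultimately show ?thesis
    by (simp add: dcoord_def linear_0[OF linear_Q] linear_0[OF linear_lproj] vec_eq_iff)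
qed

lemma torus_derivative:
  assumes P: "P \<in> dom"
  shows "((\<lambda>t. coord (torus_act (axis \<beta> t) P)) has_vector_derivative (0, axis \<beta> (- 2), 0)) (at 0)"
proof -
  define c where "c t = torus_act (axis \<beta> t) P" for t
  have c: "c t = (fst P, \<chi> \<gamma>. qexp_i (axis \<beta> t $ \<gamma>) \<odot> snd P $ \<gamma>)" for t
    unfolding c_def by (cases P) simp
  have c0: "c 0 = P"
    by (simp add: c axis_def qexp_i_zero)
  have "((\<lambda>t. qexp_i (axis \<beta> t $ \<gamma>) \<odot> snd P $ \<gamma>) has_vector_derivative axis \<beta> (qunit 1 \<odot> snd P $ \<beta>) $ \<gamma>) (at 0)" for \<gamma>
    using has_vector_derivative_qexp_i[of "snd P $ \<beta>" 0] by (cases "\<gamma> = \<beta>") (simp_all add: axis_def qexp_i_zero)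
  then have "((\<lambda>t. \<chi> \<gamma>. qexp_i (axis \<beta> t $ \<gamma>) \<odot> snd P $ \<gamma>) has_vector_derivative
      (\<chi> \<gamma>. axis \<beta> (qunit 1 \<odot> snd P $ \<beta>) $ \<gamma>)) (at 0)"
    by (rule has_vector_derivative_vec_lambda)
  from has_vector_derivative_Pair[OF has_vector_derivative_const this, of "fst P"]
  have dc: "(c has_vector_derivative (0, axis \<beta> (qunit 1 \<odot> snd P $ \<beta>))) (at 0)"
    by (simp add: c[abs_def] vec_lambda_eta)
  have "((\<lambda>t. coord (c t)) has_derivative (\<lambda>t. dcoord P (t *\<^sub>R (0, axis \<beta> (qunit 1 \<odot> snd P $ \<beta>))))) (at 0)"
  proof (rule has_derivative_compose[where g = coord and f = c and g' = "dcoord P"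
        and f' = "\<lambda>t. t *\<^sub>R (0, axis \<beta> (qunit 1 \<odot> snd P $ \<beta>))"])
    show "(c has_derivative (\<lambda>t. t *\<^sub>R (0, axis \<beta> (qunit 1 \<odot> snd P $ \<beta>)))) (at 0)"
      using dc unfolding has_vector_derivative_def .
    show "(coord has_derivative dcoord P) (at (c 0))" unfolding c0 by (rule has_derivative_coord[OF P])
  qed
  then show ?thesis
    unfolding has_vector_derivative_def c_def
      linear_scale[OF has_derivative_linear[OF has_derivative_coord[OF P]]] dcoord_vertical[OF P] .
qed

subsection \<open>The metric\<close>

text \<open>Adding \<open>\<Omega> \<cdot> dr\<close> to \<open>d\<tau>\<close> leaves \<open>\<eta>\<close>, evaluated on the velocity of the gauged coordinates; its
  value there is \<open>- 2 (b\<^sub>\<beta>/|W\<^sub>\<beta>|\<^sup>2 - s)\<close>, where \<open>b\<^sub>\<beta> = \<langle>iW\<^sub>\<beta>, Z\<^sub>\<beta>\<rangle>\<close> and \<open>s = \<langle>Y, \<theta>\<^sub>\<beta>\<rangle>\<close> for the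
  component \<open>Y\<close> of \<open>u\<close> in \<open>\<l>\<close>.  Horizontality expresses \<open>s\<close> by \<open>b\<close>, with the Gram matrix of the
  rows of the truncated \<open>\<theta>\<close>, and \<open>1/|W\<^sub>\<beta>|\<^sup>2 = 1/|r\<^sub>\<beta>|\<close> supplies the diagonal of \<open>H\<close>.\<close>

lemma tau_coframe_horizontal:
  assumes P: "P \<in> M" "P \<in> dom" and u: "u \<in> horizontal_space M \<pi> P"
  shows "fst (snd (dcoord P u)) $ \<beta> + (\<Sum>\<delta>\<in>UNIV. Omega_mat A (rvec P) \<beta> \<delta> \<bullet> snd (snd (dcoord P u)) $ \<delta>) =
    - 2 * (Hmat \<theta> \<Lambda> (rvec P) *v (\<chi> \<gamma>. (qunit 1 \<odot> snd P $ \<gamma>) \<bullet> snd u $ \<gamma>)) $ \<beta>"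
proof -
  let ?W = "snd P $ \<beta>" and ?Z = "snd u $ \<beta>"
  define b where "b \<gamma> = (qunit 1 \<odot> snd P $ \<gamma>) \<bullet> snd u $ \<gamma>" for \<gamma>
  define s where "s = lproj \<Lambda> (fst u) \<bullet> \<theta> $ \<beta>"
  have w: "norm (rvec P $ \<beta>) = ?W \<bullet> ?W" by (simp add: rvec_hopf norm_hopf)
  have "(\<Sum>\<delta>\<in>UNIV. Omega_mat A (rvec P) \<beta> \<delta> \<bullet> snd (snd (dcoord P u)) $ \<delta>) =
      (\<Sum>\<delta>\<in>UNIV. if \<beta> = \<delta> then A \<delta> (rvec P $ \<delta>) \<bullet> snd (snd (dcoord P u)) $ \<delta> else 0)"
    by (rule sum.cong) (auto simp: Omega_mat_def)
  also have "\<dots> = 2 * (A \<beta> (rvec P $ \<beta>) \<bullet> hopf ?W ?Z)"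
    by (simp add: dcoord_def)
  finally have 1: "(\<Sum>\<delta>\<in>UNIV. Omega_mat A (rvec P) \<beta> \<delta> \<bullet> snd (snd (dcoord P u)) $ \<delta>) =
      2 * (A \<beta> (rvec P $ \<beta>) \<bullet> hopf ?W ?Z)" .
  have 2: "fst (snd (dcoord P u)) $ \<beta> =
      tau_form (A \<beta> (rvec P $ \<beta>)) ?W (?Z - s *\<^sub>R (qunit 1 \<odot> ?W))"
    by (simp add: dcoord_def s_def)
  have "\<dots> = tau_form (A \<beta> (rvec P $ \<beta>)) ?W ?Z - s * tau_form (A \<beta> (rvec P $ \<beta>)) ?W (qunit 1 \<odot> ?W)"
    by (simp add: linear_diff[OF linear_tau_form] linear_scale[OF linear_tau_form])
  also have "\<dots> = tau_form (A \<beta> (rvec P $ \<beta>)) ?W ?Z + 2 * s"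
    by (simp add: tau_form_vertical[OF dom_nonzero(1)[OF P(2)]])
  also have "\<dots> = - 2 * (b \<beta> / (?W \<bullet> ?W) - s) - 2 * (A \<beta> (rvec P $ \<beta>) \<bullet> hopf ?W ?Z)"
    by (simp add: tau_form_def b_def)
  finally have 3: "fst (snd (dcoord P u)) $ \<beta> = - 2 * (b \<beta> / (?W \<bullet> ?W) - s) - 2 * (A \<beta> (rvec P $ \<beta>) \<bullet> hopf ?W ?Z)"
    unfolding 2 .
  have "s = (\<Sum>a\<in>UNIV. if a \<in> \<Lambda> then fst u $ a * \<theta> $ \<beta> $ a else 0)"
    unfolding s_def inner_vec_def lproj_def by (auto intro!: sum.cong)
  also have "\<dots> = (\<Sum>a\<in>\<Lambda>. fst u $ a * \<theta> $ \<beta> $ a)" by (simp add: sum.If_cases)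
  also have "\<dots> = - (\<Sum>a\<in>\<Lambda>. \<theta> $ \<beta> $ a * (\<Sum>\<gamma>\<in>UNIV. \<theta> $ \<gamma> $ a * b \<gamma>))"
    unfolding sum_negf[symmetric]
    by (rule sum.cong) (simp_all add: horizontal_space_imp[OF P(1) u] b_def)
  also have "(\<Sum>a\<in>\<Lambda>. \<theta> $ \<beta> $ a * (\<Sum>\<gamma>\<in>UNIV. \<theta> $ \<gamma> $ a * b \<gamma>)) = (\<Sum>\<gamma>\<in>UNIV. (\<Sum>a\<in>\<Lambda>. \<theta> $ \<beta> $ a * \<theta> $ \<gamma> $ a) * b \<gamma>)"
    unfolding sum_distrib_left sum_distrib_right by (subst sum.swap) (simp add: mult.assoc)
  finally have s: "s = - (\<Sum>\<gamma>\<in>UNIV. (\<Sum>a\<in>\<Lambda>. \<theta> $ \<beta> $ a * \<theta> $ \<gamma> $ a) * b \<gamma>)" .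
  have "(Hmat \<theta> \<Lambda> (rvec P) *v (\<chi> \<gamma>. b \<gamma>)) $ \<beta> =
      (\<Sum>\<gamma>\<in>UNIV. (\<Sum>a\<in>\<Lambda>. \<theta> $ \<beta> $ a * \<theta> $ \<gamma> $ a) * b \<gamma> + (if \<gamma> = \<beta> then b \<gamma> / (?W \<bullet> ?W) else 0))"
    unfolding matrix_vector_mult_def vec_lambda_beta
    by (rule sum.cong) (auto simp: Hmat_nth w distrib_right)
  also have "\<dots> = b \<beta> / (?W \<bullet> ?W) - s"
    unfolding s sum.distrib by simp
  finally show ?thesis unfolding 1 3 b_def by simp
qed

text \<open>By \<open>tau_coframe_horizontal\<close> both terms of \<open>h\<^sub>1\<close> are values of the form of \<open>H\<close>.  Its part with
  \<open>\<theta>\<close> yields the components of the velocity of \<open>X\<close> along the \<open>e\<^sub>a\<close> (horizontality) and the \<open>J\<^sub>\<alpha> e\<^sub>a\<close>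
  (tangency to the level set); its diagonal part yields the inner product on \<open>\<H>\<^sup>q\<close>, by
  \<open>hopf_pythagoras\<close>.\<close>

lemma submersion_metric:
  assumes P: "P \<in> M" "P \<in> dom"
    and u: "u \<in> horizontal_space M \<pi> P" and v: "v \<in> horizontal_space M \<pi> P"
  shows "h_quot \<theta> \<Lambda> A (coord P) (dcoord P u) (dcoord P v) = u \<bullet> v"
proof -
  let ?H = "Hmat \<theta> \<Lambda> (rvec P)"
  define b where "b u = (\<chi> \<gamma>. (qunit 1 \<odot> snd P $ \<gamma>) \<bullet> snd u $ \<gamma>)" for u :: "('n, 'q) group_space"
  define h where "h u \<gamma> = hopf (snd P $ \<gamma>) (snd u $ \<gamma>)" for u :: "('n, 'q) group_space" and \<gamma>
  have w: "norm (rvec P $ \<beta>) = snd P $ \<beta> \<bullet> snd P $ \<beta>" for \<beta> by (simp add: rvec_hopf norm_hopf)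
  have w0: "snd P $ \<beta> \<bullet> snd P $ \<beta> \<noteq> 0" for \<beta>
    using dom_nonzero(2)[OF P(2), of \<beta>] unfolding w[symmetric] by simp
  have "h_quot \<theta> \<Lambda> A (coord P) (dcoord P u) (dcoord P v) =
      Q (fst u) \<bullet> Q (fst v) +
      (1/4 * (\<Sum>\<beta>\<in>UNIV. \<Sum>\<gamma>\<in>UNIV. ?H $ \<beta> $ \<gamma> * (snd (snd (dcoord P u)) $ \<beta> \<bullet> snd (snd (dcoord P v)) $ \<gamma>)) +
       1/4 * (\<Sum>\<beta>\<in>UNIV. \<Sum>\<gamma>\<in>UNIV. matrix_inv ?H $ \<beta> $ \<gamma> *
         ((fst (snd (dcoord P u)) $ \<beta> + (\<Sum>\<delta>\<in>UNIV. Omega_mat A (rvec P) \<beta> \<delta> \<bullet> snd (snd (dcoord P u)) $ \<delta>)) *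
          (fst (snd (dcoord P v)) $ \<gamma> + (\<Sum>\<delta>\<in>UNIV. Omega_mat A (rvec P) \<gamma> \<delta> \<bullet> snd (snd (dcoord P v)) $ \<delta>)))))"
    unfolding h_quot_def coord_def dcoord_def h0.simps h1.simps fst_conv snd_conv ..
  also have "\<dots> = Q (fst u) \<bullet> Q (fst v) + ((\<Sum>\<beta>\<in>UNIV. \<Sum>\<gamma>\<in>UNIV. ?H $ \<beta> $ \<gamma> * (h u \<beta> \<bullet> h v \<gamma>)) +
       (\<Sum>\<beta>\<in>UNIV. \<Sum>\<gamma>\<in>UNIV. matrix_inv ?H $ \<beta> $ \<gamma> * ((?H *v b u) $ \<beta> * (?H *v b v) $ \<gamma>)))"
    unfolding tau_coframe_horizontal[OF P u] tau_coframe_horizontal[OF P v] b_def[symmetric]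
    by (simp add: dcoord_def h_def sum_distrib_left)
  also have "(\<Sum>\<beta>\<in>UNIV. \<Sum>\<gamma>\<in>UNIV. matrix_inv ?H $ \<beta> $ \<gamma> * ((?H *v b u) $ \<beta> * (?H *v b v) $ \<gamma>)) =
      (\<Sum>\<beta>\<in>UNIV. \<Sum>\<gamma>\<in>UNIV. ?H $ \<beta> $ \<gamma> * (b u $ \<beta> \<bullet> b v $ \<gamma>))"
    unfolding inner_real_def by (rule Hmat_inverse_form[OF dom_nonzero(2)[OF P(2)]])
  also have "\<dots> = (\<Sum>a\<in>\<Lambda>. fst u $ a * fst v $ a) +
      (\<Sum>\<beta>\<in>UNIV. (b u $ \<beta> * b v $ \<beta>) / (snd P $ \<beta> \<bullet> snd P $ \<beta>))"
  proof -
    have "(\<Sum>\<beta>\<in>UNIV. \<theta> $ \<beta> $ a *\<^sub>R b u $ \<beta>) = - fst u $ a" if "u \<in> horizontal_space M \<pi> P" "a \<in> \<Lambda>" for u a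
      using horizontal_space_imp[OF P(1) that] by (simp add: b_def)
    then show ?thesis unfolding Hmat_bilinear w by (simp add: u v)
  qed
  also have "(\<Sum>\<beta>\<in>UNIV. \<Sum>\<gamma>\<in>UNIV. ?H $ \<beta> $ \<gamma> * (h u \<beta> \<bullet> h v \<gamma>)) =
      (\<Sum>a\<in>\<Lambda>. \<Sum>\<alpha>\<in>UNIV. (J \<alpha> (axis a 1) \<bullet> fst u) * (J \<alpha> (axis a 1) \<bullet> fst v)) +
      (\<Sum>\<beta>\<in>UNIV. (h u \<beta> \<bullet> h v \<beta>) / (snd P $ \<beta> \<bullet> snd P $ \<beta>))"
  proof -
    have "(\<Sum>\<beta>\<in>UNIV. \<theta> $ \<beta> $ a *\<^sub>R h u \<beta>) = (\<chi> \<alpha>. - (J \<alpha> (axis a 1) \<bullet> fst u))"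
      if u: "u \<in> horizontal_space M \<pi> P" and a: "a \<in> \<Lambda>" for u a
    proof -
      have "u \<in> tangent_space M P" using u unfolding horizontal_space_def by blast
      from tangent_space_M_imp[OF this a] show ?thesis
        by (simp add: vec_eq_iff h_def hk_constraint_deriv_def eq_neg_iff_add_eq_0 add.commute)
    qed
    then show ?thesis unfolding Hmat_bilinear w by (simp add: u v inner_vec_def)
  qed
  also have "Q (fst u) \<bullet> Q (fst v) +
      ((\<Sum>a\<in>\<Lambda>. \<Sum>\<alpha>\<in>UNIV. (J \<alpha> (axis a 1) \<bullet> fst u) * (J \<alpha> (axis a 1) \<bullet> fst v)) +
       (\<Sum>\<beta>\<in>UNIV. (h u \<beta> \<bullet> h v \<beta>) / (snd P $ \<beta> \<bullet> snd P $ \<beta>)) +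
      ((\<Sum>a\<in>\<Lambda>. fst u $ a * fst v $ a) +
       (\<Sum>\<beta>\<in>UNIV. (b u $ \<beta> * b v $ \<beta>) / (snd P $ \<beta> \<bullet> snd P $ \<beta>)))) =
      fst u \<bullet> fst v + (\<Sum>\<beta>\<in>UNIV. (b u $ \<beta> * b v $ \<beta> + h u \<beta> \<bullet> h v \<beta>) / (snd P $ \<beta> \<bullet> snd P $ \<beta>))"
    unfolding inner_split[of "fst u" "fst v"] add_divide_distrib sum.distrib by simp
  also have "(\<Sum>\<beta>\<in>UNIV. (b u $ \<beta> * b v $ \<beta> + h u \<beta> \<bullet> h v \<beta>) / (snd P $ \<beta> \<bullet> snd P $ \<beta>)) = snd u \<bullet> snd v"
    unfolding inner_quat_vec
  proof (rule sum.cong[OF refl])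
    fix \<beta>
    show "(b u $ \<beta> * b v $ \<beta> + h u \<beta> \<bullet> h v \<beta>) / (snd P $ \<beta> \<bullet> snd P $ \<beta>) = snd u $ \<beta> \<bullet> snd v $ \<beta>"
      unfolding b_def h_def vec_lambda_beta hopf_pythagoras[symmetric]
      by (rule nonzero_mult_div_cancel_left[OF w0])
  qed
  also have "fst u \<bullet> fst v + snd u \<bullet> snd v = u \<bullet> v" by (rule inner_prod_def[symmetric])
  finally show ?thesis .
qed

lemma dcoord_tangent_space:
  assumes P: "P \<in> M" "P \<in> dom"
  shows "dcoord P ` tangent_space M P = coord_space I"
proof (intro equalityI subsetI)
  fix y assume "y \<in> dcoord P ` tangent_space M P"
  then show "y \<in> coord_space I" by (auto simp: dcoord_def coord_space_def Q_supp)
next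
  fix y :: "('n, 'q) coords" assume y: "y \<in> coord_space I"
  obtain x t r where xtr: "y = (x, t, r)" by (cases y)
  have "\<forall>\<beta>. \<exists>Z. tau_form (A \<beta> (rvec P $ \<beta>)) (snd P $ \<beta>) Z = t $ \<beta> \<and> 2 *\<^sub>R hopf (snd P $ \<beta>) Z = r $ \<beta>"
    using surj_tau_form_hopf[OF dom_nonzero(1)[OF P(2)]] by blast
  then obtain Z where Z: "\<forall>\<beta>. tau_form (A \<beta> (rvec P $ \<beta>)) (snd P $ \<beta>) (Z \<beta>) = t $ \<beta> \<and>
      2 *\<^sub>R hopf (snd P $ \<beta>) (Z \<beta>) = r $ \<beta>"
    by (rule choice[THEN exE])
  have "\<forall>i. i \<notin> I \<longrightarrow> x $ i = 0" using y by (auto simp: xtr coord_space_def)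
  then have "\<exists>Y. Q Y = x \<and> (\<forall>a\<in>\<Lambda>. Y $ a = 0 \<and> (\<forall>\<alpha>. J \<alpha> (axis a 1) \<bullet> Y =
      - (\<Sum>\<beta>\<in>UNIV. \<theta> $ \<beta> $ a * hopf (snd P $ \<beta>) (Z \<beta>) $ \<alpha>)))"
    by (rule Q_onto)
  then obtain Y where Y: "Q Y = x \<and> (\<forall>a\<in>\<Lambda>. Y $ a = 0 \<and> (\<forall>\<alpha>. J \<alpha> (axis a 1) \<bullet> Y =
      - (\<Sum>\<beta>\<in>UNIV. \<theta> $ \<beta> $ a * hopf (snd P $ \<beta>) (Z \<beta>) $ \<alpha>)))" ..
  have "lproj \<Lambda> Y = 0" using Y by (simp add: lproj_def vec_eq_iff)
  moreover have "(\<chi> \<beta>. tau_form (A \<beta> (rvec P $ \<beta>)) (snd P $ \<beta>) (Z \<beta>)) = t"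
    using Z by (simp add: vec_eq_iff)
  moreover have "(\<chi> \<beta>. 2 *\<^sub>R hopf (snd P $ \<beta>) (Z \<beta>)) = r"
    using Z by (simp add: vec_eq_iff)
  ultimately have "dcoord P (Y, \<chi> \<beta>. Z \<beta>) = y"
    using Y by (simp add: dcoord_def xtr)
  moreover have "(Y, \<chi> \<beta>. Z \<beta>) \<in> tangent_space M P"
    by (rule tangent_space_M_intro[OF P(1)]) (use Y in \<open>simp add: hk_constraint_deriv_def\<close>)
  ultimately show "y \<in> dcoord P ` tangent_space M P" by (rule rev_image_eqI[OF _ sym, rotated])
qed

lemma coord_inj:
  assumes "P \<in> M" "P \<in> dom" "P' \<in> M" "P' \<in> dom" and eq: "coord P = coord P'"
  shows "\<pi> P = \<pi> P'"
proof (rule orbit_eqI[OF assms(1,3)])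
  show "Q (fst P) = Q (fst P')" using eq by (simp add: coord_def)
  have "gauged \<theta> \<Lambda> P $ \<beta> = gauged \<theta> \<Lambda> P' $ \<beta>" for \<beta>
  proof (rule inj_onD[OF inj_tau])
    have "rvec P = rvec P'" using eq by (simp add: coord_def)
    moreover have "\<tau> \<beta> (gauged \<theta> \<Lambda> P $ \<beta>) = \<tau> \<beta> (gauged \<theta> \<Lambda> P' $ \<beta>)"
      using eq by (simp add: coord_def vec_eq_iff)
    ultimately show "(\<tau> \<beta> (gauged \<theta> \<Lambda> P $ \<beta>), hopf (gauged \<theta> \<Lambda> P $ \<beta>) (gauged \<theta> \<Lambda> P $ \<beta>)) =
        (\<tau> \<beta> (gauged \<theta> \<Lambda> P' $ \<beta>), hopf (gauged \<theta> \<Lambda> P' $ \<beta>) (gauged \<theta> \<Lambda> P' $ \<beta>))"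
      by (simp only: hopf_gauged)
    show "gauged \<theta> \<Lambda> P $ \<beta> \<in> N \<beta>" "gauged \<theta> \<Lambda> P' $ \<beta> \<in> N \<beta>" using assms by (simp_all add: dom_def)
  qed
  then show "gauged \<theta> \<Lambda> P = gauged \<theta> \<Lambda> P'" by (simp add: vec_eq_iff)
qed

text \<open>The coordinates on the level set are unconstrained: \<open>r\<close> prescribes the components of \<open>X\<close> along the
  \<open>J\<^sub>\<alpha> e\<^sub>a\<close>, and the component in \<open>\<l>\<close> can be taken to be \<open>0\<close>, so that the gauged coordinates are the
  quaternionic ones.\<close>

lemma coord_image:
  "coord ` (M \<inter> dom) = coord_space I \<inter>
     {y. \<forall>\<beta>. (fst (snd y) $ \<beta>, snd (snd y) $ \<beta>) \<in> (\<lambda>W. (\<tau> \<beta> W, hopf W W)) ` N \<beta>}"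
proof (intro equalityI subsetI)
  fix y assume "y \<in> coord ` (M \<inter> dom)"
  then obtain P where P: "P \<in> dom" "y = coord P" by blast
  have "(fst (snd y) $ \<beta>, snd (snd y) $ \<beta>) \<in> (\<lambda>W. (\<tau> \<beta> W, hopf W W)) ` N \<beta>" for \<beta>
  proof (rule image_eqI)
    show "gauged \<theta> \<Lambda> P $ \<beta> \<in> N \<beta>" using P(1) by (simp add: dom_def)
    show "(fst (snd y) $ \<beta>, snd (snd y) $ \<beta>) = (\<tau> \<beta> (gauged \<theta> \<Lambda> P $ \<beta>), hopf (gauged \<theta> \<Lambda> P $ \<beta>) (gauged \<theta> \<Lambda> P $ \<beta>))"
      by (simp only: hopf_gauged P(2) coord_def fst_conv snd_conv vec_lambda_beta)
  qed
  moreover have "y \<in> coord_space I" by (simp add: P(2) coord_def coord_space_def Q_supp)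
  ultimately show "y \<in> coord_space I \<inter>
     {y. \<forall>\<beta>. (fst (snd y) $ \<beta>, snd (snd y) $ \<beta>) \<in> (\<lambda>W. (\<tau> \<beta> W, hopf W W)) ` N \<beta>}" by blast
next
  fix y assume y: "y \<in> coord_space I \<inter>
     {y. \<forall>\<beta>. (fst (snd y) $ \<beta>, snd (snd y) $ \<beta>) \<in> (\<lambda>W. (\<tau> \<beta> W, hopf W W)) ` N \<beta>}"
  obtain x t r where xtr: "y = (x, t, r)" by (cases y)
  have "\<forall>\<beta>. \<exists>W. W \<in> N \<beta> \<and> \<tau> \<beta> W = t $ \<beta> \<and> hopf W W = r $ \<beta>"
  proof
    fix \<beta>
    have "(t $ \<beta>, r $ \<beta>) \<in> (\<lambda>W. (\<tau> \<beta> W, hopf W W)) ` N \<beta>" using y by (simp add: xtr)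
    then obtain W where "W \<in> N \<beta>" "(t $ \<beta>, r $ \<beta>) = (\<tau> \<beta> W, hopf W W)" by (rule imageE)
    then have "W \<in> N \<beta> \<and> \<tau> \<beta> W = t $ \<beta> \<and> hopf W W = r $ \<beta>" by simp
    then show "\<exists>W. W \<in> N \<beta> \<and> \<tau> \<beta> W = t $ \<beta> \<and> hopf W W = r $ \<beta>" ..
  qed
  then obtain W where W: "\<forall>\<beta>. W \<beta> \<in> N \<beta> \<and> \<tau> \<beta> (W \<beta>) = t $ \<beta> \<and> hopf (W \<beta>) (W \<beta>) = r $ \<beta>"
    by (rule choice[THEN exE])
  have "\<forall>i. i \<notin> I \<longrightarrow> x $ i = 0" using y by (auto simp: xtr coord_space_def)
  then have "\<exists>X. Q X = x \<and> (\<forall>a\<in>\<Lambda>. X $ a = 0 \<and> (\<forall>\<alpha>. J \<alpha> (axis a 1) \<bullet> X =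
      - (1/2 * (\<Sum>\<beta>\<in>UNIV. \<theta> $ \<beta> $ a * r $ \<beta> $ \<alpha>))))"
    by (rule Q_onto)
  then obtain X where X: "Q X = x \<and> (\<forall>a\<in>\<Lambda>. X $ a = 0 \<and> (\<forall>\<alpha>. J \<alpha> (axis a 1) \<bullet> X =
      - (1/2 * (\<Sum>\<beta>\<in>UNIV. \<theta> $ \<beta> $ a * r $ \<beta> $ \<alpha>))))" ..
  let ?P = "(X, \<chi> \<beta>. W \<beta>)"
  have r: "rvec ?P = r" using W by (simp add: rvec_hopf vec_eq_iff)
  have "lproj \<Lambda> X = 0" using X by (simp add: lproj_def vec_eq_iff)
  then have g: "gauged \<theta> \<Lambda> ?P $ \<beta> = W \<beta>" for \<beta> by (simp add: gauged_nth qexp_i_zero)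
  have "?P \<in> M" using X by (simp add: M_iff hk_constraint_rvec r)
  moreover have "?P \<in> dom" using W by (simp add: dom_def g)
  moreover have "y = coord ?P" using W X by (simp add: coord_def g r xtr vec_eq_iff)
  ultimately show "y \<in> coord ` (M \<inter> dom)" by blast
qed

lemma quotient_chart: "quotient_chart M \<pi> (coord_space I) D \<phi>"
  unfolding quotient_chart_def phi_comp_orbit
proof (intro conjI ballI impI)
  have dom: "{P \<in> M. \<pi> P \<in> D} = M \<inter> dom" using orbit_in_D by blast
  show "D \<subseteq> \<pi> ` M" by (auto simp: D_def)
  show "openin (top_of_set M) {P \<in> M. \<pi> P \<in> D}"
    unfolding dom using open_dom by (rule openin_open_Int)
  show "inj_on \<phi> D"
  proof (rule inj_onI)
    fix x y assume "x \<in> D" "y \<in> D" and eq: "\<phi> x = \<phi> y"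
    then obtain P P' where P: "P \<in> M" "P \<in> dom" "x = \<pi> P" and P': "P' \<in> M" "P' \<in> dom" "y = \<pi> P'"
      unfolding D_def by blast
    from eq have "coord P = coord P'" unfolding P(3) P'(3) phi_orbit .
    then show "x = y" unfolding P(3) P'(3) by (rule coord_inj[OF P(1,2) P'(1,2)])
  qed
  have img: "\<phi> ` D = coord ` (M \<inter> dom)" unfolding D_def image_image phi_orbit ..
  have "{y :: ('n, 'q) coords. \<forall>\<beta>. (fst (snd y) $ \<beta>, snd (snd y) $ \<beta>) \<in> (\<lambda>W. (\<tau> \<beta> W, hopf W W)) ` N \<beta>} =
      (\<Inter>\<beta>. (\<lambda>y. (fst (snd y) $ \<beta>, snd (snd y) $ \<beta>)) -` ((\<lambda>W. (\<tau> \<beta> W, hopf W W)) ` N \<beta>))" by auto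
  also have "open \<dots>"
    by (intro open_INT ballI open_vimage open_tau continuous_intros) simp
  finally show "openin (top_of_set (coord_space I)) (\<phi> ` D)"
    unfolding img coord_image by (rule openin_open_Int)
  show "smooth_map_on {P \<in> M. \<pi> P \<in> D} coord"
    unfolding smooth_map_on_def dom using open_dom smooth_on_coord by blast
  fix P assume P: "P \<in> M" and "\<pi> P \<in> D"
  then have P': "P \<in> dom" by (simp add: orbit_in_D)
  have "frechet_derivative coord (at P within M) ` tangent_space M P = dcoord P ` tangent_space M P"
    by (rule image_cong[OF refl frechet_derivative_within_tangent[OF has_derivative_coord[OF P']]])
  then show "frechet_derivative coord (at P within M) ` tangent_space M P = coord_space I"
    using dcoord_tangent_space[OF P P'] by simp
qed

lemma adapted_chart: "adapted_chart J \<theta> \<Lambda> I U D \<phi>"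
  unfolding adapted_chart_def phi_orbit
proof (intro conjI quotient_chart ballI impI allI)
  fix P assume P: "P \<in> M" "\<pi> P \<in> D"
  then have P': "P \<in> dom" by (simp add: orbit_in_D)
  show "snd (snd (coord P)) = rvec P" by (simp add: coord_def)
  show "rvec P $ \<beta> \<noteq> 0" "rvec P $ \<beta> \<in> U \<beta>" for \<beta> using dom_nonzero[OF P'] by auto
next
  fix \<beta>
  have "((\<lambda>t. coord (torus_act (axis \<beta> t) P)) has_vector_derivative (0, axis \<beta> (- 2), 0)) (at 0)"
    if "P \<in> M" "\<pi> P \<in> D" for P
    using torus_derivative that orbit_in_D by blast
  then show "\<exists>c. c \<noteq> 0 \<and> (\<forall>P\<in>M. \<pi> P \<in> D \<longrightarrow>
        ((\<lambda>t. coord (torus_act (axis \<beta> t) P)) has_vector_derivative (0, axis \<beta> c, 0)) (at 0))"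
    by (intro exI[of _ "- 2"]) simp
qed

lemma submersion_metric_in_chart: "submersion_metric_in_chart M \<pi> D \<phi> (h_quot \<theta> \<Lambda> A)"
  unfolding submersion_metric_in_chart_def phi_comp_orbit phi_orbit Let_def
proof (intro ballI impI)
  fix P u v assume P: "P \<in> M" "\<pi> P \<in> D" and uv: "u \<in> horizontal_space M \<pi> P" "v \<in> horizontal_space M \<pi> P"
  then have P': "P \<in> dom" by (simp add: orbit_in_D)
  have "frechet_derivative coord (at P within M) w = dcoord P w" if "w \<in> horizontal_space M \<pi> P" for w
  proof (rule frechet_derivative_within_tangent[OF has_derivative_coord[OF P']])
    show "w \<in> tangent_space M P" using that unfolding horizontal_space_def by blast
  qed
  then show "h_quot \<theta> \<Lambda> A (coord P) (frechet_derivative coord (at P within M) u)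
      (frechet_derivative coord (at P within M) v) = u \<bullet> v"
    using submersion_metric[OF P(1) P' uv] uv by simp
qed

end

theorem theorem6p2:
  fixes p s k l :: nat
    and K \<Lambda> :: "'n::finite set"
    and \<theta> :: "real^'n^'q::finite"
    and J :: "3 \<Rightarrow> real^'n \<Rightarrow> real^'n"
  assumes "CARD('n) = 4 * p" and "s + k = 4 * p"
    and "card (- K) = s" and "card K = k"
    and "\<forall>\<beta> a. a \<notin> K \<longrightarrow> \<theta> $ \<beta> $ a = 0" and "rank \<theta> = k"
    and "\<Lambda> \<subseteq> K" and "card \<Lambda> = l"
    and "quaternionic_triple J"
    and isotropic: "\<forall>\<alpha>. \<forall>V\<in>lie_l \<Lambda>. \<forall>V'\<in>lie_l \<Lambda>.
           kahler_form J \<alpha> ((V, 0) :: ('n, 'q) group_space) (V', 0) = 0"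
  shows "\<exists>I. card I + 4 * l = 4 * p \<and>
    (\<forall>P\<in>zero_level J \<theta> \<Lambda>. (\<forall>\<beta>. rvec P $ \<beta> \<noteq> 0) \<longrightarrow>
       (\<exists>U \<Omega>. \<forall>\<beta>. rvec P $ \<beta> \<in> U \<beta> \<and> local_potential (U \<beta>) (\<Omega> \<beta>)) \<and>
       (\<forall>U \<Omega>. (\<forall>\<beta>. rvec P $ \<beta> \<in> U \<beta> \<and> local_potential (U \<beta>) (\<Omega> \<beta>)) \<longrightarrow>
          (\<exists>D \<phi>. orbit \<theta> \<Lambda> P \<in> D \<and> adapted_chart J \<theta> \<Lambda> I U D \<phi> \<and>
             submersion_metric_in_chart (zero_level J \<theta> \<Lambda>) (orbit \<theta> \<Lambda>) D \<phi>
               (h_quot \<theta> \<Lambda> \<Omega>))))"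
proof -
  have iso: "\<forall>\<alpha>. \<forall>V\<in>lie_l \<Lambda>. \<forall>V'\<in>lie_l \<Lambda>. J \<alpha> V \<bullet> V' = 0"
    using isotropic by (simp add: kahler_form_def)
  have lin: "linear (J \<alpha>)" for \<alpha>
    using \<open>quaternionic_triple J\<close> by (auto simp: quaternionic_triple_def orthogonal_transformation_def)
  obtain I :: "'n set" and Q :: "real^'n \<Rightarrow> real^'n" where card: "card I + 4 * card \<Lambda> = CARD('n)"
    and Q: "linear Q" "\<forall>X i. i \<notin> I \<longrightarrow> Q X $ i = 0"
      "\<forall>X Y. X \<bullet> Y = (\<Sum>a\<in>\<Lambda>. X $ a * Y $ a) +
         (\<Sum>a\<in>\<Lambda>. \<Sum>\<alpha>\<in>UNIV. (J \<alpha> (axis a 1) \<bullet> X) * (J \<alpha> (axis a 1) \<bullet> Y)) + Q X \<bullet> Q Y"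
      "\<forall>y c m. (\<forall>i. i \<notin> I \<longrightarrow> y $ i = 0) \<longrightarrow>
         (\<exists>X. Q X = y \<and> (\<forall>a\<in>\<Lambda>. X $ a = c a \<and> (\<forall>\<alpha>. J \<alpha> (axis a 1) \<bullet> X = m a \<alpha>)))"
    using hyperkaehler_splitting[OF \<open>quaternionic_triple J\<close> iso]
    by (elim exE conjE) (rule that, assumption+)
  have hk: "hk_quotient J \<Lambda> I Q"
    by (rule hk_quotient.intro, rule lin, rule Q(1), erule Q(2)[THEN spec, THEN spec, THEN mp],
        rule Q(3)[THEN spec, THEN spec], erule Q(4)[THEN spec, THEN spec, THEN spec, THEN mp])
  show ?thesis
  proof (intro exI[of _ I] conjI ballI impI allI)
    show "card I + 4 * l = 4 * p"
      using card assms(1) \<open>card \<Lambda> = l\<close> by simp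
    fix P :: "('n, 'q) group_space"
    assume P: "P \<in> zero_level J \<theta> \<Lambda>" and r: "\<forall>\<beta>. rvec P $ \<beta> \<noteq> 0"
    have "\<forall>\<beta>. \<exists>UA. rvec P $ \<beta> \<in> fst UA \<and> local_potential (fst UA) (snd UA)"
      using local_potential_exists r by simp
    from choice[OF this] obtain UA where
      UA: "\<forall>\<beta>. rvec P $ \<beta> \<in> fst (UA \<beta>) \<and> local_potential (fst (UA \<beta>)) (snd (UA \<beta>))" ..
    then show "\<exists>U \<Omega>. \<forall>\<beta>. rvec P $ \<beta> \<in> U \<beta> \<and> local_potential (U \<beta>) (\<Omega> \<beta>)"
      by (intro exI[of _ "\<lambda>\<beta>. fst (UA \<beta>)"] exI[of _ "\<lambda>\<beta>. snd (UA \<beta>)"])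
    fix U \<Omega> assume U: "\<forall>\<beta>. rvec P $ \<beta> \<in> U \<beta> \<and> local_potential (U \<beta>) (\<Omega> \<beta>)"
    have "\<forall>\<beta>. \<exists>N\<tau>. gauged \<theta> \<Lambda> P $ \<beta> \<in> fst N\<tau> \<and> hopf_chart (U \<beta>) (\<Omega> \<beta>) (fst N\<tau>) (snd N\<tau>)"
    proof
      fix \<beta>
      have "hopf (gauged \<theta> \<Lambda> P $ \<beta>) (gauged \<theta> \<Lambda> P $ \<beta>) \<in> U \<beta>" "local_potential (U \<beta>) (\<Omega> \<beta>)"
        using U by (simp_all only: hopf_gauged)
      from hopf_chart_exists[OF this]
      show "\<exists>N\<tau>. gauged \<theta> \<Lambda> P $ \<beta> \<in> fst N\<tau> \<and> hopf_chart (U \<beta>) (\<Omega> \<beta>) (fst N\<tau>) (snd N\<tau>)"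
        by simp
    qed
    from choice[OF this] obtain N\<tau> where
      N\<tau>: "\<forall>\<beta>. gauged \<theta> \<Lambda> P $ \<beta> \<in> fst (N\<tau> \<beta>) \<and> hopf_chart (U \<beta>) (\<Omega> \<beta>) (fst (N\<tau> \<beta>)) (snd (N\<tau> \<beta>))" ..
    interpret hk_chart J \<theta> \<Lambda> I Q U \<Omega> "\<lambda>\<beta>. fst (N\<tau> \<beta>)" "\<lambda>\<beta>. snd (N\<tau> \<beta>)"
      by (intro hk_chart.intro hk hk_chart_axioms.intro) (use N\<tau> in blast)
    have "P \<in> dom" using N\<tau> by (simp add: dom_def)
    then have "orbit \<theta> \<Lambda> P \<in> D" using orbit_in_D[OF P] by simp
    then show "\<exists>D \<phi>. orbit \<theta> \<Lambda> P \<in> D \<and> adapted_chart J \<theta> \<Lambda> I U D \<phi> \<and>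
        submersion_metric_in_chart (zero_level J \<theta> \<Lambda>) (orbit \<theta> \<Lambda>) D \<phi> (h_quot \<theta> \<Lambda> \<Omega>)"
      using adapted_chart submersion_metric_in_chart by (intro exI conjI)
  qed
qed

end
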